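(* Consider the overlaid primary and secondary networks on the unit square operating under the primary and secondary protocols described in the context. The primary network can achieve the following throughput per S-D pair $\lambda_p(n)$ and sum throughput $T_p(n)$ w.h.p.: $$\lambda_p(n)=\Theta\left(\sqrt{\frac{1}{n\log n}}\right)\quad\text{and}\quad T_p(n)=\Theta\left(\sqrt{\frac{n}{\log n}}\right).$$
   Context: W.h.p. means with probability tending to 1 as $n\to\infty$. $O,\Omega,\Theta$ have their usual asymptotic meaning; e.g. $\lambda_p(n)=\Theta(f(n))$ w.h.p. means there are deterministic constants $c_2>0$, $c_1<\infty$ with $p(c_2f(n)\le\lambda_p(n)\le c_1f(n))\to1$. $\log$ is the natural logarithm in the cell sizes. Network model. Primary nodes form a Poisson point process of density $n$ on the unit square and secondary nodes a Poisson point process of density $m=n^\beta$, $\beta>1$. Nodes of each network are randomly grouped into one-to-one source-destination (S-D) pairs. The channel power gain at distance $r$ is $g(r)=r^{-\alpha}$, $\alpha>2$, with noise power $N_0$ and unit bandwidth. An active transmitter (TX)/receiver (RX) pair at distance $d$ with transmit power $P$ has rate $\log\left(1+\frac{P g(d)}{N_0+I}\right)$, where $I$ is the total interference at the RX from all other active TXs of both networks (a TX of power $P'$ at distance $r$ contributes $P'g(r)$). Primary protocol. The unit square is divided into square primary cells of area $a_p=\frac{k_1\log n}{n}$, $k_1\ge1$, grouped into clusters of $25$ ($5\times5$) cells. Time is split into TDMA frames of 25 slots, each of length $t_p$; in each slot one cell per cluster is active, cells taking turns in round-robin fashion, with the same pattern in all clusters. The data path of an S-D pair is the horizontal line (HDP)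 followed by the vertical line (VDP) connecting source to destination. In each cell one node is the designated relay node (nodes take turns). When a cell is active, its slot is divided into packet slots, one for each data path passing through or originating from the cell: the relay transmits one packet for each path passing through the cell, then each source in the cell transmits one packet. Each packet goes to the relay node of the neighboring cell along the data path, or directly to the destination if that is the next hop (the destination may be in the same or a neighboring cell). Received packets are buffered and sent in the next active slot of the cell. TX power is $P_0a_p^{\alpha/2}$, $P_0$ constant. Secondary protocol. Same construction with square secondary cells of area $a_s=\frac{k_2\log m}{m}$, $k_2=k_1\ge1$, clusters of 25 cells, 25-slot TDMA, horizontal-then-vertical data paths, relay nodes, and TX power $P_1a_s^{\alpha/2}$, $P_1$ constant; one secondary TDMA frame has the duration $t_p$ of one primary slot. Around each primary cell containing an active primary TX there is a preservation region, a square of $M^2$ secondary cells, $M=\lfloor 3\sqrt{a_p/a_s}\rfloor+2$, in which no secondary node may transmit (but may receive). A relay node in a preservation region buffers packets until the region is cleared and its cell is active. Throughput. For a network with $n_t$ nodes, the throughput per S-D pair $\lambda(n_t)$ is the average data rate that each source can transmit to its destination w.h.p. in multi-hop fashion under the given scheduling scheme, i.e. $p\left(\min_{1\le i\le n_t/2}\liminf_{t\to\infty}\frac1tM_i(t)\ge\lambda(n_t)\right)\to1$ as $n_t\to\infty$, where $M_i(t)$ is the number of bits S-D pair $i$ transmitted in $t$ time slots. The sum throughput is $T(n_t)=\frac{n_t}{2}\lambda(n_t)$. For the primary network these are written $\lambda_p(n)$, $T_p(n)$. *)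

theory Defs
  imports "HOL-Probability.Probability" "HOL-Combinatorics.Permutations"
begin

section \<open>Random networks\<close>

type_synonym point = "real \<times> real"
type_synonym cell = "nat \<times> nat"

definition unit_square :: "point set" where
  "unit_square = {0..1} \<times> {0..1}"

text \<open>
  A realisation of one network.  The nodes are labelled by the numbers below \<open>node_count\<close>; the
  source-destination pair number \<open>i\<close> consists of the nodes labelled \<open>shuffle (2 * i)\<close> and
  \<open>shuffle (2 * i + 1)\<close>.  If the number of nodes is odd, one node is left without a partner;
  it can still act as a relay.
\<close>

record network =
  node_count :: nat
  node_pos :: "nat \<Rightarrow> point"
  shuffle :: "nat \<Rightarrow> nat"

definition pair_count :: "network \<Rightarrow> nat" where
  "pair_count \<nu> = node_count \<nu> div 2"

definition src :: "network \<Rightarrow> nat \<Rightarrow> nat" where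
  "src \<nu> i = shuffle \<nu> (2 * i)"

definition dst :: "network \<Rightarrow> nat \<Rightarrow> nat" where
  "dst \<nu> i = shuffle \<nu> (2 * i + 1)"

definition node_set :: "network \<Rightarrow> point set" where
  "node_set \<nu> = node_pos \<nu> ` {..<node_count \<nu>}"

text \<open>
  Poisson point process of density \<open>d\<close> on the unit square: Poisson counts with mean \<open>d\<close> times
  the area, independent over disjoint sets.
\<close>

definition poisson_process :: "'w measure \<Rightarrow> real \<Rightarrow> ('w \<Rightarrow> point set) \<Rightarrow> bool" where
  "poisson_process M d \<Phi> \<longleftrightarrow>
     prob_space M \<and>
     (\<forall>\<omega>\<in>space M. finite (\<Phi> \<omega>) \<and> \<Phi> \<omega> \<subseteq> unit_square) \<and>
     (\<forall>A\<in>sets borel. A \<subseteq> unit_square \<longrightarrow>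
        (\<lambda>\<omega>. card (\<Phi> \<omega> \<inter> A)) \<in> measurable M (count_space UNIV) \<and>
        (\<forall>k. measure M {\<omega>\<in>space M. card (\<Phi> \<omega> \<inter> A) = k} =
           (d * measure lborel A) ^ k / fact k * exp (- (d * measure lborel A)))) \<and>
     (\<forall>\<A>. finite \<A> \<longrightarrow> disjoint \<A> \<longrightarrow> (\<forall>A\<in>\<A>. A \<in> sets borel \<and> A \<subseteq> unit_square) \<longrightarrow>
        prob_space.indep_vars M (\<lambda>_. count_space UNIV) (\<lambda>A \<omega>. card (\<Phi> \<omega> \<inter> A)) \<A>)"

text \<open>
  A network whose nodes form a Poisson process and are grouped into pairs uniformly at random:
  conditionally on the number and the positions of the labelled nodes, \<open>shuffle\<close> is a uniformly
  distributed permutation of the labels.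
\<close>

definition random_network :: "'w measure \<Rightarrow> real \<Rightarrow> ('w \<Rightarrow> network) \<Rightarrow> bool" where
  "random_network M d \<N> \<longleftrightarrow>
     poisson_process M d (\<lambda>\<omega>. node_set (\<N> \<omega>)) \<and>
     (\<lambda>\<omega>. node_count (\<N> \<omega>)) \<in> measurable M (count_space UNIV) \<and>
     (\<lambda>\<omega>. node_pos (\<N> \<omega>)) \<in> measurable M (PiM UNIV (\<lambda>_. borel)) \<and>
     (\<forall>\<omega>\<in>space M. inj_on (node_pos (\<N> \<omega>)) {..<node_count (\<N> \<omega>)} \<and>
        shuffle (\<N> \<omega>) permutes {..<node_count (\<N> \<omega>)}) \<and>
     (\<forall>k \<pi> B. \<pi> permutes {..<k} \<longrightarrow> B \<in> sets (PiM UNIV (\<lambda>_. borel)) \<longrightarrow>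
        {\<omega>\<in>space M. node_count (\<N> \<omega>) = k \<and> node_pos (\<N> \<omega>) \<in> B \<and> shuffle (\<N> \<omega>) = \<pi>} \<in> sets M \<and>
        measure M {\<omega>\<in>space M. node_count (\<N> \<omega>) = k \<and> node_pos (\<N> \<omega>) \<in> B \<and> shuffle (\<N> \<omega>) = \<pi>} =
          measure M {\<omega>\<in>space M. node_count (\<N> \<omega>) = k \<and> node_pos (\<N> \<omega>) \<in> B} / fact k)"


section \<open>Cells, data paths and the TDMA schedule of one network\<close>

text \<open>
  The unit square is tiled by \<open>q \<times> q\<close> cells.  Cells of area exactly \<open>k * ln d / d\<close> need not tile
  the square, so the number of cells per side is rounded down; the cell area \<open>1 / q\<^sup>2\<close> is then
  at least \<open>k * ln d / d\<close> and asymptotically equal to it.  The actual cell area is the one used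
  for the transmit powers and the preservation regions.
\<close>

definition cells_per_side :: "real \<Rightarrow> real \<Rightarrow> nat" where
  "cells_per_side k d = nat \<lfloor>1 / sqrt (k * ln d / d)\<rfloor>"

definition cell_index :: "nat \<Rightarrow> real \<Rightarrow> nat" where
  "cell_index q x = min (nat \<lfloor>real q * x\<rfloor>) (q - 1)"

definition cell_of :: "nat \<Rightarrow> network \<Rightarrow> nat \<Rightarrow> cell" where
  "cell_of q \<nu> v = (cell_index q (fst (node_pos \<nu> v)), cell_index q (snd (node_pos \<nu> v)))"

definition cell_nodes :: "nat \<Rightarrow> network \<Rightarrow> cell \<Rightarrow> nat list" where
  "cell_nodes q \<nu> c = filter (\<lambda>v. cell_of q \<nu> v = c) [0..<node_count \<nu>]"

definition walk :: "nat \<Rightarrow> nat \<Rightarrow> nat list" where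
  "walk a b = (if a \<le> b then [a..<Suc b] else rev [b..<Suc a])"

text \<open>
  The cells met by the horizontal line from the source to the abscissa of the destination,
  followed by the vertical line to the destination.
\<close>

definition route :: "nat \<Rightarrow> network \<Rightarrow> nat \<Rightarrow> cell list" where
  "route q \<nu> i =
     (let (a, b) = cell_of q \<nu> (src \<nu> i); (a', b') = cell_of q \<nu> (dst \<nu> i)
      in map (\<lambda>x. (x, b)) (walk a a') @ map (\<lambda>y. (a', y)) (tl (walk b b')))"

text \<open>
  Hop \<open>h\<close> starts in the cell \<open>route ! h\<close>.  If source and destination lie in the same cell, there
  is a single hop.
\<close>

definition hop_count :: "nat \<Rightarrow> network \<Rightarrow> nat \<Rightarrow> nat" where
  "hop_count q \<nu> i = max 1 (length (route q \<nu> i) - 1)"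

definition phase :: "cell \<Rightarrow> nat" where
  "phase c = fst c mod 5 + 5 * (snd c mod 5)"

definition active :: "nat \<Rightarrow> cell \<Rightarrow> bool" where
  "active s c \<longleftrightarrow> s mod 25 = phase c"

text \<open>
  The nodes of a cell take turns as relay; the turn passes on directly after an active slot of
  the cell, so that a node that received packets is still the relay in the next active slot.
  Meaningful for nonempty cells only.
\<close>

definition relay :: "nat \<Rightarrow> network \<Rightarrow> nat \<Rightarrow> cell \<Rightarrow> nat" where
  "relay q \<nu> s c =
     (let vs = cell_nodes q \<nu> c in vs ! (((s + 24 - phase c) div 25) mod length vs))"

text \<open>
  A task \<open>(i, h)\<close> is the transmission of a packet of pair \<open>i\<close> over hop \<open>h\<close> of its route.
\<close>

definition sender :: "nat \<Rightarrow> network \<Rightarrow> nat \<Rightarrow> nat \<times> nat \<Rightarrow> nat" where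
  "sender q \<nu> s = (\<lambda>(i, h). if h = 0 then src \<nu> i else relay q \<nu> s (route q \<nu> i ! h))"

definition receiver :: "nat \<Rightarrow> network \<Rightarrow> nat \<Rightarrow> nat \<times> nat \<Rightarrow> nat" where
  "receiver q \<nu> s = (\<lambda>(i, h). if Suc h = hop_count q \<nu> i then dst \<nu> i
     else relay q \<nu> s (route q \<nu> i ! Suc h))"

definition tasks :: "nat \<Rightarrow> network \<Rightarrow> cell \<Rightarrow> (nat \<times> nat) list" where
  "tasks q \<nu> c =
     [(i, h). i \<leftarrow> [0..<pair_count \<nu>], h \<leftarrow> [1..<hop_count q \<nu> i], route q \<nu> i ! h = c] @
     [(i, 0). i \<leftarrow> [0..<pair_count \<nu>], route q \<nu> i ! 0 = c]"

text \<open>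
  A slot has length \<open>T\<close> and is split into equal packet slots, one for each task of the cell;
  \<open>u\<close> is the time elapsed since the beginning of the slot.
\<close>

definition current_task :: "nat \<Rightarrow> network \<Rightarrow> real \<Rightarrow> real \<Rightarrow> cell \<Rightarrow> nat \<times> nat" where
  "current_task q \<nu> T u c =
     tasks q \<nu> c ! nat \<lfloor>real (length (tasks q \<nu> c)) * u / T\<rfloor>"

definition transmitters :: "nat \<Rightarrow> network \<Rightarrow> real \<Rightarrow> nat \<Rightarrow> real \<Rightarrow> nat set" where
  "transmitters q \<nu> T s u =
     {v. v < node_count \<nu> \<and> active s (cell_of q \<nu> v) \<and> tasks q \<nu> (cell_of q \<nu> v) \<noteq> [] \<and>
         v = sender q \<nu> s (current_task q \<nu> T u (cell_of q \<nu> v))}"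


section \<open>The overlaid networks\<close>

text \<open>
  \<open>tp\<close> is the length of a primary slot; \<open>qp\<close> and \<open>qs\<close> are the numbers of primary and secondary
  cells per side; \<open>s\<close> always counts primary slots and \<open>u\<close> is the time since the beginning of
  slot \<open>s\<close>.
\<close>

locale overlay =
  fixes \<alpha> N0 P0 P1 tp :: real
    and qp qs :: nat
    and pri sec :: network
begin

definition gain :: "real \<Rightarrow> real" where
  "gain r = r powr (- \<alpha>)"

definition pri_power :: real where
  "pri_power = P0 * (1 / real qp ^ 2) powr (\<alpha> / 2)"

definition sec_power :: real where
  "sec_power = P1 * (1 / real qs ^ 2) powr (\<alpha> / 2)"

definition pri_tx :: "nat \<Rightarrow> real \<Rightarrow> nat set" where
  "pri_tx s u = transmitters qp pri tp s u"

text \<open>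
  The preservation region of a primary cell is the square with the same centre and with the side
  of \<open>region_width\<close> secondary cells.
\<close>

definition region_width :: nat where
  "region_width = nat \<lfloor>3 * sqrt ((1 / real qp ^ 2) / (1 / real qs ^ 2))\<rfloor> + 2"

definition preservation_region :: "cell \<Rightarrow> point set" where
  "preservation_region c =
     {z. \<bar>fst z - (real (fst c) + 1 / 2) / real qp\<bar> \<le> real region_width / (2 * real qs) \<and>
         \<bar>snd z - (real (snd c) + 1 / 2) / real qp\<bar> \<le> real region_width / (2 * real qs)}"

text \<open>
  A secondary frame of 25 slots fills one primary slot, so primary slot \<open>s\<close> consists of the
  secondary slots \<open>25 * s, \<dots>, 25 * s + 24\<close>, each of length \<open>tp / 25\<close>.
\<close>

definition sec_tx :: "nat \<Rightarrow> real \<Rightarrow> nat set" where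
  "sec_tx s u =
     (let j = nat \<lfloor>25 * u / tp\<rfloor>
      in {v \<in> transmitters qs sec (tp / 25) (25 * s + j) (u - real j * (tp / 25)).
            \<forall>w\<in>pri_tx s u. node_pos sec v \<notin> preservation_region (cell_of qp pri w)})"

definition interference :: "nat \<Rightarrow> real \<Rightarrow> nat \<Rightarrow> point \<Rightarrow> real" where
  "interference s u v z =
     (\<Sum>w\<in>pri_tx s u - {v}. pri_power * gain (dist (node_pos pri w) z)) +
     (\<Sum>w\<in>sec_tx s u. sec_power * gain (dist (node_pos sec w) z))"

definition rate :: "nat \<Rightarrow> real \<Rightarrow> nat \<Rightarrow> nat \<Rightarrow> real" where
  "rate s u v w =
     ln (1 + pri_power * gain (dist (node_pos pri v) (node_pos pri w)) /
             (N0 + interference s u v (node_pos pri w)))"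

text \<open>
  The number of bits that fit into the packet slot of a primary task in slot \<open>s\<close>.  The rate is
  integrated because the set of interferers changes during the packet slot.
\<close>

definition capacity :: "nat \<Rightarrow> nat \<times> nat \<Rightarrow> real" where
  "capacity s k =
     (let c = route qp pri (fst k) ! snd k
      in if active s c
         then integral {u \<in> {0..<tp}. current_task qp pri tp u c = k}
                (\<lambda>u. rate s u (sender qp pri s k) (receiver qp pri s k))
         else 0)"

text \<open>
  \<open>held i s v\<close> is the number of bits of pair \<open>i\<close> that node \<open>v\<close> has received and not passed on
  before slot \<open>s\<close>.  Sources always have data to send; a relay sends at most what it has buffered.
\<close>

definition sent :: "(nat \<Rightarrow> real) \<Rightarrow> nat \<Rightarrow> nat \<times> nat \<Rightarrow> real" where
  "sent b s k = (if snd k = 0 then capacity s k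
     else min (capacity s k) (b (sender qp pri s k)))"

primrec held :: "nat \<Rightarrow> nat \<Rightarrow> nat \<Rightarrow> real" where
  "held i 0 = (\<lambda>v. 0)"
| "held i (Suc s) = (\<lambda>v. held i s v +
     (\<Sum>h | h < hop_count qp pri i \<and> receiver qp pri s (i, h) = v. sent (held i s) s (i, h)) -
     (\<Sum>h | 0 < h \<and> h < hop_count qp pri i \<and> sender qp pri s (i, h) = v. sent (held i s) s (i, h)))"

text \<open>The bits of pair \<open>i\<close> that have reached the destination after \<open>t\<close> slots.\<close>

definition delivered :: "nat \<Rightarrow> nat \<Rightarrow> real" where
  "delivered i t = held i t (dst pri i)"

text \<open>The largest rate that every primary pair achieves in this realisation, and the resulting sum
  throughput.\<close>

definition throughput :: ereal where
  "throughput = (INF i\<in>{..<pair_count pri}. liminf (\<lambda>t. ereal (delivered i t / real t)))"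

definition sum_throughput :: ereal where
  "sum_throughput = ereal (real (node_count pri) / 2) * throughput"

end


section \<open>Asymptotics with high probability\<close>

text \<open>
  \<open>Q\<close> holds with probability tending to 1.  For measurable \<open>Q n\<close> this is convergence of the
  probability of \<open>Q n\<close> to 1; stated with measurable subevents because \<open>measure\<close> is 0 on
  nonmeasurable sets.
\<close>

definition whp :: "(real \<Rightarrow> 'w measure) \<Rightarrow> (real \<Rightarrow> 'w \<Rightarrow> bool) \<Rightarrow> bool" where
  "whp M Q \<longleftrightarrow>
     (\<exists>A. (\<forall>n. A n \<in> sets (M n) \<and> (\<forall>\<omega>\<in>A n. Q n \<omega>)) \<and>
          ((\<lambda>n. measure (M n) (A n)) \<longlongrightarrow> 1) at_top)"

definition whp_Theta :: "(real \<Rightarrow> 'w measure) \<Rightarrow> (real \<Rightarrow> 'w \<Rightarrow> ereal) \<Rightarrow> (real \<Rightarrow> real) \<Rightarrow> bool" where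
  "whp_Theta M X f \<longleftrightarrow>
     (\<exists>c1 c2. 0 < c2 \<and> whp M (\<lambda>n \<omega>. ereal (c2 * f n) \<le> X n \<omega> \<and> X n \<omega> \<le> ereal (c1 * f n)))"

end

theory Submission
  imports Defs
begin

text \<open>Probability is confined to showing that a realisation is \<open>typical\<close>; the
  throughput bounds are deterministic statements about one fixed realisation in
  \<open>regular_overlay\<close>. The lower bound works for every pairing of the nodes; uniformity
  of the pairing enters only through the upper bound.

  Chebyshev's inequality shapes \<open>typical\<close>. Its failure probability, of order
  \<open>1 / mean\<close>, can be summed over the \<open>q\<close> rows and columns, but not over
  all \<open>q ^ 2\<close> cells, whose means are only of order \<open>ln d\<close>. Hence a general
  cell is only required to be nonempty, which follows from the exact Poisson probability
  \<open>exp (- d / q ^ 2) \<le> 1 / d\<close>, and node numbers are controlled in the single middle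
  cell. All failures together are \<open>O(q ^ 2 / d)\<close>, that is \<open>O(1 / ln d)\<close>.

  The hop used for the upper bound must be sent by a relay. A first hop is always sent by the same
  source, which may lie arbitrarily close to the border, and no averaging over the cell would help.
  This is why the sources are taken strictly to the left of the middle cell.\<close>

text \<open>
  Only the positions and the pairing of the primary nodes matter; the secondary network enters
  through the fact that at most one node per secondary cell transmits.

  Lower bound.  Around every primary receiver the interferers lie in distinct cells, outside the
  immediate neighbourhood of the receiver because of the reuse pattern and of the preservation
  regions.  Comparing with the lattice sum of \<open>max 1 (max \<bar>x\<bar> \<bar>y\<bar>) powr (- \<alpha>)\<close>, which
  converges for \<open>\<alpha> > 2\<close>, bounds the interference and hence bounds every rate from below by a
  constant.  With \<open>q\<close> cells per side, a cell carries at most one path per node of its row and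
  column, that is \<open>O(n / q)\<close> paths, and a constant flow of \<open>\<kappa>\<close> bits per frame is
  propagated along each path.

  Upper bound.  By a second moment estimate over uniform permutations, \<open>\<Omega>(n / q)\<close> pairs have their
  source in the bottom row left of its middle cell and their destination right of it, so the middle
  cell is shared by that many paths.  The flow through one of its hops is at most the time average
  of the rate, which is unbounded for close nodes; but the distance to the receiver is at least the
  distance \<open>y\<close> (in units of cells) of the relay to the right border, the relays take turns, and the
  average of \<open>ln (1 / y)\<close> over the nodes of the cell is bounded by counting the nodes in geometrically shrinking strips
  along the border.
\<close>

section \<open>Poisson counts\<close>

text \<open>The factorial moments follow from the shift
  \<open>(k + 1) * p (k + 1) = \<mu> * p k\<close>; the square is then expanded as
  \<open>k (k - 1) + (1 - 2 \<mu>) k + \<mu>\<^sup>2\<close>. The factor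
  \<open>exp (- \<mu>)\<close> is multiplied in last, so that only the exponential series has to be
  summed.\<close>

lemma poisson_second_central_moment:
  fixes \<mu> :: real
  shows "(\<lambda>k. (real k - \<mu>)\<^sup>2 * (\<mu> ^ k / fact k * exp (- \<mu>))) sums \<mu>"
proof -
  define p where "p k = \<mu> ^ k / fact k" for k :: nat
  have p: "p sums exp \<mu>"
    unfolding p_def using exp_converges[of \<mu>] by (simp add: field_simps)
  have pS: "real (Suc k) * p (Suc k) = \<mu> * p k" for k
    by (simp add: p_def del: of_nat_Suc)
  have "(\<lambda>k. real (Suc k) * p (Suc k)) sums (\<mu> * exp \<mu>)"
    unfolding pS by (intro sums_mult p)
  then have p1: "(\<lambda>k. real k * p k) sums (\<mu> * exp \<mu>)"
    using sums_Suc_iff[of "\<lambda>k. real k * p k"] by simp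
  have "(\<lambda>k. real (Suc k) * real k * p (Suc k)) sums (\<mu> * (\<mu> * exp \<mu>))"
  proof -
    have "real (Suc k) * real k * p (Suc k) = \<mu> * (real k * p k)" for k
      using pS[of k] by (metis mult.assoc mult.commute)
    then show ?thesis by (simp only:) (intro sums_mult p1)
  qed
  then have p2: "(\<lambda>k. real k * (real k - 1) * p k) sums (\<mu> * (\<mu> * exp \<mu>))"
    using sums_Suc_iff[of "\<lambda>k. real k * (real k - 1) * p k"] by simp
  have "(\<lambda>k. exp (- \<mu>) * (real k * (real k - 1) * p k + (1 - 2 * \<mu>) * (real k * p k) + \<mu>\<^sup>2 * p k))
      sums (exp (- \<mu>) * (\<mu> * (\<mu> * exp \<mu>) + (1 - 2 * \<mu>) * (\<mu> * exp \<mu>) + \<mu>\<^sup>2 * exp \<mu>))"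
    by (intro sums_mult sums_add p p1 p2)
  moreover have "exp (- \<mu>) * (real k * (real k - 1) * p k + (1 - 2 * \<mu>) * (real k * p k) + \<mu>\<^sup>2 * p k)
      = (real k - \<mu>)\<^sup>2 * (\<mu> ^ k / fact k * exp (- \<mu>))" for k
    unfolding p_def[symmetric] by (simp add: algebra_simps power2_eq_square)
  moreover have "exp (- \<mu>) * (\<mu> * (\<mu> * exp \<mu>) + (1 - 2 * \<mu>) * (\<mu> * exp \<mu>) + \<mu>\<^sup>2 * exp \<mu>) = \<mu>"
  proof -
    have "\<mu> * (\<mu> * exp \<mu>) + (1 - 2 * \<mu>) * (\<mu> * exp \<mu>) + \<mu>\<^sup>2 * exp \<mu> = \<mu> * exp \<mu>"
      by (simp add: algebra_simps power2_eq_square)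
    then show ?thesis by (simp add: exp_minus)
  qed
  ultimately show ?thesis by simp
qed

text \<open>The event is split by the value of \<open>X\<close>, and the resulting series is
  compared termwise with that of the second central moment; no expectation of \<open>X\<close> has
  to be formed.\<close>

lemma (in prob_space) poisson_chebyshev:
  fixes X :: "'a \<Rightarrow> nat"
  assumes X: "X \<in> measurable M (count_space UNIV)"
    and distr: "\<And>k. prob {\<omega>\<in>space M. X \<omega> = k} = \<mu> ^ k / fact k * exp (- \<mu>)"
    and t: "t > 0"
  shows "prob {\<omega>\<in>space M. t \<le> \<bar>real (X \<omega>) - \<mu>\<bar>} \<le> \<mu> / t\<^sup>2"
proof -
  define A where "A k = (if t \<le> \<bar>real k - \<mu>\<bar> then {\<omega>\<in>space M. X \<omega> = k} else {})" for k
  have A: "range A \<subseteq> events"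
    using X by (auto simp: A_def)
  have "disjoint_family A"
    by (auto simp: disjoint_family_on_def A_def)
  from finite_measure_UNION[OF A this]
  have 1: "(\<lambda>k. prob (A k)) sums prob (\<Union>k. A k)" .
  have 2: "(\<lambda>k. (real k - \<mu>)\<^sup>2 * (\<mu> ^ k / fact k * exp (- \<mu>)) / t\<^sup>2) sums (\<mu> / t\<^sup>2)"
    by (intro sums_divide poisson_second_central_moment)
  have "prob (A k) \<le> (real k - \<mu>)\<^sup>2 * (\<mu> ^ k / fact k * exp (- \<mu>)) / t\<^sup>2" for k
  proof (cases "t \<le> \<bar>real k - \<mu>\<bar>")
    case True
    then have "t\<^sup>2 \<le> (real k - \<mu>)\<^sup>2"
      using t by (metis abs_of_pos abs_le_square_iff)
    then have "1 \<le> (real k - \<mu>)\<^sup>2 / t\<^sup>2"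
      using t by (simp add: field_simps)
    from mult_right_mono[OF this measure_nonneg[of M "{\<omega>\<in>space M. X \<omega> = k}"]] True
    show ?thesis by (simp add: A_def distr mult.commute)
  next
    case False
    have "0 \<le> (real k - \<mu>)\<^sup>2 * prob {\<omega>\<in>space M. X \<omega> = k} / t\<^sup>2"
      by simp
    then show ?thesis using False by (simp add: A_def distr)
  qed
  from sums_le[OF this 1 2]
  have "prob (\<Union>k. A k) \<le> \<mu> / t\<^sup>2" .
  moreover have "(\<Union>k. A k) = {\<omega>\<in>space M. t \<le> \<bar>real (X \<omega>) - \<mu>\<bar>}"
    by (auto simp: A_def split: if_splits)
  ultimately show ?thesis by simp
qed

lemma poisson_process_chebyshev:
  assumes "poisson_process M d \<Phi>" "A \<in> sets borel" "A \<subseteq> unit_square" "t > 0"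
  shows "measure M {\<omega>\<in>space M. t \<le> \<bar>real (card (\<Phi> \<omega> \<inter> A)) - d * measure lborel A\<bar>}
    \<le> d * measure lborel A / t\<^sup>2"
proof -
  interpret prob_space M using assms(1) by (simp add: poisson_process_def)
  show ?thesis
    using assms by (intro poisson_chebyshev) (auto simp: poisson_process_def)
qed

lemma poisson_process_measurable:
  assumes "poisson_process M d \<Phi>" "A \<in> sets borel" "A \<subseteq> unit_square"
  shows "(\<lambda>\<omega>. card (\<Phi> \<omega> \<inter> A)) \<in> measurable M (count_space UNIV)"
  using assms by (auto simp: poisson_process_def)

section \<open>Counting permutations with prescribed values\<close>

text \<open>Composition with the transposition of \<open>x\<close> and \<open>y\<close> turns a
  permutation sending \<open>x\<close> to \<open>y\<close> into one fixing \<open>x\<close>, that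
  is, into a permutation of \<open>S - {x}\<close>; the remaining prescribed images are transposed
  as well. Lists of length 2 and 4 give the first two moments below.\<close>

lemma card_permutes_map_eq:
  assumes "finite S" "distinct xs" "distinct ys" "length xs = length ys" "set xs \<subseteq> S" "set ys \<subseteq> S"
  shows "card {\<pi>. \<pi> permutes S \<and> map \<pi> xs = ys} = fact (card S - length xs)"
  using assms
proof (induction xs arbitrary: S ys)
  case Nil
  then show ?case by (simp add: card_permutations)
next
  case (Cons x xs)
  then obtain y ys' where ys: "ys = y # ys'" by (cases ys) auto
  define \<tau> where "\<tau> = Transposition.transpose x y"
  define S' where "S' = S - {x}"
  have S: "S = insert x S'" "x \<notin> S'" using Cons.prems by (auto simp: S'_def)
  let ?R = "{\<pi>. \<pi> permutes S' \<and> map \<pi> xs = map \<tau> ys'}"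
  have dist: "distinct (map \<tau> ys')"
    using Cons.prems ys by (auto simp: distinct_map \<tau>_def intro: inj_on_subset[OF inj_swap])
  have sub: "set (map \<tau> ys') \<subseteq> S'"
  proof
    fix z assume "z \<in> set (map \<tau> ys')"
    then obtain w where w: "w \<in> set ys'" "z = \<tau> w" by auto
    then have "w \<noteq> y" "w \<in> S" "y \<in> S" using Cons.prems ys by auto
    then show "z \<in> S'" using w Cons.prems by (auto simp: \<tau>_def S'_def Transposition.transpose_def)
  qed
  have "card ?R = fact (card S' - length xs)"
    using Cons.prems dist sub by (intro Cons.IH) (auto simp: S'_def ys)
  moreover have "{\<pi>. \<pi> permutes S \<and> map \<pi> (x # xs) = ys} = (\<lambda>p. \<tau> \<circ> p) ` ?R"
  proof (intro set_eqI iffI)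
    fix \<pi> assume "\<pi> \<in> {\<pi>. \<pi> permutes S \<and> map \<pi> (x # xs) = ys}"
    then have \<pi>: "\<pi> permutes S" "\<pi> x = y" "map \<pi> xs = ys'" by (auto simp: ys)
    have "(\<tau> \<circ> \<pi>) permutes S'"
      using permutes_insert_lemma[of \<pi> x S'] \<pi> S by (simp add: \<tau>_def)
    moreover have "map (\<tau> \<circ> \<pi>) xs = map \<tau> ys'"
      using \<pi>(3) by (metis map_map)
    moreover have "\<pi> = \<tau> \<circ> (\<tau> \<circ> \<pi>)" by (auto simp: \<tau>_def fun_eq_iff)
    ultimately show "\<pi> \<in> (\<lambda>p. \<tau> \<circ> p) ` ?R" by blast
  next
    fix \<pi> assume "\<pi> \<in> (\<lambda>p. \<tau> \<circ> p) ` ?R"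
    then obtain p where p: "\<pi> = \<tau> \<circ> p" "p permutes S'" "map p xs = map \<tau> ys'" by auto
    have "\<tau> permutes S" unfolding \<tau>_def
      using Cons.prems ys by (intro permutes_swap_id) auto
    moreover have "p permutes S" using p(2) S by (auto intro: permutes_subset)
    ultimately have "\<pi> permutes S" using p(1) by (simp add: permutes_compose)
    moreover have "p x = x" using p(2) S by (simp add: permutes_not_in)
    moreover have "map \<pi> xs = ys'"
    proof -
      have "map \<pi> xs = map \<tau> (map p xs)" by (simp add: p(1))
      also have "\<dots> = ys'" by (simp add: p(3) \<tau>_def comp_def)
      finally show ?thesis .
    qed
    ultimately show "\<pi> \<in> {\<pi>. \<pi> permutes S \<and> map \<pi> (x # xs) = ys}"
      using p(1) by (simp add: ys \<tau>_def)
  qed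
  moreover have "inj_on (\<lambda>p. \<tau> \<circ> p) ?R"
  proof (rule inj_onI)
    fix p p' assume "\<tau> \<circ> p = \<tau> \<circ> p'"
    then have "\<tau> \<circ> (\<tau> \<circ> p) = \<tau> \<circ> (\<tau> \<circ> p')" by simp
    then show "p = p'" by (simp add: \<tau>_def fun_eq_iff)
  qed
  ultimately show ?case
    using Cons.prems by (simp add: card_image S'_def)
qed

section \<open>Uniformly random pairing\<close>

text \<open>For \<open>\<pi>\<close> the \<open>shuffle\<close> of a network with \<open>k\<close>
  nodes, these are the source-destination pairs with source label in \<open>A\<close> and
  destination label in \<open>B\<close>.\<close>

definition linked_pairs :: "nat \<Rightarrow> (nat \<Rightarrow> nat) \<Rightarrow> nat set \<Rightarrow> nat set \<Rightarrow> nat set" where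
  "linked_pairs k \<pi> A B = {i. i < k div 2 \<and> \<pi> (2 * i) \<in> A \<and> \<pi> (2 * i + 1) \<in> B}"

lemma linked_pairs_first_moment:
  assumes "A \<subseteq> {..<k}" "B \<subseteq> {..<k}" "A \<inter> B = {}" "i < k div 2"
  shows "card {\<pi>. \<pi> permutes {..<k} \<and> i \<in> linked_pairs k \<pi> A B} = card A * card B * fact (k - 2)"
proof -
  have fin: "finite A" "finite B"
    using finite_subset[OF assms(1)] finite_subset[OF assms(2)] by auto
  let ?F = "\<lambda>(x, y). {\<pi>. \<pi> permutes {..<k} \<and> map \<pi> [2 * i, 2 * i + 1] = [x, y]}"
  have eq: "{\<pi>. \<pi> permutes {..<k} \<and> i \<in> linked_pairs k \<pi> A B} = (\<Union>xy\<in>A \<times> B. ?F xy)"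
    using assms(4) by (auto simp: linked_pairs_def)
  have "card (\<Union>xy\<in>A \<times> B. ?F xy) = (\<Sum>xy\<in>A \<times> B. card (?F xy))"
  proof (rule card_UN_disjoint)
    have "finite (?F xy)" for xy
      by (rule finite_subset[OF _ finite_permutations[of "{..<k}"]]) (auto split: prod.splits)
    then show "\<forall>xy\<in>A \<times> B. finite (?F xy)" by blast
  qed (use fin in auto)
  also have "\<dots> = (\<Sum>xy\<in>A \<times> B. fact (k - 2))"
  proof (intro sum.cong refl)
    fix xy assume xy: "xy \<in> A \<times> B"
    obtain x y where [simp]: "xy = (x, y)" by force
    have "2 * i + 1 < k" using assms(4) by linarith
    moreover have "x \<noteq> y" "x < k" "y < k" using xy assms(1-3) by auto
    ultimately show "card (?F xy) = fact (k - 2)"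
      using card_permutes_map_eq[of "{..<k}" "[2 * i, 2 * i + 1]" "[x, y]"] by (simp add: numeral_2_eq_2)
  qed
  finally show ?thesis unfolding eq by (simp add: card_cartesian_product)
qed

text \<open>Quadruples of labels with a repetition are images under no permutation, so letting all
  of \<open>A \<times> B \<times> A \<times> B\<close> contribute only overestimates. An upper bound
  is what the variance estimate asks for.\<close>

lemma linked_pairs_second_moment:
  assumes "A \<subseteq> {..<k}" "B \<subseteq> {..<k}" "i < k div 2" "j < k div 2" "i \<noteq> j"
  shows "card {\<pi>. \<pi> permutes {..<k} \<and> i \<in> linked_pairs k \<pi> A B \<and> j \<in> linked_pairs k \<pi> A B}
    \<le> (card A * card B)\<^sup>2 * fact (k - 4)"
proof -
  have fin: "finite A" "finite B"
    using finite_subset[OF assms(1)] finite_subset[OF assms(2)] by auto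
  let ?xs = "[2 * i, 2 * i + 1, 2 * j, 2 * j + 1]"
  let ?F = "\<lambda>(x, y, x', y'). {\<pi>. \<pi> permutes {..<k} \<and> map \<pi> ?xs = [x, y, x', y']}"
  have eq: "{\<pi>. \<pi> permutes {..<k} \<and> i \<in> linked_pairs k \<pi> A B \<and> j \<in> linked_pairs k \<pi> A B}
      = (\<Union>z\<in>A \<times> B \<times> A \<times> B. ?F z)"
    using assms(3,4) by (auto simp: linked_pairs_def simp del: One_nat_def)
  have "card (\<Union>z\<in>A \<times> B \<times> A \<times> B. ?F z) \<le> (\<Sum>z\<in>A \<times> B \<times> A \<times> B. card (?F z))"
    using fin by (intro card_UN_le) auto
  also have "\<dots> \<le> (\<Sum>z\<in>A \<times> B \<times> A \<times> B. fact (k - 4))"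
  proof (intro sum_mono)
    fix z assume z: "z \<in> A \<times> B \<times> A \<times> B"
    obtain x y x' y' where [simp]: "z = (x, y, x', y')" by (cases z) auto
    have neq: "2 * i \<noteq> 2 * j + 1" "2 * j \<noteq> 2 * i + 1" by presburger+
    have dist: "distinct ?xs" using assms(5) neq by simp
    have "2 * i + 1 < k" "2 * j + 1 < k" using assms(3,4) by linarith+
    then have xs: "set ?xs \<subseteq> {..<k}" by simp
    have ys: "set [x, y, x', y'] \<subseteq> {..<k}" using z assms(1,2) by auto
    show "card (?F z) \<le> fact (k - 4)"
    proof (cases "distinct [x, y, x', y']")
      case True
      then show ?thesis
        using card_permutes_map_eq[OF finite_lessThan dist True _ xs ys] by (simp add: numeral_eq_Suc)
    next
      case False
      have "?F z = {}"
      proof (rule ccontr)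
        assume "?F z \<noteq> {}"
        then obtain \<pi> where "\<pi> permutes {..<k}" "map \<pi> ?xs = [x, y, x', y']" by auto
        then have "distinct [x, y, x', y']"
          using dist by (metis distinct_map inj_on_subset permutes_inj subset_UNIV)
        then show False using False by blast
      qed
      then show ?thesis by (simp only: card.empty)
    qed
  qed
  finally show ?thesis
    unfolding eq by (simp add: card_cartesian_product power2_eq_square algebra_simps)
qed

text \<open>Chebyshev's inequality with deviation \<open>m / 2\<close>, where \<open>m\<close> is
  the mean number of linked pairs under a uniform permutation. Bad permutations are counted because
  \<open>random_network\<close> gives each permutation the same conditional weight
  \<open>1 / fact k\<close>.\<close>

lemma linked_pairs_chebyshev:
  assumes "A \<subseteq> {..<k}" "B \<subseteq> {..<k}" "A \<inter> B = {}" "k \<ge> 6"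
    and m_def: "m = real (k div 2) * real (card A) * real (card B) / (real k * (real k - 1))"
    and m: "m > 0"
  shows "real (card {\<pi>. \<pi> permutes {..<k} \<and> real (card (linked_pairs k \<pi> A B)) \<le> m / 2})
    \<le> fact k * (4 / m + 64 / real k)"
proof -
  define P where "P = {\<pi>. \<pi> permutes {..<k}}"
  define p where "p = k div 2"
  define I where "I i \<pi> = (if i \<in> linked_pairs k \<pi> A B then 1 else 0 :: real)" for i \<pi>
  define Y where "Y \<pi> = real (card (linked_pairs k \<pi> A B))" for \<pi>
  define s where "s = real (card A) * real (card B)"
  have finP: "finite P" by (simp add: P_def finite_permutations)
  have cardP: "real (card P) = fact k" by (simp add: P_def card_permutations)
  have Y: "Y \<pi> = (\<Sum>i<p. I i \<pi>)" for \<pi>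
  proof -
    have "{..<p} \<inter> linked_pairs k \<pi> A B = linked_pairs k \<pi> A B"
      by (auto simp: linked_pairs_def p_def)
    then show ?thesis unfolding I_def Y_def by (simp add: sum.If_cases)
  qed
  have I1: "(\<Sum>\<pi>\<in>P. I i \<pi>) = s * fact (k - 2)" if "i < p" for i
  proof -
    have "(\<Sum>\<pi>\<in>P. I i \<pi>) = real (card {\<pi>\<in>P. i \<in> linked_pairs k \<pi> A B})"
      unfolding I_def using finP by (simp add: sum.If_cases Int_def)
    then show ?thesis
      using linked_pairs_first_moment[OF assms(1-3), of i] that by (simp add: P_def p_def s_def)
  qed
  have I2: "(\<Sum>\<pi>\<in>P. I i \<pi> * I j \<pi>) \<le> s\<^sup>2 * fact (k - 4)" if "i < p" "j < p" "i \<noteq> j" for i j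
  proof -
    have "(\<Sum>\<pi>\<in>P. I i \<pi> * I j \<pi>) =
        (\<Sum>\<pi>\<in>P. if i \<in> linked_pairs k \<pi> A B \<and> j \<in> linked_pairs k \<pi> A B then 1 else 0)"
      unfolding I_def by (intro sum.cong) auto
    also have "\<dots> =
        real (card {\<pi>\<in>P. i \<in> linked_pairs k \<pi> A B \<and> j \<in> linked_pairs k \<pi> A B})"
      using finP by (simp add: sum.If_cases Int_def)
    also have "\<dots> \<le> real ((card A * card B)\<^sup>2 * fact (k - 4))"
      using linked_pairs_second_moment[OF assms(1,2), of i j] that
      by (intro of_nat_mono) (simp add: P_def p_def)
    finally show ?thesis by (simp add: s_def power_mult_distrib)
  qed
  have S1: "(\<Sum>\<pi>\<in>P. Y \<pi>) = real p * s * fact (k - 2)"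
    unfolding Y by (subst sum.swap) (simp add: I1)
  have "(\<Sum>\<pi>\<in>P. (Y \<pi>)\<^sup>2) = (\<Sum>\<pi>\<in>P. \<Sum>i<p. \<Sum>j<p. I i \<pi> * I j \<pi>)"
    unfolding Y power2_eq_square by (simp add: sum_product)
  also have "\<dots> = (\<Sum>i<p. \<Sum>\<pi>\<in>P. \<Sum>j<p. I i \<pi> * I j \<pi>)"
    by (rule sum.swap)
  also have "\<dots> = (\<Sum>i<p. \<Sum>j<p. \<Sum>\<pi>\<in>P. I i \<pi> * I j \<pi>)"
    by (intro sum.cong refl sum.swap)
  also have "\<dots> \<le> (\<Sum>i<p. \<Sum>j<p. (if j = i then s * fact (k - 2) else 0) + s\<^sup>2 * fact (k - 4))"
  proof (intro sum_mono)
    fix i j assume ij: "i \<in> {..<p}" "j \<in> {..<p}"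
    show "(\<Sum>\<pi>\<in>P. I i \<pi> * I j \<pi>) \<le> (if j = i then s * fact (k - 2) else 0) + s\<^sup>2 * fact (k - 4)"
    proof (cases "i = j")
      case True
      have "I i \<pi> * I i \<pi> = I i \<pi>" for \<pi> by (simp add: I_def)
      then show ?thesis unfolding True[symmetric] using I1 ij by (simp only:) auto
    qed (use I2 ij in auto)
  qed
  also have "\<dots> = real p * s * fact (k - 2) + (real p * s)\<^sup>2 * fact (k - 4)"
    by (simp add: sum.distrib sum.delta power2_eq_square algebra_simps)
  finally have S2: "(\<Sum>\<pi>\<in>P. (Y \<pi>)\<^sup>2) \<le> real p * s * fact (k - 2) + (real p * s)\<^sup>2 * fact (k - 4)" .
  define K where "K = real k"
  have K: "K \<ge> 6" using assms(4) by (simp add: K_def)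
  define l where "l = k - 4"
  have l: "k = Suc (Suc (Suc (Suc l)))" using assms(4) by (simp add: l_def)
  have f2: "fact k = K * (K - 1) * (fact (k - 2) :: real)"
    unfolding K_def l by (simp add: algebra_simps)
  have f4: "fact k = K * (K - 1) * (K - 2) * (K - 3) * (fact (k - 4) :: real)"
    unfolding K_def l by (simp add: numeral_eq_Suc)
  have ps: "real p * s = m * (K * (K - 1))"
    unfolding m_def K_def[symmetric] p_def s_def using K by simp
  have 1: "real p * s * fact (k - 2) = m * fact k"
    unfolding ps f2 by simp
  \<comment> \<open>Two pairs are almost independent: their joint probability is at most the product
    times \<open>K (K - 1) / ((K - 2) (K - 3))\<close>, which is \<open>1 + O(1 / K)\<close>. The
    constant 16 works for all \<open>K \<ge> 6\<close>.\<close>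
  define \<epsilon> where "\<epsilon> = 16 / K"
  have "K * (K - 1) \<le> (1 + \<epsilon>) * ((K - 2) * (K - 3))"
  proof -
    have "0 \<le> (K - 6) * (12 * K - 2) + 84" using K by simp
    then have "K * (K * (K - 1)) \<le> (K + 16) * ((K - 2) * (K - 3)) "
      by (simp add: algebra_simps power2_eq_square)
    then show ?thesis using K by (simp add: \<epsilon>_def field_simps)
  qed
  then have "(m\<^sup>2 * K * (K - 1) * fact (k - 4)) * (K * (K - 1))
      \<le> (m\<^sup>2 * K * (K - 1) * fact (k - 4)) * ((1 + \<epsilon>) * ((K - 2) * (K - 3)))"
    using K by (intro mult_left_mono) auto
  then have 2: "(real p * s)\<^sup>2 * fact (k - 4) \<le> m\<^sup>2 * (1 + \<epsilon>) * fact k"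
    unfolding ps f4 by (simp add: power2_eq_square mult_ac)
  have "(\<Sum>\<pi>\<in>P. (Y \<pi> - m)\<^sup>2) = (\<Sum>\<pi>\<in>P. (Y \<pi>)\<^sup>2) - 2 * m * (\<Sum>\<pi>\<in>P. Y \<pi>) + m\<^sup>2 * fact k"
  proof -
    have "(Y \<pi> - m)\<^sup>2 = (Y \<pi>)\<^sup>2 - 2 * m * Y \<pi> + m\<^sup>2" for \<pi>
      by (simp add: power2_diff)
    then show ?thesis
      by (simp add: sum.distrib sum_subtractf sum_distrib_left[symmetric] cardP)
  qed
  also have "\<dots> \<le> m * fact k + m\<^sup>2 * (1 + \<epsilon>) * fact k - 2 * m * (m * fact k) + m\<^sup>2 * fact k"
    using S1 S2 1 2 by simp
  also have "\<dots> = (m + m\<^sup>2 * \<epsilon>) * fact k"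
    by (simp add: algebra_simps power2_eq_square)
  finally have var: "(\<Sum>\<pi>\<in>P. (Y \<pi> - m)\<^sup>2) \<le> (m + m\<^sup>2 * \<epsilon>) * fact k" .
  define Bad where "Bad = {\<pi>\<in>P. Y \<pi> \<le> m / 2}"
  have "real (card Bad) * (m / 2)\<^sup>2 = (\<Sum>\<pi>\<in>Bad. (m / 2)\<^sup>2)" by simp
  also have "\<dots> \<le> (\<Sum>\<pi>\<in>Bad. (Y \<pi> - m)\<^sup>2)"
  proof (intro sum_mono)
    fix \<pi> assume "\<pi> \<in> Bad"
    then have "m / 2 \<le> m - Y \<pi>" by (simp add: Bad_def)
    then have "(m / 2)\<^sup>2 \<le> (m - Y \<pi>)\<^sup>2" using m by (intro power_mono) auto
    then show "(m / 2)\<^sup>2 \<le> (Y \<pi> - m)\<^sup>2" by (simp add: power2_commute)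
  qed
  also have "\<dots> \<le> (\<Sum>\<pi>\<in>P. (Y \<pi> - m)\<^sup>2)"
    using finP by (intro sum_mono2) (auto simp: Bad_def)
  finally have "real (card Bad) * (m / 2)\<^sup>2 \<le> (m + m\<^sup>2 * \<epsilon>) * fact k" using var by simp
  then have "real (card Bad) \<le> (m + m\<^sup>2 * \<epsilon>) * fact k / (m / 2)\<^sup>2"
    using m by (simp add: pos_le_divide_eq)
  also have "\<dots> = fact k * (4 / m + 4 * \<epsilon>)"
    using m by (simp add: power2_eq_square distrib_left distrib_right add_divide_distrib)
  finally show ?thesis by (simp add: Bad_def P_def Y_def \<epsilon>_def K_def)
qed

section \<open>Cells, routes and tasks\<close>

lemma cell_index_less: "0 < q \<Longrightarrow> cell_index q x < q"
  by (auto simp: cell_index_def min_def)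

lemma cell_index_bounds:
  assumes "0 < q" "0 \<le> x" "x \<le> 1"
  shows "real (cell_index q x) \<le> real q * x" "real q * x \<le> real (cell_index q x) + 1"
proof -
  have nn: "0 \<le> real q * x" using assms by simp
  then have "real (nat \<lfloor>real q * x\<rfloor>) \<le> real q * x" by (simp add: of_nat_nat)
  then show "real (cell_index q x) \<le> real q * x" by (simp add: cell_index_def min_def)
  have 1: "real q * x < real (nat \<lfloor>real q * x\<rfloor>) + 1" using nn by (simp add: of_nat_nat)
  have 2: "real q * x \<le> real q" using assms by (simp add: mult_left_le)
  show "real q * x \<le> real (cell_index q x) + 1"
    using 1 2 assms(1) by (auto simp: cell_index_def min_def)
qed

text \<open>The truncation in \<open>cell_index\<close> acts only in the last cell. Strictness
  elsewhere is what makes \<open>border_gap\<close> positive.\<close>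

lemma cell_index_upper:
  assumes "cell_index q x < q - 1" "0 \<le> x"
  shows "real q * x < real (cell_index q x) + 1"
proof -
  have "0 \<le> real q * x" using assms by simp
  then have "real q * x < real (nat \<lfloor>real q * x\<rfloor>) + 1" by (simp add: of_nat_nat)
  then show ?thesis using assms(1) by (auto simp: cell_index_def min_def split: if_splits)
qed

section \<open>Corner paths on the grid\<close>

definition nat_diff :: "nat \<Rightarrow> nat \<Rightarrow> nat" where
  "nat_diff a b = (a - b) + (b - a)"

lemma length_walk: "length (walk a b) = Suc (nat_diff a b)"
  by (auto simp: walk_def nat_diff_def)

lemma nth_walk: "h \<le> nat_diff a b \<Longrightarrow> walk a b ! h = (if a \<le> b then a + h else a - h)"
  by (auto simp: walk_def nat_diff_def rev_nth simp del: upt_Suc)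

lemma distinct_walk: "distinct (walk a b)"
  by (simp add: walk_def)

lemma set_walk: "set (walk a b) = {min a b..max a b}"
  by (auto simp: walk_def)

lemma walk_eq_Cons: "walk a b = a # tl (walk a b)"
proof -
  have "walk a b \<noteq> []" using length_walk[of a b] by auto
  moreover have "walk a b ! 0 = a" by (simp add: nth_walk)
  ultimately show ?thesis by (metis hd_Cons_tl hd_conv_nth)
qed

text \<open>This is \<open>route\<close> as a function of the two end cells, on which alone the
  shape of a path depends.\<close>

definition corner_path :: "cell \<Rightarrow> cell \<Rightarrow> cell list" where
  "corner_path c c' = map (\<lambda>x. (x, snd c)) (walk (fst c) (fst c')) @
     map (\<lambda>y. (fst c', y)) (tl (walk (snd c) (snd c')))"

lemma route_eq_corner_path:
  "route q \<nu> i = corner_path (cell_of q \<nu> (src \<nu> i)) (cell_of q \<nu> (dst \<nu> i))"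
  by (simp add: route_def corner_path_def split: prod.split)

lemma length_corner_path:
  "length (corner_path c c') = Suc (nat_diff (fst c) (fst c') + nat_diff (snd c) (snd c'))"
  by (simp add: corner_path_def length_walk)

lemma nth_corner_path_horizontal:
  "h \<le> nat_diff (fst c) (fst c') \<Longrightarrow>
    corner_path c c' ! h = (if fst c \<le> fst c' then fst c + h else fst c - h, snd c)"
  by (simp add: corner_path_def nth_append length_walk nth_walk)

lemma nth_corner_path_vertical:
  assumes "nat_diff (fst c) (fst c') \<le> h"
    "h \<le> nat_diff (fst c) (fst c') + nat_diff (snd c) (snd c')"
  shows "corner_path c c' ! h = (fst c', if snd c \<le> snd c'
    then snd c + (h - nat_diff (fst c) (fst c')) else snd c - (h - nat_diff (fst c) (fst c')))"
proof (cases "h = nat_diff (fst c) (fst c')")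
  case True
  then show ?thesis
    using nth_corner_path_horizontal[of h c c'] by (auto simp: nat_diff_def)
next
  case False
  \<comment> \<open>\<open>tl\<close> drops the corner from the vertical list because the horizontal
    list already ends with it; hence the shift by one.\<close>
  define g where "g = h - nat_diff (fst c) (fst c') - 1"
  have h: "h = Suc (nat_diff (fst c) (fst c')) + g" "Suc g \<le> nat_diff (snd c) (snd c')"
    using False assms by (auto simp: g_def)
  have "tl (walk (snd c) (snd c')) ! g = walk (snd c) (snd c') ! Suc g"
    by (subst (2) walk_eq_Cons) simp
  then show ?thesis using h
    by (simp add: corner_path_def nth_append length_walk nth_walk)
qed

lemma corner_path_first: "corner_path c c' ! 0 = c"
  by (simp add: nth_corner_path_horizontal)

lemma corner_path_last: "corner_path c c' ! (length (corner_path c c') - 1) = c'"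
  by (subst nth_corner_path_vertical) (auto simp: length_corner_path nat_diff_def prod_eq_iff)

lemma distinct_corner_path: "distinct (corner_path c c')"
proof -
  have "distinct (snd c # tl (walk (snd c) (snd c')))"
    using distinct_walk[of "snd c" "snd c'"] by (simp add: walk_eq_Cons[symmetric])
  then show ?thesis
    by (auto simp: corner_path_def distinct_map distinct_walk inj_on_def)
qed

text \<open>The source of the load bound: a path through a cell starts in its row or ends in its
  column.\<close>

lemma set_corner_path:
  "x \<in> set (corner_path c c') \<Longrightarrow> snd x = snd c \<or> fst x = fst c'"
  by (auto simp: corner_path_def)

lemma corner_path_less:
  assumes "x \<in> set (corner_path c c')" "fst c < q" "snd c < q" "fst c' < q" "snd c' < q"
  shows "fst x < q" "snd x < q"
proof -
  have "set (tl (walk (snd c) (snd c'))) \<subseteq> set (walk (snd c) (snd c'))"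
    by (metis list.set_intros(2) subsetI walk_eq_Cons)
  moreover have "set (walk (snd c) (snd c')) \<subseteq> {..<q}"
    using assms by (auto simp: set_walk)
  ultimately have "set (tl (walk (snd c) (snd c'))) \<subseteq> {..<q}" by blast
  with assms show "fst x < q" "snd x < q"
    by (auto simp: corner_path_def set_walk)
qed

text \<open>Equal cells are included for the pairs whose source and destination share a
  cell.\<close>

definition near_cells :: "cell \<Rightarrow> cell \<Rightarrow> bool" where
  "near_cells c c' \<longleftrightarrow> \<bar>int (fst c) - int (fst c')\<bar> \<le> 1 \<and> \<bar>int (snd c) - int (snd c')\<bar> \<le> 1"

lemma near_cells_refl: "near_cells c c"
  by (simp add: near_cells_def)

lemma near_cells_corner_path:
  assumes "Suc h < length (corner_path c c')"
  shows "near_cells (corner_path c c' ! h) (corner_path c c' ! Suc h)"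
proof (cases "Suc h \<le> nat_diff (fst c) (fst c')")
  case True
  then show ?thesis
    by (auto simp: nth_corner_path_horizontal near_cells_def)
next
  case False
  then show ?thesis using assms
    by (auto simp: nth_corner_path_vertical length_corner_path near_cells_def Suc_diff_le)
qed

section \<open>TDMA phases and the load of a cell\<close>

lemma phase_less: "phase c < 25"
proof -
  have "fst c mod 5 < 5" "snd c mod 5 < 5" by simp_all
  then show ?thesis unfolding phase_def by linarith
qed

lemma phase_eq_iff:
  "phase c = phase c' \<longleftrightarrow> fst c mod 5 = fst c' mod 5 \<and> snd c mod 5 = snd c' mod 5"
proof
  assume "phase c = phase c'"
  moreover have "fst c mod 5 < 5" "fst c' mod 5 < 5" by simp_all
  ultimately have "snd c mod 5 = snd c' mod 5"
    unfolding phase_def by linarith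
  with \<open>phase c = phase c'\<close> show "fst c mod 5 = fst c' mod 5 \<and> snd c mod 5 = snd c' mod 5"
    unfolding phase_def by simp
qed (simp add: phase_def)

lemma mod_5_eq_imp_far:
  fixes a b :: nat
  assumes "a mod 5 = b mod 5" "a \<noteq> b"
  shows "\<bar>int a - int b\<bar> \<ge> 5"
  using assms by presburger

text \<open>Cells of the same phase agree modulo 5 in both coordinates, so a coordinate in which
  they differ does so by a multiple of 5.\<close>

lemma phase_eq_imp_far:
  assumes "phase c = phase c'" "c \<noteq> c'"
  shows "\<bar>int (fst c) - int (fst c')\<bar> \<ge> 5 \<or> \<bar>int (snd c) - int (snd c')\<bar> \<ge> 5"
  using assms mod_5_eq_imp_far by (auto simp: phase_eq_iff prod_eq_iff)

text \<open>Consecutive cells of a path are never active together; in the flow argument this places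
  the last active slot of the preceding cell strictly before the current slot.\<close>

lemma near_cells_phase: "near_cells c c' \<Longrightarrow> c \<noteq> c' \<Longrightarrow> phase c \<noteq> phase c'"
  using phase_eq_imp_far[of c c'] by (auto simp: near_cells_def)

text \<open>List comprehensions as in \<open>tasks\<close> unfold to this nesting of
  \<open>concat\<close>, \<open>map\<close> and \<open>if\<close>.\<close>

lemma concat_map_if: "concat (map (\<lambda>h. if P h then [g h] else []) hs) = map g (filter P hs)"
  by (induction hs) auto

lemma distinct_concat_pairs:
  assumes "distinct is" "\<And>i. distinct (H i)"
  shows "distinct (concat (map (\<lambda>i. concat (map (\<lambda>h. if P i h then [(i, h)] else []) (H i))) is))"
  using assms(1)
proof (induction "is")
  case (Cons i "is")
  have "distinct (concat (map (\<lambda>h. if P i h then [(i, h)] else []) (H i)))"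
    unfolding concat_map_if by (simp add: distinct_map inj_on_def assms(2))
  then show ?case using Cons by (auto split: if_splits)
qed simp

lemma set_tasks:
  "set (tasks q \<nu> c) = {(i, h). i < pair_count \<nu> \<and> h < hop_count q \<nu> i \<and> route q \<nu> i ! h = c}"
proof -
  have "(i, h) \<in> set (tasks q \<nu> c) \<longleftrightarrow> i < pair_count \<nu> \<and> h < hop_count q \<nu> i \<and> route q \<nu> i ! h = c"
    for i h
  proof (cases h)
    case 0
    have "0 < hop_count q \<nu> i" by (simp add: hop_count_def)
    then show ?thesis using 0 by (auto simp: tasks_def split: if_splits)
  qed (auto simp: tasks_def split: if_splits)
  then show ?thesis by auto
qed

lemma distinct_tasks: "distinct (tasks q \<nu> c)"
proof -
  have "distinct [(i, h). i \<leftarrow> [0..<pair_count \<nu>], h \<leftarrow> [1..<hop_count q \<nu> i], route q \<nu> i ! h = c]"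
    by (rule distinct_concat_pairs) auto
  moreover have "distinct [(i, 0 :: nat). i \<leftarrow> [0..<pair_count \<nu>], route q \<nu> i ! 0 = c]"
    unfolding concat_map_if by (simp add: distinct_map inj_on_def)
  ultimately show ?thesis
    unfolding tasks_def by (auto split: if_splits)
qed

lemma distinct_route: "distinct (route q \<nu> i)"
  by (simp add: route_eq_corner_path distinct_corner_path)

lemma route_nonempty: "route q \<nu> i \<noteq> []"
  using length_corner_path by (metis Zero_not_Suc list.size(3) route_eq_corner_path)

lemma hop_less_length: "h < hop_count q \<nu> i \<Longrightarrow> h < length (route q \<nu> i)"
  using route_nonempty[of q \<nu> i] by (cases "route q \<nu> i") (auto simp: hop_count_def max_def split: if_splits)

text \<open>A path visits a cell at most once, so the tasks of a cell inject into the pairs. Each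
  pair is charged to its source if that lies in the row of \<open>c\<close>, and otherwise to its
  destination in the column of \<open>c\<close>; \<open>src\<close> and \<open>dst\<close> are
  injective because \<open>shuffle\<close> is. The bound holds for every permutation.\<close>

lemma length_tasks_le:
  assumes perm: "shuffle \<nu> permutes {..<node_count \<nu>}"
  shows "length (tasks q \<nu> c) \<le> card {v. v < node_count \<nu> \<and> snd (cell_of q \<nu> v) = snd c}
    + card {v. v < node_count \<nu> \<and> fst (cell_of q \<nu> v) = fst c}"
proof -
  have lt: "shuffle \<nu> j < node_count \<nu>" if "j < node_count \<nu>" for j
    using permutes_in_image[OF perm, of j] that by simp
  have inj: "inj (shuffle \<nu>)" using perm by (rule permutes_inj)
  have "length (tasks q \<nu> c) = card (set (tasks q \<nu> c))"
    by (simp add: distinct_card distinct_tasks)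
  also have "\<dots> = card (fst ` set (tasks q \<nu> c))"
  proof (rule card_image[symmetric], rule inj_onI)
    fix x y assume xy: "x \<in> set (tasks q \<nu> c)" "y \<in> set (tasks q \<nu> c)" "fst x = fst y"
    obtain i h h' where [simp]: "x = (i, h)" "y = (i, h')"
      using xy(3) by (metis prod.collapse)
    have "h = h'"
      using xy(1,2) nth_eq_iff_index_eq[OF distinct_route, of h q \<nu> i h'] hop_less_length[of _ q \<nu> i]
      by (simp add: set_tasks)
    then show "x = y" by simp
  qed
  also have "\<dots> \<le> card ({i. i < pair_count \<nu> \<and> snd (cell_of q \<nu> (src \<nu> i)) = snd c}
      \<union> {i. i < pair_count \<nu> \<and> fst (cell_of q \<nu> (dst \<nu> i)) = fst c})"
  proof (rule card_mono)
    show "fst ` set (tasks q \<nu> c) \<subseteq> {i. i < pair_count \<nu> \<and> snd (cell_of q \<nu> (src \<nu> i)) = snd c}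
      \<union> {i. i < pair_count \<nu> \<and> fst (cell_of q \<nu> (dst \<nu> i)) = fst c}"
    proof
      fix i assume "i \<in> fst ` set (tasks q \<nu> c)"
      then obtain h where h: "i < pair_count \<nu>" "h < hop_count q \<nu> i" "route q \<nu> i ! h = c"
        by (auto simp: set_tasks)
      then have "c \<in> set (route q \<nu> i)" using hop_less_length nth_mem by blast
      then show "i \<in> {i. i < pair_count \<nu> \<and> snd (cell_of q \<nu> (src \<nu> i)) = snd c}
        \<union> {i. i < pair_count \<nu> \<and> fst (cell_of q \<nu> (dst \<nu> i)) = fst c}"
        using h(1) set_corner_path[of c "cell_of q \<nu> (src \<nu> i)" "cell_of q \<nu> (dst \<nu> i)"]
        by (auto simp: route_eq_corner_path)
    qed
  qed auto
  also have "\<dots> \<le> card {i. i < pair_count \<nu> \<and> snd (cell_of q \<nu> (src \<nu> i)) = snd c}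
      + card {i. i < pair_count \<nu> \<and> fst (cell_of q \<nu> (dst \<nu> i)) = fst c}"
    by (rule card_Un_le)
  also have "\<dots> \<le> card {v. v < node_count \<nu> \<and> snd (cell_of q \<nu> v) = snd c}
    + card {v. v < node_count \<nu> \<and> fst (cell_of q \<nu> v) = fst c}"
  proof (rule add_mono)
    show "card {i. i < pair_count \<nu> \<and> snd (cell_of q \<nu> (src \<nu> i)) = snd c}
        \<le> card {v. v < node_count \<nu> \<and> snd (cell_of q \<nu> v) = snd c}"
    proof (rule card_inj_on_le)
      show "inj_on (src \<nu>) {i. i < pair_count \<nu> \<and> snd (cell_of q \<nu> (src \<nu> i)) = snd c}"
        by (auto intro!: inj_onI dest!: injD[OF inj] simp: src_def)
    qed (auto simp: src_def pair_count_def intro!: lt)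
    show "card {i. i < pair_count \<nu> \<and> fst (cell_of q \<nu> (dst \<nu> i)) = fst c}
        \<le> card {v. v < node_count \<nu> \<and> fst (cell_of q \<nu> v) = fst c}"
    proof (rule card_inj_on_le)
      show "inj_on (dst \<nu>) {i. i < pair_count \<nu> \<and> fst (cell_of q \<nu> (dst \<nu> i)) = fst c}"
        by (auto intro!: inj_onI dest!: injD[OF inj] simp: dst_def)
    qed (auto simp: dst_def pair_count_def intro!: lt)
  qed
  finally show ?thesis .
qed

section \<open>Interference as a lattice sum\<close>

text \<open>One coordinate's share of the path loss; the cut-off at 1 treats the cells around the
  receiver as if they were at distance 1.\<close>

definition lattice_weight :: "real \<Rightarrow> real \<Rightarrow> real" where
  "lattice_weight \<gamma> x = (max 1 \<bar>x\<bar>) powr (- \<gamma>)"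

text \<open>Two copies of the sum over the naturals dominate the sum over all integers.\<close>

definition lattice_total :: "real \<Rightarrow> real" where
  "lattice_total \<gamma> = 2 * (\<Sum>k. lattice_weight \<gamma> (real k))"

lemma lattice_weight_nonneg: "0 \<le> lattice_weight \<gamma> x"
  by (simp add: lattice_weight_def)

lemma summable_lattice_weight:
  assumes "\<gamma> > 1"
  shows "summable (\<lambda>k. lattice_weight \<gamma> (real k))"
proof (rule summable_comparison_test')
  show "summable (\<lambda>k. real k powr (- \<gamma>))"
    using assms by (simp add: summable_real_powr_iff)
  show "norm (lattice_weight \<gamma> (real k)) \<le> real k powr (- \<gamma>)" if "k \<ge> 1" for k
    using that by (simp add: lattice_weight_def max_def)
qed

lemma sum_lattice_weight_le:
  fixes S :: "int set"
  assumes "\<gamma> > 1" "finite S"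
  shows "(\<Sum>x\<in>S. lattice_weight \<gamma> (real_of_int x)) \<le> lattice_total \<gamma>"
proof -
  have part: "(\<Sum>x\<in>T. lattice_weight \<gamma> (real_of_int x)) \<le> (\<Sum>k. lattice_weight \<gamma> (real k))"
    if T: "finite T" "inj_on (\<lambda>x. nat \<bar>x\<bar>) T" for T :: "int set"
  proof -
    have "(\<Sum>x\<in>T. lattice_weight \<gamma> (real_of_int x)) = (\<Sum>x\<in>T. lattice_weight \<gamma> (real (nat \<bar>x\<bar>)))"
      by (intro sum.cong) (auto simp: lattice_weight_def)
    also have "\<dots> = (\<Sum>k\<in>(\<lambda>x. nat \<bar>x\<bar>) ` T. lattice_weight \<gamma> (real k))"
      by (simp add: sum.reindex[OF T(2)])
    also have "\<dots> \<le> (\<Sum>k. lattice_weight \<gamma> (real k))"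
      using T by (intro sum_le_suminf summable_lattice_weight assms) (auto simp: lattice_weight_nonneg)
    finally show ?thesis .
  qed
  have "S = (S \<inter> {0..}) \<union> (S \<inter> {..<0})" by auto
  then have "(\<Sum>x\<in>S. lattice_weight \<gamma> (real_of_int x)) =
      (\<Sum>x\<in>S \<inter> {0..}. lattice_weight \<gamma> (real_of_int x)) + (\<Sum>x\<in>S \<inter> {..<0}. lattice_weight \<gamma> (real_of_int x))"
    using assms(2) by (metis (no_types, lifting) Int_lower2 disjoint_iff finite_Int atLeast_iff lessThan_iff not_less Int_iff sum.union_disjoint)
  also have "\<dots> \<le> lattice_total \<gamma>"
    unfolding lattice_total_def mult_2
    using assms(2) by (intro add_mono part) (auto simp: inj_on_def)
  finally show ?thesis .
qed

definition cell_dist :: "cell \<Rightarrow> cell \<Rightarrow> real" where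
  "cell_dist c c' = max \<bar>real (fst c) - real (fst c')\<bar> \<bar>real (snd c) - real (snd c')\<bar>"

text \<open>The exponent is shared equally between the coordinates, which bounds the planar sum by a
  product of two one-dimensional sums with exponent \<open>\<alpha> / 2\<close>. These converge
  precisely because \<open>\<alpha> > 2\<close>.\<close>

lemma sum_cell_dist_le:
  assumes "\<alpha> > 2" "finite W" "inj_on f W"
  shows "(\<Sum>w\<in>W. (max 1 (cell_dist (f w) r)) powr (- \<alpha>)) \<le> (lattice_total (\<alpha> / 2))\<^sup>2"
proof -
  define g where "g x = lattice_weight (\<alpha> / 2) (real_of_int x)" for x
  define X where "X w = int (fst (f w)) - int (fst r)" for w
  define Y where "Y w = int (snd (f w)) - int (snd r)" for w
  have prod: "(max 1 (cell_dist (f w) r)) powr (- \<alpha>) \<le> g (X w) * g (Y w)" for w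
  proof -
    define m where "m = max 1 (cell_dist (f w) r)"
    have 1: "max 1 \<bar>real_of_int (X w)\<bar> \<le> m" "max 1 \<bar>real_of_int (Y w)\<bar> \<le> m"
      by (auto simp: m_def X_def Y_def cell_dist_def)
    have "m powr (- \<alpha>) = m powr (- (\<alpha> / 2)) * m powr (- (\<alpha> / 2))"
      by (simp add: powr_add[symmetric])
    also have "\<dots> \<le> g (X w) * g (Y w)"
      unfolding g_def lattice_weight_def using 1 assms(1)
      by (intro mult_mono powr_mono2') auto
    finally show ?thesis by (simp add: m_def)
  qed
  have "inj_on (\<lambda>w. (X w, Y w)) W"
    using assms(3) by (auto simp: inj_on_def X_def Y_def prod_eq_iff)
  then have "(\<Sum>w\<in>W. g (X w) * g (Y w)) = (\<Sum>(x, y)\<in>(\<lambda>w. (X w, Y w)) ` W. g x * g y)"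
    by (simp add: sum.reindex)
  also have "\<dots> \<le> (\<Sum>(x, y)\<in>X ` W \<times> Y ` W. g x * g y)"
    using assms(2) by (intro sum_mono2) (auto simp: g_def lattice_weight_nonneg)
  also have "\<dots> = (\<Sum>x\<in>X ` W. g x) * (\<Sum>y\<in>Y ` W. g y)"
    by (simp add: sum_product sum.cartesian_product)
  \<comment> \<open>The instance of \<open>sum_lattice_weight_le\<close> for the empty set supplies
    nonnegativity of \<open>lattice_total\<close>.\<close>
  also have "\<dots> \<le> lattice_total (\<alpha> / 2) * lattice_total (\<alpha> / 2)"
    using assms(1,2) unfolding g_def
    by (intro mult_mono sum_lattice_weight_le sum_nonneg lattice_weight_nonneg order_trans[OF sum_nonneg sum_lattice_weight_le[of _ "{}"]]) auto
  finally have "(\<Sum>w\<in>W. g (X w) * g (Y w)) \<le> (lattice_total (\<alpha> / 2))\<^sup>2"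
    by (simp add: power2_eq_square)
  moreover have "(\<Sum>w\<in>W. (max 1 (cell_dist (f w) r)) powr (- \<alpha>)) \<le> (\<Sum>w\<in>W. g (X w) * g (Y w))"
    by (intro sum_mono prod)
  ultimately show ?thesis by linarith
qed

text \<open>A closed cell: points on the right or upper side of the unit square are assigned to the
  last cells, so strict upper bounds would fail for them.\<close>

definition in_cell :: "nat \<Rightarrow> point \<Rightarrow> cell \<Rightarrow> bool" where
  "in_cell q z c \<longleftrightarrow> real (fst c) \<le> real q * fst z \<and> real q * fst z \<le> real (fst c) + 1 \<and>
     real (snd c) \<le> real q * snd z \<and> real q * snd z \<le> real (snd c) + 1"

lemma in_cell_index:
  assumes "0 < q" "z \<in> unit_square"
  shows "in_cell q z (cell_index q (fst z), cell_index q (snd z))"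
  using assms cell_index_bounds[of q "fst z"] cell_index_bounds[of q "snd z"]
  by (auto simp: in_cell_def unit_square_def)

lemma scaled_dist_coord:
  fixes z z' :: point
  assumes "0 < q"
  shows "\<bar>real q * fst z - real q * fst z'\<bar> \<le> real q * dist z z'"
    "\<bar>real q * snd z - real q * snd z'\<bar> \<le> real q * dist z z'"
  using mult_left_mono[OF dist_fst_le[of z z'], of "real q"] mult_left_mono[OF dist_snd_le[of z z'], of "real q"]
  by (auto simp: dist_real_def abs_mult right_diff_distrib[symmetric])

lemma scaled_dist_ge:
  assumes "0 < q" "in_cell q z c" "in_cell q z' c'"
  shows "cell_dist c c' - 1 \<le> real q * dist z z'"
proof -
  have close: "\<bar>a - b\<bar> \<le> \<bar>x - y\<bar> + 1"
    if "a \<le> x" "x \<le> a + 1" "b \<le> y" "y \<le> b + 1" for a b x y :: real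
    using that by (simp add: abs_if)
  have "\<bar>real (fst c) - real (fst c')\<bar> \<le> \<bar>real q * fst z - real q * fst z'\<bar> + 1"
    "\<bar>real (snd c) - real (snd c')\<bar> \<le> \<bar>real q * snd z - real q * snd z'\<bar> + 1"
    using assms(2,3) unfolding in_cell_def by (auto intro: close)
  with scaled_dist_coord[OF assms(1), of z z'] show ?thesis
    unfolding cell_dist_def by simp
qed

text \<open>Points of near cells differ by at most 2 cell widths in each coordinate, and the
  Euclidean norm is at most the sum of the coordinates. This is the 4 in
  \<open>rate_floor\<close>.\<close>

lemma scaled_dist_le:
  assumes "0 < q" "in_cell q z c" "in_cell q z' c'" "near_cells c c'"
  shows "real q * dist z z' \<le> 4"
proof -
  have real_abs: "\<bar>real a - real b\<bar> = real_of_int \<bar>int a - int b\<bar>" for a b by simp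
  have n: "\<bar>real (fst c) - real (fst c')\<bar> \<le> 1" "\<bar>real (snd c) - real (snd c')\<bar> \<le> 1"
    unfolding real_abs using assms(4) unfolding near_cells_def by (simp_all only: of_int_le_1_iff)
  have "dist z z' \<le> dist (fst z) (fst z') + dist (snd z) (snd z')"
    unfolding dist_prod_def by (rule sqrt_sum_squares_le_sum) auto
  then have "real q * dist z z' \<le> real q * (dist (fst z) (fst z') + dist (snd z) (snd z'))"
    by (intro mult_left_mono) auto
  also have "\<dots> = \<bar>real q * fst z - real q * fst z'\<bar> + \<bar>real q * snd z - real q * snd z'\<bar>"
    by (simp add: dist_real_def abs_mult right_diff_distrib[symmetric] distrib_left)
  also have "\<dots> \<le> 2 + 2"
  proof (rule add_mono)
    have close: "\<bar>x - y\<bar> \<le> 2"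
      if "a \<le> x" "x \<le> a + 1" "b \<le> y" "y \<le> b + 1" "\<bar>a - b\<bar> \<le> 1" for a b x y :: real
      using that by (simp add: abs_if split: if_splits)
    show "\<bar>real q * fst z - real q * fst z'\<bar> \<le> 2" "\<bar>real q * snd z - real q * snd z'\<bar> \<le> 2"
      using n assms(2,3) unfolding in_cell_def by (auto intro: close)
  qed
  finally show ?thesis by simp
qed

lemma transmitters_finite: "finite (transmitters q \<nu> T s u)"
  by (rule finite_subset[of _ "{..<node_count \<nu>}"]) (auto simp: transmitters_def)

text \<open>The current task of a cell determines the sender, so a cell contains at most one
  transmitter at a time.\<close>

lemma transmitters_inj: "inj_on (cell_of q \<nu>) (transmitters q \<nu> T s u)"
  by (rule inj_onI) (simp add: transmitters_def)

text \<open>The \<open>integral\<close> in \<open>capacity\<close> is 0 for a nonintegrable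
  integrand, so a lower bound on the capacity requires the rate to be measurable in time. Time
  enters the set of transmitters only through the rounded index of the packet slot.\<close>

lemma transmitters_measurable [measurable]:
  "Measurable.pred borel (\<lambda>u. v \<in> transmitters q \<nu> T s (f u))"
  if [measurable]: "f \<in> borel_measurable borel"
proof -
  define N where "N = length (tasks q \<nu> (cell_of q \<nu> v))"
  have [measurable]: "(\<lambda>u. nat \<lfloor>real N * f u / T\<rfloor>) \<in> measurable borel (count_space UNIV)"
    by measurable
  have "Measurable.pred borel (\<lambda>u. v < node_count \<nu> \<and> active s (cell_of q \<nu> v) \<and> tasks q \<nu> (cell_of q \<nu> v) \<noteq> [] \<and>
      (\<lambda>j. v = sender q \<nu> s (tasks q \<nu> (cell_of q \<nu> v) ! j)) (nat \<lfloor>real N * f u / T\<rfloor>))"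
    by measurable
  then show ?thesis
    by (simp add: transmitters_def current_task_def N_def)
qed

text \<open>The power, proportional to the cell area to the \<open>\<alpha> / 2\<close>, exactly
  compensates the scale: received power depends only on the distance measured in cell widths. All
  constants are therefore independent of the density.\<close>

lemma scaled_power_gain:
  fixes q :: nat
  assumes "0 < q" "0 \<le> r"
  shows "P * (1 / real q ^ 2) powr (\<alpha> / 2) * r powr (- \<alpha>) = P * (real q * r) powr (- \<alpha>)"
proof -
  have "real q powr 2 = real q ^ 2" using assms by (intro powr_numeral) simp
  then have "(1 / real q ^ 2) powr (\<alpha> / 2) = (real q powr (- 2)) powr (\<alpha> / 2)"
    by (simp only: powr_minus_divide)
  also have "\<dots> = real q powr (- \<alpha>)" by (simp add: powr_powr)
  finally show ?thesis using assms by (simp add: powr_mult)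
qed


text \<open>What the deterministic part asks of a realisation. Occupied cells make
  \<open>relay\<close> meaningful.\<close>

locale regular_overlay = overlay +
  assumes exponent: "\<alpha> > 2"
    and noise_pos: "N0 > 0" and power_pos: "P0 > 0" "P1 > 0"
    and slot_pos: "tp > 0"
    and cells_pos: "0 < qp" "0 < qs"
    and pri_square: "\<And>v. v < node_count pri \<Longrightarrow> node_pos pri v \<in> unit_square"
    and sec_square: "\<And>v. v < node_count sec \<Longrightarrow> node_pos sec v \<in> unit_square"
    and pri_inj: "inj_on (node_pos pri) {..<node_count pri}"
    and pri_shuffle: "shuffle pri permutes {..<node_count pri}"
    and cells_occupied: "\<And>c. fst c < qp \<Longrightarrow> snd c < qp \<Longrightarrow> cell_nodes qp pri c \<noteq> []"
begin

section \<open>Interference and rates between near primary cells\<close>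

abbreviation "pcell \<equiv> cell_of qp pri"

lemma in_cell_pri: "v < node_count pri \<Longrightarrow> in_cell qp (node_pos pri v) (pcell v)"
  using in_cell_index[OF cells_pos(1) pri_square] by (simp add: cell_of_def)

lemma in_cell_sec: "v < node_count sec \<Longrightarrow> in_cell qs (node_pos sec v) (cell_of qs sec v)"
  using in_cell_index[OF cells_pos(2) sec_square] by (simp add: cell_of_def)

lemma pri_power_gain: "0 \<le> r \<Longrightarrow> pri_power * gain r = P0 * (real qp * r) powr (- \<alpha>)"
  unfolding pri_power_def gain_def by (rule scaled_power_gain[OF cells_pos(1)])

lemma sec_power_gain: "0 \<le> r \<Longrightarrow> sec_power * gain r = P1 * (real qs * r) powr (- \<alpha>)"
  unfolding sec_power_def gain_def by (rule scaled_power_gain[OF cells_pos(2)])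

definition interference_bound :: real where
  "interference_bound = 2 powr \<alpha> * (lattice_total (\<alpha> / 2))\<^sup>2"

lemma interference_bound_nonneg: "0 \<le> interference_bound"
  by (simp add: interference_bound_def)

text \<open>Passing from actual distances to distances between cells costs at most a factor 2, hence
  the factor \<open>2 powr \<alpha>\<close> in \<open>interference_bound\<close>.\<close>

lemma sum_gain_le:
  assumes "finite W" "inj_on f W"
    and "\<And>w. w \<in> W \<Longrightarrow> max 1 (cell_dist (f w) r) / 2 \<le> x w"
  shows "(\<Sum>w\<in>W. x w powr (- \<alpha>)) \<le> interference_bound"
proof -
  have "x w powr (- \<alpha>) \<le> 2 powr \<alpha> * (max 1 (cell_dist (f w) r)) powr (- \<alpha>)" if "w \<in> W" for w
  proof -
    have "x w powr (- \<alpha>) \<le> (max 1 (cell_dist (f w) r) / 2) powr (- \<alpha>)"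
      using assms(3)[OF that] exponent by (intro powr_mono2') auto
    also have "\<dots> = 2 powr \<alpha> * (max 1 (cell_dist (f w) r)) powr (- \<alpha>)"
      by (simp add: powr_divide powr_minus field_simps)
    finally show ?thesis .
  qed
  then have "(\<Sum>w\<in>W. x w powr (- \<alpha>)) \<le> (\<Sum>w\<in>W. 2 powr \<alpha> * (max 1 (cell_dist (f w) r)) powr (- \<alpha>))"
    by (rule sum_mono)
  also have "\<dots> \<le> interference_bound"
    unfolding interference_bound_def sum_distrib_left[symmetric]
    using sum_cell_dist_le[OF exponent assms(1,2)] by (intro mult_left_mono) auto
  finally show ?thesis .
qed

lemma sec_tx_finite: "finite (sec_tx s u)"
  using transmitters_finite by (simp add: sec_tx_def Let_def)

lemma sec_tx_inj: "inj_on (cell_of qs sec) (sec_tx s u)"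
  unfolding sec_tx_def Let_def by (rule inj_on_subset[OF transmitters_inj]) auto

lemma sec_tx_less: "v \<in> sec_tx s u \<Longrightarrow> v < node_count sec"
  by (auto simp: sec_tx_def Let_def transmitters_def)

text \<open>
  The half-width of a preservation region exceeds \<open>3 / (2 * qp) + 1 / (2 * qs)\<close>, and a receiver of
  the protected cell is within \<open>3 / (2 * qp)\<close> of the centre in each coordinate.
\<close>

lemma preservation_region_far:
  assumes "in_cell qp z r" "near_cells c r" "z' \<notin> preservation_region c"
  shows "1 / 2 \<le> real qs * dist z' z"
proof -
  define H where "H = real region_width / (2 * real qs)"
  have "sqrt ((1 / real qp ^ 2) / (1 / real qs ^ 2)) = real qs / real qp"
    by (simp add: real_sqrt_divide)
  then have "real region_width > 3 * (real qs / real qp) + 1"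
    unfolding region_width_def by (simp add: of_nat_nat) linarith
  then have H: "H > 3 / (2 * real qp) + 1 / (2 * real qs)"
  proof -
    have "3 / (2 * real qp) + 1 / (2 * real qs) = (3 * (real qs / real qp) + 1) / (2 * real qs)"
      using cells_pos by (simp add: add_divide_distrib)
    also have "\<dots> < H"
      unfolding H_def using \<open>real region_width > _\<close> cells_pos by (intro divide_strict_right_mono) auto
    finally show ?thesis .
  qed
  have coord: "1 / 2 \<le> real qs * d"
    if d: "\<bar>x' - x\<bar> \<le> d" and far: "\<not> \<bar>x' - (real a + 1 / 2) / real qp\<bar> \<le> H"
      and x: "real b \<le> real qp * x" "real qp * x \<le> real b + 1" and ab: "\<bar>int a - int b\<bar> \<le> 1"
    for x x' d :: real and a b :: nat
  proof -
    have "\<bar>real a - real b\<bar> = real_of_int \<bar>int a - int b\<bar>" by simp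
    then have "\<bar>real a - real b\<bar> \<le> 1" using ab by (simp only: of_int_le_1_iff)
    then have "\<bar>real qp * x - (real a + 1 / 2)\<bar> \<le> 3 / 2" using x by (simp add: abs_if split: if_splits)
    then have "\<bar>x - (real a + 1 / 2) / real qp\<bar> \<le> 3 / (2 * real qp)"
    proof -
      have "x - (real a + 1 / 2) / real qp = (real qp * x - (real a + 1 / 2)) / real qp"
        using cells_pos by (simp add: field_simps)
      then have "\<bar>x - (real a + 1 / 2) / real qp\<bar> = \<bar>real qp * x - (real a + 1 / 2)\<bar> / real qp"
        by (simp add: abs_divide)
      also have "\<dots> \<le> (3 / 2) / real qp"
        using \<open>\<bar>real qp * x - (real a + 1 / 2)\<bar> \<le> 3 / 2\<close> by (intro divide_right_mono) auto
      finally show ?thesis by simp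
    qed
    then have "1 / (2 * real qs) \<le> d" using d far H by linarith
    then show ?thesis using cells_pos by (simp add: field_simps)
  qed
  from assms(3) have "\<not> \<bar>fst z' - (real (fst c) + 1 / 2) / real qp\<bar> \<le> H \<or>
      \<not> \<bar>snd z' - (real (snd c) + 1 / 2) / real qp\<bar> \<le> H"
    by (simp add: preservation_region_def H_def)
  then show ?thesis
  proof
    assume *: "\<not> \<bar>fst z' - (real (fst c) + 1 / 2) / real qp\<bar> \<le> H"
    show ?thesis
      by (rule coord[OF _ *, of "fst z" _ "fst r"])
        (use assms(1,2) dist_fst_le[of z' z] in \<open>auto simp: in_cell_def near_cells_def dist_real_def\<close>)
  next
    assume *: "\<not> \<bar>snd z' - (real (snd c) + 1 / 2) / real qp\<bar> \<le> H"
    show ?thesis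
      by (rule coord[OF _ *, of "snd z" _ "snd r"])
        (use assms(1,2) dist_snd_le[of z' z] in \<open>auto simp: in_cell_def near_cells_def dist_real_def\<close>)
  qed
qed

lemma interference_nonneg: "0 \<le> interference s u v z"
  unfolding interference_def pri_power_def sec_power_def gain_def
  using power_pos by (intro add_nonneg_nonneg sum_nonneg mult_nonneg_nonneg) auto

lemma interference_le:
  assumes v: "v \<in> pri_tx s u" and w: "w < node_count pri" and near: "near_cells (pcell v) (pcell w)"
  shows "interference s u v (node_pos pri w) \<le> (P0 + P1) * interference_bound"
proof -
  define z where "z = node_pos pri w"
  have z: "in_cell qp z (pcell w)" "z \<in> unit_square"
    using in_cell_pri[OF w] pri_square[OF w] by (auto simp: z_def)
  define r where "r = (cell_index qs (fst z), cell_index qs (snd z))"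
  have zr: "in_cell qs z r" unfolding r_def by (rule in_cell_index[OF cells_pos(2) z(2)])
  have "(\<Sum>x\<in>pri_tx s u - {v}. pri_power * gain (dist (node_pos pri x) z))
      = P0 * (\<Sum>x\<in>pri_tx s u - {v}. (real qp * dist (node_pos pri x) z) powr (- \<alpha>))"
    by (simp add: pri_power_gain sum_distrib_left)
  also have "\<dots> \<le> P0 * interference_bound"
  proof (intro mult_left_mono sum_gain_le[where f = pcell and r = "pcell w"])
    show "finite (pri_tx s u - {v})" by (simp add: pri_tx_def transmitters_finite)
    show "inj_on pcell (pri_tx s u - {v})"
      using transmitters_inj unfolding pri_tx_def by (rule inj_on_subset) auto
    fix x assume x: "x \<in> pri_tx s u - {v}"
    then have xn: "x < node_count pri" by (auto simp: pri_tx_def transmitters_def)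
    have "phase (pcell x) = phase (pcell v)"
      using x v by (auto simp: pri_tx_def transmitters_def active_def)
    moreover have "pcell x \<noteq> pcell v"
      using x v transmitters_inj unfolding pri_tx_def by (metis Diff_iff inj_on_def insertI1)
    ultimately have far: "\<bar>int (fst (pcell x)) - int (fst (pcell v))\<bar> \<ge> 5 \<or> \<bar>int (snd (pcell x)) - int (snd (pcell v))\<bar> \<ge> 5"
      by (rule phase_eq_imp_far)
    \<comment> \<open>The receiver is at most one cell away from the sender, so 4 of the reuse
      distance 5 remain. For a cell distance \<open>D \<ge> 4\<close> the guaranteed distance
      \<open>D - 1\<close> is at least \<open>D / 2\<close>.\<close>
    have "\<bar>int (fst (pcell x)) - int (fst (pcell w))\<bar> \<ge> 4 \<or> \<bar>int (snd (pcell x)) - int (snd (pcell w))\<bar> \<ge> 4"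
    proof -
      have tri: "\<bar>a - c\<bar> \<ge> 4" if "\<bar>a - b\<bar> \<ge> 5" "\<bar>b - c\<bar> \<le> 1" for a b c :: int using that by arith
      show ?thesis using far near unfolding near_cells_def by (meson tri)
    qed
    note far4 = this
    have "cell_dist (pcell x) (pcell w) \<ge> 4"
    proof -
      have real_abs: "\<bar>real a - real b\<bar> = real_of_int \<bar>int a - int b\<bar>" for a b by simp
      show ?thesis
        using far4 unfolding cell_dist_def real_abs le_max_iff_disj
        by (simp only: of_int_numeral_le_iff)
    qed
    moreover have "cell_dist (pcell x) (pcell w) - 1 \<le> real qp * dist (node_pos pri x) z"
      by (rule scaled_dist_ge[OF cells_pos(1) in_cell_pri[OF xn] z(1)])
    ultimately show "max 1 (cell_dist (pcell x) (pcell w)) / 2 \<le> real qp * dist (node_pos pri x) z"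
      by (simp add: max_def)
  qed (use power_pos in auto)
  finally have 1: "(\<Sum>x\<in>pri_tx s u - {v}. pri_power * gain (dist (node_pos pri x) z)) \<le> P0 * interference_bound" .
  have "(\<Sum>x\<in>sec_tx s u. sec_power * gain (dist (node_pos sec x) z))
      = P1 * (\<Sum>x\<in>sec_tx s u. (real qs * dist (node_pos sec x) z) powr (- \<alpha>))"
    by (simp add: sec_power_gain sum_distrib_left)
  also have "\<dots> \<le> P1 * interference_bound"
  proof (intro mult_left_mono sum_gain_le[where f = "cell_of qs sec" and r = r] sec_tx_finite sec_tx_inj)
    fix x assume x: "x \<in> sec_tx s u"
    have "node_pos sec x \<notin> preservation_region (pcell v)"
      using x v by (auto simp: sec_tx_def Let_def)
    from preservation_region_far[OF z(1) near this]
    have "1 / 2 \<le> real qs * dist (node_pos sec x) z" .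
    moreover have "cell_dist (cell_of qs sec x) r - 1 \<le> real qs * dist (node_pos sec x) z"
      by (rule scaled_dist_ge[OF cells_pos(2) in_cell_sec[OF sec_tx_less[OF x]] zr])
    \<comment> \<open>Cell distances are integers. Up to 1 the preservation region supplies the
      distance \<open>1 / 2\<close>; from 2 on, \<open>D - 1 \<ge> D / 2\<close>.\<close>
    moreover have "cell_dist (cell_of qs sec x) r \<le> 1 \<or> cell_dist (cell_of qs sec x) r \<ge> 2"
    proof -
      define D where "D = max \<bar>int (fst (cell_of qs sec x)) - int (fst r)\<bar> \<bar>int (snd (cell_of qs sec x)) - int (snd r)\<bar>"
      have "cell_dist (cell_of qs sec x) r = real_of_int D"
        unfolding D_def cell_dist_def by (simp add: of_int_max)
      then show ?thesis by (cases "D \<le> 1") auto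
    qed
    ultimately show "max 1 (cell_dist (cell_of qs sec x) r) / 2 \<le> real qs * dist (node_pos sec x) z"
      by (auto simp: max_def)
  qed (use power_pos in auto)
  finally have 2: "(\<Sum>x\<in>sec_tx s u. sec_power * gain (dist (node_pos sec x) z)) \<le> P1 * interference_bound" .
  show ?thesis
    using add_mono[OF 1 2] by (simp add: interference_def z_def distrib_right)
qed

definition rate_floor :: real where
  "rate_floor = ln (1 + P0 * 4 powr (- \<alpha>) / (N0 + (P0 + P1) * interference_bound))"

lemma rate_floor_pos: "rate_floor > 0"
  unfolding rate_floor_def using power_pos noise_pos interference_bound_nonneg
  by (intro ln_gt_zero) (auto intro!: divide_pos_pos add_pos_nonneg mult_nonneg_nonneg)

lemma rate_eq:
  "rate s u v w = ln (1 + P0 * (real qp * dist (node_pos pri v) (node_pos pri w)) powr (- \<alpha>) /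
    (N0 + interference s u v (node_pos pri w)))"
  by (simp add: rate_def pri_power_gain)

lemma rate_ge:
  assumes v: "v \<in> pri_tx s u" and w: "w < node_count pri" and near: "near_cells (pcell v) (pcell w)"
    and "v \<noteq> w"
  shows "rate_floor \<le> rate s u v w"
proof -
  have vn: "v < node_count pri" using v by (auto simp: pri_tx_def transmitters_def)
  \<comment> \<open>Since \<open>0 powr (- \<alpha>) = 0\<close>, coinciding positions would give
    rate 0 instead of a large rate; injectivity excludes this.\<close>
  have "node_pos pri v \<noteq> node_pos pri w"
    using pri_inj vn w \<open>v \<noteq> w\<close> by (auto simp: inj_on_def)
  then have "0 < real qp * dist (node_pos pri v) (node_pos pri w)" using cells_pos by simp
  moreover have "real qp * dist (node_pos pri v) (node_pos pri w) \<le> 4"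
    by (rule scaled_dist_le[OF cells_pos(1) in_cell_pri[OF vn] in_cell_pri[OF w] near])
  ultimately have "4 powr (- \<alpha>) \<le> (real qp * dist (node_pos pri v) (node_pos pri w)) powr (- \<alpha>)"
    using exponent by (intro powr_mono2') auto
  then have "P0 * 4 powr (- \<alpha>) / (N0 + (P0 + P1) * interference_bound)
      \<le> P0 * (real qp * dist (node_pos pri v) (node_pos pri w)) powr (- \<alpha>) /
        (N0 + interference s u v (node_pos pri w))"
    using interference_le[OF v w near] power_pos noise_pos interference_nonneg[of s u v "node_pos pri w"]
    by (intro frac_le mult_left_mono add_left_mono) auto
  moreover have "0 \<le> P0 * 4 powr (- \<alpha>) / (N0 + (P0 + P1) * interference_bound)"
    using power_pos noise_pos interference_bound_nonneg by auto
  ultimately show ?thesis unfolding rate_floor_def rate_eq by (intro ln_mono) auto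
qed

lemma rate_nonneg: "0 \<le> rate s u v w"
  unfolding rate_eq using power_pos noise_pos interference_nonneg[of s u v "node_pos pri w"]
  by (intro ln_ge_zero) auto

lemma rate_le:
  assumes "0 < e" "e \<le> real qp * dist (node_pos pri v) (node_pos pri w)"
  shows "rate s u v w \<le> ln (1 + P0 * e powr (- \<alpha>) / N0)"
proof -
  have "(real qp * dist (node_pos pri v) (node_pos pri w)) powr (- \<alpha>) \<le> e powr (- \<alpha>)"
    using assms exponent by (intro powr_mono2') auto
  then have "P0 * (real qp * dist (node_pos pri v) (node_pos pri w)) powr (- \<alpha>) /
        (N0 + interference s u v (node_pos pri w)) \<le> P0 * e powr (- \<alpha>) / N0"
    using power_pos noise_pos interference_nonneg[of s u v "node_pos pri w"]
    by (intro frac_le mult_left_mono) auto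
  moreover have "0 \<le> P0 * (real qp * dist (node_pos pri v) (node_pos pri w)) powr (- \<alpha>) /
        (N0 + interference s u v (node_pos pri w))"
    using power_pos noise_pos interference_nonneg[of s u v "node_pos pri w"] by auto
  ultimately show ?thesis unfolding rate_eq by (intro ln_mono) auto
qed

lemma pri_tx_measurable [measurable]: "Measurable.pred borel (\<lambda>u. v \<in> pri_tx s u)"
  unfolding pri_tx_def by measurable

lemma sec_tx_measurable [measurable]: "Measurable.pred borel (\<lambda>u. v \<in> sec_tx s u)"
proof -
  have [measurable]: "(\<lambda>u :: real. nat \<lfloor>25 * u / tp\<rfloor>) \<in> measurable borel (count_space UNIV)"
    by measurable
  \<comment> \<open>The secondary slot depends on \<open>u\<close>, but takes only countably many
    values and can be held fixed on each of them.\<close>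
  have "Measurable.pred borel (\<lambda>u. v \<in> transmitters qs sec (tp / 25) (25 * s + nat \<lfloor>25 * u / tp\<rfloor>)
      (u - real (nat \<lfloor>25 * u / tp\<rfloor>) * (tp / 25)))"
    by (rule measurable_compose_countable[where
      f = "\<lambda>j u. v \<in> transmitters qs sec (tp / 25) (25 * s + j) (u - real j * (tp / 25))"]) measurable
  moreover have "Measurable.pred borel (\<lambda>u. \<forall>w\<in>{..<node_count pri}. w \<in> pri_tx s u \<longrightarrow>
      node_pos sec v \<notin> preservation_region (pcell w))"
    by measurable
  moreover have "(v \<in> sec_tx s u) \<longleftrightarrow> v \<in> transmitters qs sec (tp / 25) (25 * s + nat \<lfloor>25 * u / tp\<rfloor>)
      (u - real (nat \<lfloor>25 * u / tp\<rfloor>) * (tp / 25)) \<and> (\<forall>w\<in>{..<node_count pri}. w \<in> pri_tx s u \<longrightarrow>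
      node_pos sec v \<notin> preservation_region (pcell w))" for u
    by (auto simp: sec_tx_def Let_def pri_tx_def transmitters_def)
  ultimately show ?thesis by simp
qed

lemma rate_measurable [measurable]: "(\<lambda>u. rate s u v w) \<in> borel_measurable borel"
proof -
  \<comment> \<open>Sums over index sets varying with \<open>u\<close> are rewritten as sums over
    fixed ranges with indicators, where measurability is termwise.\<close>
  have p: "(\<Sum>x\<in>pri_tx s u - {v}. f x) = (\<Sum>x<node_count pri. if x \<in> pri_tx s u \<and> x \<noteq> v then f x else 0)"
    for f :: "nat \<Rightarrow> real" and u
    by (rule sum.mono_neutral_cong_left) (auto simp: pri_tx_def transmitters_def)
  have s: "(\<Sum>x\<in>sec_tx s u. f x) = (\<Sum>x<node_count sec. if x \<in> sec_tx s u then f x else 0)"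
    for f :: "nat \<Rightarrow> real" and u
    by (rule sum.mono_neutral_cong_left) (auto dest: sec_tx_less)
  show ?thesis
    unfolding rate_def interference_def p s by measurable
qed

end

section \<open>Capacity of a hop\<close>

lemma current_task_eq_iff:
  assumes "j < length (tasks q \<nu> c)" "0 < T" "0 \<le> u" "u < T"
  shows "current_task q \<nu> T u c = tasks q \<nu> c ! j \<longleftrightarrow>
    real j * T / real (length (tasks q \<nu> c)) \<le> u \<and> u < real (Suc j) * T / real (length (tasks q \<nu> c))"
proof -
  define n where "n = length (tasks q \<nu> c)"
  define x where "x = real n * u / T"
  have n: "0 < real n" using assms(1) unfolding n_def by linarith
  have x: "0 \<le> x" "x < real n" using assms n by (auto simp: x_def field_simps)
  have "nat \<lfloor>x\<rfloor> < n" using x by linarith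
  then have "current_task q \<nu> T u c = tasks q \<nu> c ! j \<longleftrightarrow> nat \<lfloor>x\<rfloor> = j"
    using assms(1) unfolding current_task_def n_def[symmetric] x_def[symmetric]
    by (intro nth_eq_iff_index_eq distinct_tasks) (auto simp: n_def)
  also have "\<dots> \<longleftrightarrow> real j \<le> x \<and> x < real (Suc j)"
    using x by linarith
  also have "\<dots> \<longleftrightarrow> real j * T / real n \<le> u \<and> u < real (Suc j) * T / real n"
    unfolding x_def using assms(2) n by (simp add: field_simps del: of_nat_Suc)
  finally show ?thesis by (simp add: n_def)
qed

text \<open>Tasks are listed without repetition, so a task owns exactly one of the equal packet
  slots.\<close>

lemma packet_slot_interval:
  assumes "k \<in> set (tasks q \<nu> c)" "0 < T"
  obtains a b where "{u \<in> {0..<T}. current_task q \<nu> T u c = k} = {a..<b}" "a < b"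
    "b - a = T / real (length (tasks q \<nu> c))"
proof -
  define n where "n = length (tasks q \<nu> c)"
  obtain j where j: "j < n" "k = tasks q \<nu> c ! j" using assms(1) by (auto simp: in_set_conv_nth n_def)
  have n: "0 < real n" using j by simp
  have "real (Suc j) * T \<le> real n * T" using j assms(2) by (intro mult_right_mono of_nat_mono) auto
  then have up: "real (Suc j) * T / real n \<le> T" using n by (simp add: field_simps del: of_nat_Suc)
  have lo: "0 \<le> real j * T / real n" using assms(2) by simp
  have "{u \<in> {0..<T}. current_task q \<nu> T u c = k} = {real j * T / real n..<real (Suc j) * T / real n}"
  proof (rule set_eqI)
    fix u
    show "u \<in> {u \<in> {0..<T}. current_task q \<nu> T u c = k} \<longleftrightarrow>
        u \<in> {real j * T / real n..<real (Suc j) * T / real n}"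
    proof (cases "0 \<le> u \<and> u < T")
      case True
      then show ?thesis
        using current_task_eq_iff[of j q \<nu> c T u] j assms(2) unfolding n_def by simp
    next
      case False
      then show ?thesis using up lo by (auto simp del: of_nat_Suc)
    qed
  qed
  moreover have "real (Suc j) * T / real n - real j * T / real n = T / real n"
    by (simp add: diff_divide_distrib[symmetric] left_diff_distrib[symmetric])
  moreover have "real j * T / real n < real (Suc j) * T / real n"
    using n assms(2) by (intro divide_strict_right_mono mult_strict_right_mono) auto
  ultimately show ?thesis using that by (simp add: n_def)
qed

lemma bounded_measurable_integrable_on:
  fixes f :: "real \<Rightarrow> real"
  assumes "f \<in> borel_measurable borel" "\<And>x. \<bar>f x\<bar> \<le> B"
  shows "f integrable_on {a..<b}"
proof -
  have "set_integrable lborel {a..<b} f"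
    unfolding set_integrable_def
    using assms by (intro integrableI_bounded_set_indicator[where B = B]) (cases "a \<le> b"; auto)+
  then show ?thesis by (rule set_borel_integral_eq_integral(1))
qed

lemma has_integral_const_Ico:
  fixes a b c :: real
  assumes "a \<le> b"
  shows "((\<lambda>_. c) has_integral (c * (b - a))) {a..<b}"
proof -
  have "((\<lambda>_. c) has_integral (c * (b - a))) {a..b}"
    using has_integral_const_real[of c a b] assms by (simp add: mult.commute)
  moreover have "((\<lambda>_. c) has_integral (c * (b - a))) {a..<b} \<longleftrightarrow>
      ((\<lambda>_. c) has_integral (c * (b - a))) {a..b}"
    by (rule has_integral_spike_set_eq)
      (auto intro: negligible_subset[OF negligible_sing[of b]])
  ultimately show ?thesis by simp
qed

section \<open>Turns of the relays\<close>

text \<open>With \<open>s = 25 * j + phase c\<close>, the turn counter equals \<open>j\<close>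
  during the 25 slots ending with \<open>s\<close>. A node receiving in one of them is thus still
  the relay when its cell becomes active.\<close>

lemma relay_eq:
  assumes "active s c" "s < s0 + 25" "s0 \<le> s"
  shows "relay q \<nu> s0 c = relay q \<nu> s c"
proof -
  define j where "j = s div 25"
  define d where "d = s - s0"
  have s: "s = 25 * j + phase c"
    using assms(1) mult_div_mod_eq[of 25 s] unfolding active_def j_def by simp
  have "s0 + 24 - phase c = 25 * j + (24 - d)" "d \<le> 24"
    using assms phase_less[of c] s by (auto simp: d_def)
  then have "(s0 + 24 - phase c) div 25 = j" by simp
  moreover have "(s + 24 - phase c) div 25 = j" by (simp add: s)
  ultimately have "(s0 + 24 - phase c) div 25 = (s + 24 - phase c) div 25" by simp
  then show ?thesis by (simp add: relay_def)
qed

lemma relay_turn: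
  "relay q \<nu> (25 * j + phase c) c = cell_nodes q \<nu> c ! (j mod length (cell_nodes q \<nu> c))"
proof -
  have "(25 * j + phase c + 24 - phase c) div 25 = j" by simp
  then show ?thesis by (simp add: relay_def Let_def)
qed

lemma relay_in_cell:
  assumes "cell_nodes q \<nu> c \<noteq> []"
  shows "relay q \<nu> s c < node_count \<nu>" "cell_of q \<nu> (relay q \<nu> s c) = c"
proof -
  have "relay q \<nu> s c \<in> set (cell_nodes q \<nu> c)"
    unfolding relay_def Let_def using assms by (intro nth_mem) auto
  then show "relay q \<nu> s c < node_count \<nu>" "cell_of q \<nu> (relay q \<nu> s c) = c"
    by (auto simp: cell_nodes_def)
qed

context regular_overlay
begin

abbreviation "proute \<equiv> route qp pri"
abbreviation "phops \<equiv> hop_count qp pri"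

lemma src_less: "i < pair_count pri \<Longrightarrow> src pri i < node_count pri"
  and dst_less: "i < pair_count pri \<Longrightarrow> dst pri i < node_count pri"
  using permutes_in_image[OF pri_shuffle] by (auto simp: src_def dst_def pair_count_def)

lemma src_neq_dst: "src pri i \<noteq> dst pri j"
proof
  assume "src pri i = dst pri j"
  then have "2 * i = 2 * j + 1"
    using permutes_inj[OF pri_shuffle] unfolding src_def dst_def by (rule injD[rotated])
  then show False by presburger
qed

lemma pcell_less: "fst (pcell v) < qp" "snd (pcell v) < qp"
  by (simp_all add: cell_of_def cell_index_less cells_pos)

lemma route_cell_occupied: "c \<in> set (proute i) \<Longrightarrow> cell_nodes qp pri c \<noteq> []"
  using corner_path_less[of c _ _ qp] pcell_less
  by (intro cells_occupied) (auto simp: route_eq_corner_path)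

lemma route_first: "proute i ! 0 = pcell (src pri i)"
  by (simp add: route_eq_corner_path corner_path_first)

lemma route_last: "proute i ! (length (proute i) - 1) = pcell (dst pri i)"
  unfolding route_eq_corner_path by (rule corner_path_last)

lemma route_length_pos: "0 < length (proute i)"
  using route_nonempty by simp

lemma route_inj:
  "g < length (proute i) \<Longrightarrow> h < length (proute i) \<Longrightarrow> proute i ! g = proute i ! h \<longleftrightarrow> g = h"
  using distinct_route by (rule nth_eq_iff_index_eq)

lemma sender_in_cell:
  assumes "i < pair_count pri" "h < phops i"
  shows "sender qp pri s (i, h) < node_count pri" "pcell (sender qp pri s (i, h)) = proute i ! h"
  using assms src_less route_first relay_in_cell[OF route_cell_occupied[OF nth_mem[OF hop_less_length]]]
  by (auto simp: sender_def)

text \<open>The position on the route of the cell receiving hop \<open>h\<close>. For a hop below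
  \<open>phops i\<close> the minimum matters only if source and destination share a cell: then hop 0
  stays in it.\<close>

definition target :: "nat \<Rightarrow> nat \<Rightarrow> nat" where
  "target i h = min (Suc h) (length (proute i) - 1)"

lemma target_less: "target i h < length (proute i)"
  using route_length_pos[of i] unfolding target_def by linarith

lemma hop_count_cases:
  "(length (proute i) = 1 \<and> phops i = 1) \<or> (length (proute i) \<ge> 2 \<and> phops i = length (proute i) - 1)"
  using route_length_pos[of i] unfolding hop_count_def by linarith

lemma receiver_in_cell:
  assumes "i < pair_count pri" "h < phops i"
  shows "receiver qp pri s (i, h) < node_count pri"
    "pcell (receiver qp pri s (i, h)) = proute i ! target i h"
proof -
  have last: "target i h = length (proute i) - 1" if "Suc h = phops i"
    using that hop_count_cases[of i] by (auto simp: target_def)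
  have step: "target i h = Suc h" "Suc h < length (proute i)" if "Suc h \<noteq> phops i"
    using that assms(2) hop_count_cases[of i] by (auto simp: target_def)
  show "receiver qp pri s (i, h) < node_count pri"
    "pcell (receiver qp pri s (i, h)) = proute i ! target i h"
    using assms dst_less route_last[of i] last step relay_in_cell[OF route_cell_occupied[OF nth_mem[of "Suc h"]]]
    by (auto simp: receiver_def)
qed

lemma hop_near:
  assumes "h < phops i"
  shows "near_cells (proute i ! h) (proute i ! target i h)"
proof (cases "Suc h < length (proute i)")
  case True
  then have "target i h = Suc h" by (simp add: target_def)
  then show ?thesis using near_cells_corner_path True by (simp add: route_eq_corner_path)
next
  case False
  then have "target i h = h" using hop_less_length[OF assms] by (simp add: target_def)
  then show ?thesis by (simp add: near_cells_refl)
qed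

lemma sender_neq_receiver:
  assumes "i < pair_count pri" "h < phops i"
  shows "sender qp pri s (i, h) \<noteq> receiver qp pri s (i, h)"
proof (cases "target i h = h")
  case True
  then have "h = length (proute i) - 1" by (auto simp: target_def min_def split: if_splits)
  then have "length (proute i) = 1" "phops i = 1" "h = 0"
    using assms hop_count_cases[of i] by auto
  then show ?thesis using src_neq_dst by (simp add: sender_def receiver_def)
next
  case False
  then have "proute i ! target i h \<noteq> proute i ! h"
    using route_inj target_less hop_less_length[OF assms(2)] by blast
  then show ?thesis
    using sender_in_cell(2)[OF assms] receiver_in_cell(2)[OF assms] by metis
qed

lemma task_mem: "i < pair_count pri \<Longrightarrow> h < phops i \<Longrightarrow> (i, h) \<in> set (tasks qp pri (proute i ! h))"
  by (simp add: set_tasks)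

lemma sender_transmits:
  assumes "i < pair_count pri" "h < phops i" "active s (proute i ! h)"
    "current_task qp pri tp u (proute i ! h) = (i, h)"
  shows "sender qp pri s (i, h) \<in> pri_tx s u"
  using assms sender_in_cell[OF assms(1,2), of s] task_mem[OF assms(1,2)]
  by (auto simp: pri_tx_def transmitters_def)

text \<open>For fixed \<open>v\<close> and \<open>w\<close> the noise alone bounds the rate
  uniformly in time, which yields integrability. The bound depends on the distance and is useless as
  a throughput estimate.\<close>

lemma rate_bounded: "\<bar>rate s u v w\<bar> \<le>
  ln (1 + P0 * (real qp * dist (node_pos pri v) (node_pos pri w)) powr (- \<alpha>) / N0)"
proof (cases "dist (node_pos pri v) (node_pos pri w) = 0")
  case True
  then show ?thesis by (simp add: rate_eq)
next
  case False
  then show ?thesis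
    using rate_le[OF _ order_refl, of v w s u] rate_nonneg[of s u v w] cells_pos by simp
qed

lemma rate_integrable: "(\<lambda>u. rate s u v w) integrable_on {a..<b}"
  using rate_measurable rate_bounded by (rule bounded_measurable_integrable_on)

lemma capacity_inactive: "\<not> active s (proute i ! h) \<Longrightarrow> capacity s (i, h) = 0"
  by (simp add: capacity_def)

lemma
  assumes ih: "i < pair_count pri" "h < phops i" and act: "active s (proute i ! h)"
  shows capacity_ge: "rate_floor * tp / real (length (tasks qp pri (proute i ! h))) \<le> capacity s (i, h)"
    and capacity_le: "(\<And>u. rate s u (sender qp pri s (i, h)) (receiver qp pri s (i, h)) \<le> B) \<Longrightarrow>
      capacity s (i, h) \<le> B * tp / real (length (tasks qp pri (proute i ! h)))"
proof -
  let ?f = "\<lambda>u. rate s u (sender qp pri s (i, h)) (receiver qp pri s (i, h))"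
  obtain a b where ab: "{u \<in> {0..<tp}. current_task qp pri tp u (proute i ! h) = (i, h)} = {a..<b}" "a < b"
    "b - a = tp / real (length (tasks qp pri (proute i ! h)))"
    by (rule packet_slot_interval[OF task_mem[OF ih] slot_pos])
  have cap: "capacity s (i, h) = integral {a..<b} ?f"
    using act ab(1) by (simp add: capacity_def Let_def)
  have int: "(?f has_integral integral {a..<b} ?f) {a..<b}"
    using rate_integrable by (rule integrable_integral)
  have "rate_floor * (b - a) \<le> integral {a..<b} ?f"
  proof (rule has_integral_le[OF has_integral_const_Ico int])
    fix u assume "u \<in> {a..<b}"
    then have "current_task qp pri tp u (proute i ! h) = (i, h)"
      unfolding ab(1)[symmetric] by (simp only: mem_Collect_eq)
    from sender_transmits[OF ih act this] show "rate_floor \<le> ?f u"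
    proof (rule rate_ge)
      show "near_cells (pcell (sender qp pri s (i, h))) (pcell (receiver qp pri s (i, h)))"
        unfolding receiver_in_cell(2)[OF ih] sender_in_cell(2)[OF ih] by (rule hop_near[OF ih(2)])
    qed (rule receiver_in_cell(1)[OF ih] sender_neq_receiver[OF ih])+
  qed (use ab in simp)
  then show "rate_floor * tp / real (length (tasks qp pri (proute i ! h))) \<le> capacity s (i, h)"
    by (simp add: cap ab(3))
  assume B: "\<And>u. ?f u \<le> B"
  have "integral {a..<b} ?f \<le> B * (b - a)"
    by (rule has_integral_le[OF int has_integral_const_Ico]) (use ab B in auto)
  then show "capacity s (i, h) \<le> B * tp / real (length (tasks qp pri (proute i ! h)))"
    by (simp add: cap ab(3))
qed

lemma capacity_nonneg:
  assumes "i < pair_count pri" "h < phops i"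
  shows "0 \<le> capacity s (i, h)"
proof (cases "active s (proute i ! h)")
  case True
  have "0 \<le> rate_floor * tp / real (length (tasks qp pri (proute i ! h)))"
    using rate_floor_pos slot_pos by simp
  then show ?thesis using capacity_ge[OF assms True] by linarith
qed (simp add: capacity_inactive)

end

section \<open>Flow along a route\<close>

text \<open>Supplies the last active slot of the preceding cell on a route, less than one frame
  back.\<close>

lemma previous_residue:
  fixes s a b :: nat
  assumes "a \<noteq> s mod 25" "a < 25" "25 \<le> s"
  obtains s0 where "s0 < s" "s < s0 + 25" "s0 mod 25 = a"
proof -
  define k where "k = s div 25"
  define b where "b = s mod 25"
  have s: "s = 25 * k + b" by (simp add: k_def b_def)
  have b: "b < 25" by (simp add: b_def)
  show ?thesis
  proof (cases "a < b")
    case True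
    then show ?thesis using that[of "25 * k + a"] assms(2) b by (simp add: s)
  next
    case False
    then have ab: "b < a" using assms(1) by (simp add: b_def)
    have "1 \<le> k" using assms(3) by (simp add: k_def)
    then obtain l where "k = Suc l" by (cases k) auto
    then show ?thesis using that[of "25 * l + a"] assms(2) ab by (simp add: s)
  qed
qed

context regular_overlay
begin

definition transfer :: "nat \<Rightarrow> nat \<Rightarrow> nat \<Rightarrow> real" where
  "transfer i s h = sent (held i s) s (i, h)"

lemma hops_pos: "0 < phops i"
  by (simp add: hop_count_def)

text \<open>A route visits each cell once, so a node in its cell number \<open>g\<close> can forward
  bits of the pair only over hop \<open>g\<close>; in the next lemma it receives them only over hops
  aimed at \<open>g\<close>. The balance of a node thus has at most one term on either side away
  from the ends.\<close>

lemma outgoing_subset: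
  assumes "i < pair_count pri" "pcell v = proute i ! g" "g < length (proute i)"
  shows "{h. 0 < h \<and> h < phops i \<and> sender qp pri s (i, h) = v} \<subseteq> {g} \<inter> {0<..<phops i}"
proof
  fix h assume "h \<in> {h. 0 < h \<and> h < phops i \<and> sender qp pri s (i, h) = v}"
  then have h: "0 < h" "h < phops i" "sender qp pri s (i, h) = v" by auto
  have "proute i ! h = proute i ! g" using sender_in_cell(2)[OF assms(1) h(2), of s] h(3) assms(2) by simp
  then show "h \<in> {g} \<inter> {0<..<phops i}"
    using route_inj[OF hop_less_length[OF h(2)] assms(3)] h by simp
qed

lemma incoming_subset:
  assumes "i < pair_count pri" "pcell v = proute i ! g" "g < length (proute i)"
  shows "{h. h < phops i \<and> receiver qp pri s (i, h) = v} \<subseteq> {h. h < phops i \<and> target i h = g}"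
proof
  fix h assume "h \<in> {h. h < phops i \<and> receiver qp pri s (i, h) = v}"
  then have h: "h < phops i" "receiver qp pri s (i, h) = v" by auto
  have "proute i ! target i h = proute i ! g"
    using receiver_in_cell(2)[OF assms(1) h(1), of s] h(2) assms(2) by simp
  then show "h \<in> {h. h < phops i \<and> target i h = g}"
    using route_inj[OF target_less assms(3)] h by simp
qed

lemma held_step:
  "held i (Suc s) v = held i s v
    + (\<Sum>h | h < phops i \<and> receiver qp pri s (i, h) = v. transfer i s h)
    - (\<Sum>h | 0 < h \<and> h < phops i \<and> sender qp pri s (i, h) = v. transfer i s h)"
  by (simp add: transfer_def)

lemma held_step_relay:
  assumes "i < pair_count pri" "Suc g < phops i" "pcell v = proute i ! Suc g"
  shows "held i (Suc s) v = held i s v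
    + (if receiver qp pri s (i, g) = v then transfer i s g else 0)
    - (if sender qp pri s (i, Suc g) = v then transfer i s (Suc g) else 0)"
proof -
  have len: "Suc g < length (proute i)" by (rule hop_less_length[OF assms(2)])
  have len2: "Suc (Suc g) < length (proute i)" using assms(2) hop_count_cases[of i] by linarith
  have "h = g" if "target i h = Suc g" for h
    using that len2 by (auto simp: target_def min_def split: if_splits)
  then have "{h. h < phops i \<and> receiver qp pri s (i, h) = v} =
      (if receiver qp pri s (i, g) = v then {g} else {})"
    using incoming_subset[OF assms(1,3) len, of s] assms(2) by auto
  moreover have "{h. 0 < h \<and> h < phops i \<and> sender qp pri s (i, h) = v} =
      (if sender qp pri s (i, Suc g) = v then {Suc g} else {})"
    using outgoing_subset[OF assms(1,3) len, of s] assms(2) by auto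
  ultimately show ?thesis unfolding held_step by simp
qed

text \<open>Bits never leave the destination: no hop of positive index starts in its cell, and hop 0
  is not subtracted in \<open>held\<close>.\<close>

lemma held_step_dst:
  assumes "i < pair_count pri"
  shows "held i (Suc s) (dst pri i) = held i s (dst pri i) + transfer i s (phops i - 1)"
proof -
  have len: "length (proute i) - 1 < length (proute i)" using route_length_pos[of i] by simp
  have "h = phops i - 1" if "target i h = length (proute i) - 1" "h < phops i" for h
    using that hop_count_cases[of i] by (auto simp: target_def)
  moreover have "receiver qp pri s (i, phops i - 1) = dst pri i"
    using hops_pos[of i] by (simp add: receiver_def)
  ultimately have "in": "{h. h < phops i \<and> receiver qp pri s (i, h) = dst pri i} = {phops i - 1}"
    using incoming_subset[OF assms route_last[symmetric] len, of s] hops_pos[of i] by auto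
  have "{length (proute i) - 1} \<inter> {0<..<phops i} = {}"
    using hop_count_cases[of i] by auto
  then have out: "{h. 0 < h \<and> h < phops i \<and> sender qp pri s (i, h) = dst pri i} = {}"
    using outgoing_subset[OF assms route_last[symmetric] len, of s] by blast
  show ?thesis unfolding held_step "in" out by simp
qed

lemma transfer_le_capacity: "transfer i s h \<le> capacity s (i, h)"
  by (simp add: transfer_def sent_def)

lemma transfer_nonneg_aux:
  assumes "i < pair_count pri" "h < phops i" "\<And>v. 0 \<le> held i s v"
  shows "0 \<le> transfer i s h"
  using assms capacity_nonneg[OF assms(1,2), of s] by (auto simp: transfer_def sent_def)

text \<open>Per slot a node forwards bits of the pair over at most one hop, and \<open>sent\<close>
  caps that hop at the buffer content.\<close>

lemma held_nonneg:
  assumes "i < pair_count pri"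
  shows "0 \<le> held i s v"
proof (induction s arbitrary: v)
  case (Suc s)
  have "0 \<le> (\<Sum>h | h < phops i \<and> receiver qp pri s (i, h) = v. transfer i s h)"
    using transfer_nonneg_aux[OF assms _ Suc.IH] by (intro sum_nonneg) auto
  moreover have "(\<Sum>h | 0 < h \<and> h < phops i \<and> sender qp pri s (i, h) = v. transfer i s h) \<le> held i s v"
  proof (cases "{h. 0 < h \<and> h < phops i \<and> sender qp pri s (i, h) = v} = {}")
    case True
    show ?thesis unfolding True using Suc.IH by simp
  next
    case False
    then obtain g where g: "0 < g" "g < phops i" "sender qp pri s (i, g) = v" by blast
    have "{h. 0 < h \<and> h < phops i \<and> sender qp pri s (i, h) = v} = {g}"
      using outgoing_subset[OF assms _ hop_less_length[OF g(2)], of v s] g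
        sender_in_cell(2)[OF assms g(2), of s] by auto
    moreover have "transfer i s g \<le> held i s v"
      using g by (simp add: transfer_def sent_def)
    ultimately show ?thesis by simp
  qed
  ultimately show ?case unfolding held_step using Suc.IH[of v] by linarith
qed simp

lemma transfer_nonneg: "i < pair_count pri \<Longrightarrow> h < phops i \<Longrightarrow> 0 \<le> transfer i s h"
  by (rule transfer_nonneg_aux) (auto intro: held_nonneg)

lemma delivered_eq:
  assumes "i < pair_count pri"
  shows "delivered i t = (\<Sum>s<t. transfer i s (phops i - 1))"
proof (induction t)
  case (Suc t)
  then show ?case using held_step_dst[OF assms, of t] by (simp only: delivered_def sum.lessThan_Suc)
qed (simp add: delivered_def)

text \<open>The bits held in a cell are those that have entered minus those that have left; they are nonnegative.\<close>

lemma sum_transfer_Suc_le: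
  assumes i: "i < pair_count pri" and g: "Suc g < phops i"
  shows "(\<Sum>s<t. transfer i s (Suc g)) \<le> (\<Sum>s<t. transfer i s g)"
proof -
  define V where "V = {v. v < node_count pri \<and> pcell v = proute i ! Suc g}"
  have fin: "finite V" by (simp add: V_def)
  have g': "g < phops i" using g by simp
  have "target i g = Suc g" using g hop_count_cases[of i] by (auto simp: target_def)
  then have recv: "receiver qp pri s (i, g) \<in> V" for s
    using receiver_in_cell[OF i g', of s] by (simp add: V_def)
  have send: "sender qp pri s (i, Suc g) \<in> V" for s
    using sender_in_cell[OF i g, of s] by (simp add: V_def)
  have "(\<Sum>v\<in>V. held i t v) = (\<Sum>s<t. transfer i s g) - (\<Sum>s<t. transfer i s (Suc g))"
  proof (induction t)
    case (Suc t)
    have "(\<Sum>v\<in>V. held i (Suc t) v) = (\<Sum>v\<in>V. held i t v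
        + (if receiver qp pri t (i, g) = v then transfer i t g else 0)
        - (if sender qp pri t (i, Suc g) = v then transfer i t (Suc g) else 0))"
      by (rule sum.cong) (use held_step_relay[OF i g] in \<open>auto simp: V_def simp del: held.simps\<close>)
    also have "\<dots> = (\<Sum>v\<in>V. held i t v) + transfer i t g - transfer i t (Suc g)"
      using fin recv[of t] send[of t] by (simp add: sum.distrib sum_subtractf)
    finally show ?case using Suc.IH by simp
  qed simp
  moreover have "0 \<le> (\<Sum>v\<in>V. held i t v)" using held_nonneg[OF i] by (rule sum_nonneg)
  ultimately show ?thesis by linarith
qed

text \<open>Accumulated flow does not increase along the route, so every single hop is a bottleneck.
  The induction runs backwards from the last hop to \<open>h\<close>.\<close>

lemma delivered_le_sum_capacity:
  assumes i: "i < pair_count pri" and h: "h < phops i"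
  shows "delivered i t \<le> (\<Sum>s<t. capacity s (i, h))"
proof -
  have "h \<le> phops i - 1" using h by simp
  then have "(\<Sum>s<t. transfer i s (phops i - 1)) \<le> (\<Sum>s<t. transfer i s h)"
  proof (induction rule: inc_induct)
    case (step n)
    then show ?case using sum_transfer_Suc_le[OF i, of n t] by linarith
  qed simp
  also have "\<dots> \<le> (\<Sum>s<t. capacity s (i, h))"
    by (intro sum_mono transfer_le_capacity)
  finally show ?thesis by (simp add: delivered_eq[OF i])
qed

text \<open>
  A relay that receives \<open>\<kappa>\<close> bits holds the turn until the next active slot of its cell, so it can
  forward them then: a steady inflow of \<open>\<kappa>\<close> bits per frame moves on one hop with a delay of at
  most one frame.
\<close>

lemma transfer_ge:
  assumes i: "i < pair_count pri" and h: "h < phops i"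
    and cap: "\<And>s h. h < phops i \<Longrightarrow> active s (proute i ! h) \<Longrightarrow> \<kappa> \<le> capacity s (i, h)"
    and "active s (proute i ! h)" "25 * h \<le> s"
  shows "\<kappa> \<le> transfer i s h"
  using h assms(4,5)
proof (induction h arbitrary: s)
  case 0
  then show ?case using cap[of 0 s] by (simp add: transfer_def sent_def)
next
  case (Suc g)
  define c where "c = proute i ! g"
  define c' where "c' = proute i ! Suc g"
  have g: "g < phops i" using Suc.prems by simp
  have tg: "target i g = Suc g" using Suc.prems hop_count_cases[of i] by (auto simp: target_def)
  have "c \<noteq> c'"
    using route_inj[OF hop_less_length[OF g] hop_less_length[OF Suc.prems(1)]] by (simp add: c_def c'_def)
  then have "phase c \<noteq> phase c'"
    using hop_near[OF g] near_cells_phase unfolding c_def c'_def tg by blast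
  moreover have s: "s mod 25 = phase c'" using Suc.prems by (simp add: active_def c'_def)
  ultimately have "phase c \<noteq> s mod 25" by simp
  moreover have "25 \<le> s" using Suc.prems(3) by simp
  ultimately obtain s0 where s0': "s0 < s" "s < s0 + 25" "s0 mod 25 = phase c"
    using previous_residue[OF _ phase_less] by blast
  then have s0: "s0 < s" "s < s0 + 25" "25 * g \<le> s0" using Suc.prems(3) by auto
  have act0: "active s0 (proute i ! g)" using s0'(3) by (simp add: active_def c_def)
  have in0: "\<kappa> \<le> transfer i s0 g" by (rule Suc.IH[OF g act0 s0(3)])
  have act: "active s c'" using Suc.prems by (simp add: c'_def)
  \<comment> \<open>\<open>s\<close> is the first slot from \<open>s0\<close> on in which
    \<open>c'\<close> is active, so the bits received in slot \<open>s0\<close> cannot leave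
    earlier.\<close>
  have idle: "\<not> active r c'" if "s0 \<le> r" "r < s" for r
  proof
    assume "active r c'"
    then have "r mod 25 = s mod 25" using s by (simp add: active_def)
    then have "25 dvd s - r" using that using mod_eq_dvd_iff_nat[of r s 25] by simp
    then show False using that s0 by (auto dest: dvd_imp_le)
  qed
  define v where "v = relay qp pri s c'"
  have c': "c' \<in> set (proute i)" using hop_less_length[OF Suc.prems(1)] by (simp add: c'_def)
  have v: "pcell v = proute i ! Suc g"
    unfolding v_def c'_def[symmetric] by (rule relay_in_cell(2)[OF route_cell_occupied[OF c']])
  have sender: "sender qp pri s (i, Suc g) = v" by (simp add: sender_def v_def c'_def)
  have receiver: "receiver qp pri s0 (i, g) = v"
    using Suc.prems(1) relay_eq[OF act, of s0 qp pri] s0 by (simp add: receiver_def v_def c'_def)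
  have quiet: "transfer i r (Suc g) = 0" if "s0 \<le> r" "r < s" for r
    using capacity_inactive[of r i "Suc g"] idle[OF that] held_nonneg[OF i]
    by (simp add: transfer_def sent_def c'_def min_def)
  have "\<kappa> \<le> held i r v" if "Suc s0 \<le> r" "r \<le> s" for r
    using that
  proof (induction r rule: dec_induct)
    case base
    have "held i (Suc s0) v = held i s0 v + transfer i s0 g
      - (if sender qp pri s0 (i, Suc g) = v then transfer i s0 (Suc g) else 0)"
      using held_step_relay[OF i Suc.prems(1) v, of s0] receiver by simp
    then show ?case using quiet[of s0] s0 held_nonneg[OF i, of s0 v] in0 by (simp del: held.simps)
  next
    case (step r)
    have "held i (Suc r) v = held i r v + (if receiver qp pri r (i, g) = v then transfer i r g else 0)
      - (if sender qp pri r (i, Suc g) = v then transfer i r (Suc g) else 0)"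
      by (rule held_step_relay[OF i Suc.prems(1) v])
    then show ?case using quiet[of r] step transfer_nonneg[OF i g, of r] by (simp del: held.simps)
  qed
  from this[of s] have "\<kappa> \<le> held i s v" using s0 by simp
  then show ?case
    using cap[OF Suc.prems(1,2)] sender by (simp add: transfer_def sent_def)
qed

lemma delivered_ge:
  assumes i: "i < pair_count pri" and \<kappa>: "0 \<le> \<kappa>"
    and cap: "\<And>s h. h < phops i \<Longrightarrow> active s (proute i ! h) \<Longrightarrow> \<kappa> \<le> capacity s (i, h)"
  shows "\<kappa> * (real t / 25 - 1 - real (phops i)) \<le> delivered i t"
proof -
  define g where "g = phops i - 1"
  have g: "g < phops i" using hops_pos[of i] by (simp add: g_def)
  \<comment> \<open>The active slot in frame \<open>j\<close> of the cell starting the last hop.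
    Frames before \<open>phops i\<close> are given up as start-up time, and so is the possibly
    incomplete last frame.\<close>
  define f where "f j = 25 * j + phase (proute i ! g)" for j
  have "\<kappa> * (real t / 25 - 1 - real (phops i)) \<le> \<kappa> * real (card {phops i..<t div 25})"
  proof (rule mult_left_mono[OF _ \<kappa>])
    have "real t / 25 - 1 \<le> real (t div 25)" by linarith
    then show "real t / 25 - 1 - real (phops i) \<le> real (card {phops i..<t div 25})" by simp
  qed
  also have "\<dots> = (\<Sum>j\<in>{phops i..<t div 25}. \<kappa>)" by simp
  also have "\<dots> \<le> (\<Sum>j\<in>{phops i..<t div 25}. transfer i (f j) g)"
  proof (rule sum_mono)
    fix j assume j: "j \<in> {phops i..<t div 25}"
    have "active (f j) (proute i ! g)" using phase_less by (simp add: active_def f_def)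
    then show "\<kappa> \<le> transfer i (f j) g"
      using j g by (intro transfer_ge[OF i g cap]) (auto simp: f_def)
  qed
  also have "\<dots> = (\<Sum>s\<in>f ` {phops i..<t div 25}. transfer i s g)"
    by (subst sum.reindex) (auto simp: inj_on_def f_def)
  also have "\<dots> \<le> (\<Sum>s<t. transfer i s g)"
  proof (rule sum_mono2)
    show "f ` {phops i..<t div 25} \<subseteq> {..<t}"
    proof
      fix s assume "s \<in> f ` {phops i..<t div 25}"
      then obtain j where "s = f j" "j < t div 25" by auto
      then show "s \<in> {..<t}" using phase_less[of "proute i ! g"] unfolding f_def by simp
    qed
  qed (auto intro: transfer_nonneg[OF i g])
  finally show ?thesis by (simp add: delivered_eq[OF i] g_def)
qed

lemma throughput_ge:
  assumes tasks: "\<And>c. fst c < qp \<Longrightarrow> snd c < qp \<Longrightarrow> real (length (tasks qp pri c)) \<le> m"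
  shows "ereal (rate_floor * tp / (25 * m)) \<le> throughput"
  unfolding throughput_def
proof (rule INF_greatest)
  fix i assume "i \<in> {..<pair_count pri}"
  then have i: "i < pair_count pri" by simp
  define \<kappa> where "\<kappa> = rate_floor * tp / m"
  have cap: "\<kappa> \<le> capacity s (i, h)" if h: "h < phops i" "active s (proute i ! h)" for s h
  proof -
    have "proute i ! h \<in> set (proute i)" using hop_less_length[OF h(1)] by simp
    then have "fst (proute i ! h) < qp" "snd (proute i ! h) < qp"
      using corner_path_less[of "proute i ! h" _ _ qp] pcell_less by (auto simp: route_eq_corner_path)
    then have "real (length (tasks qp pri (proute i ! h))) \<le> m" by (rule tasks)
    moreover have "0 < length (tasks qp pri (proute i ! h))"
      using task_mem[OF i h(1)] by (metis length_pos_if_in_set)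
    moreover from calculation have "0 < m" by linarith
    ultimately have "\<kappa> \<le> rate_floor * tp / real (length (tasks qp pri (proute i ! h)))"
      unfolding \<kappa>_def using rate_floor_pos slot_pos by (intro divide_left_mono) auto
    then show ?thesis using capacity_ge[OF i h] by linarith
  qed
  have "0 \<le> \<kappa>"
  proof -
    have "real (length (tasks qp pri (0, 0))) \<le> m" using cells_pos by (intro tasks) auto
    then have "0 \<le> m" by (rule order_trans[OF of_nat_0_le_iff])
    then show ?thesis using rate_floor_pos slot_pos by (simp add: \<kappa>_def)
  qed
  have lim: "(\<lambda>t. \<kappa> * (1 / 25 - (1 + real (phops i)) / real t)) \<longlonglongrightarrow> \<kappa> * (1 / 25 - 0)"
    by (intro tendsto_intros lim_const_over_n)
  have "ereal (\<kappa> / 25) = liminf (\<lambda>t. ereal (\<kappa> * (1 / 25 - (1 + real (phops i)) / real t)))"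
    using lim by (intro lim_imp_Liminf[symmetric]) auto
  also have "\<dots> \<le> liminf (\<lambda>t. ereal (delivered i t / real t))"
  proof (rule Liminf_mono, rule eventually_sequentiallyI[of 1])
    fix t :: nat assume t: "1 \<le> t"
    have "\<kappa> * (1 / 25 - (1 + real (phops i)) / real t) = \<kappa> * (real t / 25 - 1 - real (phops i)) / real t"
      using t by (simp add: field_simps)
    also have "\<dots> \<le> delivered i t / real t"
      by (intro divide_right_mono delivered_ge[OF i \<open>0 \<le> \<kappa>\<close> cap]) auto
    finally show "ereal (\<kappa> * (1 / 25 - (1 + real (phops i)) / real t)) \<le> ereal (delivered i t / real t)"
      by simp
  qed
  finally show "ereal (rate_floor * tp / (25 * m)) \<le> liminf (\<lambda>t. ereal (delivered i t / real t))"
    by (simp add: \<kappa>_def mult.commute)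
qed

end


section \<open>Averaging over the turns, and logarithmic sums\<close>

text \<open>Since the terms are nonnegative, \<open>J\<close> may be rounded up to whole rounds of
  length \<open>L\<close>. The extra round vanishes in the time average.\<close>

lemma sum_mod_le:
  fixes g :: "nat \<Rightarrow> real"
  assumes "0 < L" "\<And>l. 0 \<le> g l"
  shows "(\<Sum>j<J. g (j mod L)) \<le> (real (J div L) + 1) * (\<Sum>l<L. g l)"
proof -
  have period: "(\<Sum>j\<in>{m * L..<m * L + L}. g (j mod L)) = (\<Sum>l<L. g l)" for m
    by (subst sum.atLeastLessThan_shift_0) (simp add: lessThan_atLeast0)
  have "J < (J div L + 1) * L" using assms(1) dividend_less_div_times[of L J] by (simp add: algebra_simps)
  then have "(\<Sum>j<J. g (j mod L)) \<le> (\<Sum>j<(J div L + 1) * L. g (j mod L))"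
    using assms(2) by (intro sum_mono2) auto
  also have "\<dots> = (\<Sum>m<J div L + 1. \<Sum>j\<in>{m * L..<m * L + L}. g (j mod L))"
    by (rule sum.nat_group[symmetric])
  also have "\<dots> = (real (J div L) + 1) * (\<Sum>l<L. g l)"
    by (simp only: period) (simp add: algebra_simps)
  finally show ?thesis .
qed

text \<open>A discrete layer-cake bound: every threshold \<open>16 ^ (- j)\<close> that
  \<open>y\<close> does not exceed contributes \<open>ln 16\<close>. The hypothesis ensures that
  thresholds from \<open>J\<close> on are irrelevant.\<close>

lemma neg_ln_le_count:
  fixes y :: real
  assumes "(1 / 16) ^ J < y"
  shows "- ln y \<le> ln 16 * (\<Sum>j<J. if y \<le> (1 / 16) ^ j then 1 else 0)"
  using assms
proof (induction J)
  case 0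
  then show ?case by simp
next
  case (Suc J)
  show ?case
  proof (cases "y \<le> (1 / 16) ^ J")
    case False
    then show ?thesis using Suc by simp
  next
    case True
    have le: "y \<le> (1 / 16) ^ j" if "j < Suc J" for j
      by (rule order_trans[OF True power_decreasing]) (use that in auto)
    have "(\<Sum>j<Suc J. if y \<le> (1 / 16) ^ j then 1 else (0 :: real)) = (\<Sum>j<Suc J. 1)"
      by (intro sum.cong) (use le in auto)
    moreover have "ln ((1 / 16) ^ Suc J) < ln y"
      by (rule ln_less_cancel_iff[THEN iffD2, OF _ less_trans[OF _ Suc.prems] Suc.prems]) simp_all
    moreover have "ln ((1 / 16) ^ Suc J :: real) = - (real (Suc J) * ln 16)"
      by (subst ln_realpow) (simp_all add: ln_div)
    ultimately show ?thesis by (simp add: algebra_simps)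
  qed
qed

text \<open>Exchanging the sums replaces the thresholds per node by the nodes per threshold; their
  geometric decay sums to \<open>2 * C\<close>.\<close>

lemma sum_neg_ln_le:
  fixes y :: "'a \<Rightarrow> real"
  assumes "finite V" "\<And>v. v \<in> V \<Longrightarrow> 0 < y v"
    and "\<And>j. real (card {v \<in> V. y v \<le> (1 / 16) ^ j}) \<le> C * (1 / 2) ^ j"
  shows "(\<Sum>v\<in>V. - ln (y v)) \<le> 2 * C * ln 16"
proof -
  have "\<exists>J. \<forall>v\<in>V. (1 / 16) ^ J < y v"
    using assms(1,2)
  proof (induction V rule: finite_induct)
    case (insert a V)
    then obtain J where J: "\<forall>v\<in>V. (1 / 16) ^ J < y v" by auto
    obtain K where K: "(1 / 16) ^ K < y a"
      using real_arch_pow_inv[of "y a" "1 / 16"] insert.prems by auto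
    have "(1 / 16 :: real) ^ max J K \<le> (1 / 16) ^ J" "(1 / 16 :: real) ^ max J K \<le> (1 / 16) ^ K"
      by (auto intro: power_decreasing)
    then have "\<forall>v\<in>insert a V. (1 / 16) ^ max J K < y v"
      using J K by (metis insert_iff order_le_less_trans)
    then show ?case ..
  qed simp
  then obtain J where J: "\<And>v. v \<in> V \<Longrightarrow> (1 / 16) ^ J < y v" by auto
  have "(\<Sum>v\<in>V. - ln (y v)) \<le> (\<Sum>v\<in>V. ln 16 * (\<Sum>j<J. if y v \<le> (1 / 16) ^ j then 1 else 0))"
    by (intro sum_mono neg_ln_le_count J)
  also have "\<dots> = ln 16 * (\<Sum>j<J. \<Sum>v\<in>V. if y v \<le> (1 / 16) ^ j then 1 else 0)"
    unfolding sum_distrib_left[symmetric] by (subst sum.swap) (rule refl)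
  also have "\<dots> = ln 16 * (\<Sum>j<J. real (card {v \<in> V. y v \<le> (1 / 16) ^ j}))"
    using assms(1) by (simp add: sum.If_cases Int_def)
  also have "\<dots> \<le> ln 16 * (\<Sum>j<J. C * (1 / 2) ^ j)"
    by (intro mult_left_mono sum_mono assms) auto
  also have "\<dots> = ln 16 * (C * (\<Sum>j<J. (1 / 2) ^ j))" by (simp add: sum_distrib_left)
  also have "\<dots> \<le> ln 16 * (C * 2)"
  proof (intro mult_left_mono)
    have "(\<Sum>j<J. (1 / 2 :: real) ^ j) \<le> (\<Sum>j. (1 / 2) ^ j)"
      by (rule sum_le_suminf) (auto intro: summable_geometric)
    then show "(\<Sum>j<J. (1 / 2 :: real) ^ j) \<le> 2" by (simp add: suminf_geometric)
    show "0 \<le> C" using order_trans[OF of_nat_0_le_iff assms(3)[of 0]] by simp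
  qed auto
  finally show ?thesis by (simp add: mult_ac)
qed

section \<open>Upper bound on the throughput through a single hop\<close>

context regular_overlay
begin

definition border_gap :: "nat \<Rightarrow> real" where
  "border_gap v = real (fst (pcell v)) + 1 - real qp * fst (node_pos pri v)"

text \<open>The noise-limited rate at distance \<open>border_gap v\<close> in cell widths, the best
  that a hop into the next column on the right can reach.\<close>

definition border_rate :: "nat \<Rightarrow> real" where
  "border_rate v = ln (1 + P0 * border_gap v powr (- \<alpha>) / N0)"

lemma border_gap_pos:
  assumes "v < node_count pri" "Suc (fst (pcell v)) < qp"
  shows "0 < border_gap v" "border_gap v \<le> 1"
  using cell_index_upper[of qp "fst (node_pos pri v)"] pri_square[OF assms(1)] assms(2) in_cell_pri[OF assms(1)]
  by (auto simp: border_gap_def cell_of_def unit_square_def in_cell_def)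

lemma border_rate_nonneg: "0 \<le> border_rate v"
  unfolding border_rate_def using power_pos noise_pos by (intro ln_ge_zero) auto

text \<open>As \<open>y \<le> 1\<close>, the factor \<open>y powr (- \<alpha>)\<close> is at least 1
  and can be pulled out of the logarithm. What remains near the border is a logarithmic singularity,
  with bounded average.\<close>

lemma border_rate_le:
  assumes "0 < border_gap v" "border_gap v \<le> 1"
  shows "border_rate v \<le> ln (1 + P0 / N0) - \<alpha> * ln (border_gap v)"
proof -
  define y where "y = border_gap v"
  have y: "0 < y" "y \<le> 1" using assms by (auto simp: y_def)
  have "1 \<le> y powr (- \<alpha>)" using powr_mono2'[of "- \<alpha>" y 1] y exponent by simp
  then have "1 + P0 * y powr (- \<alpha>) / N0 \<le> (1 + P0 / N0) * y powr (- \<alpha>)"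
    by (simp add: distrib_right)
  then have "border_rate v \<le> ln ((1 + P0 / N0) * y powr (- \<alpha>))"
    unfolding border_rate_def y_def[symmetric] using power_pos noise_pos y
    by (intro ln_mono) (auto intro!: add_pos_nonneg)
  also have "\<dots> = ln (1 + P0 / N0) + ln (y powr (- \<alpha>))"
    using power_pos noise_pos y by (intro ln_mult_pos add_pos_pos) auto
  also have "\<dots> = ln (1 + P0 / N0) - \<alpha> * ln y" using y by (simp add: ln_powr)
  finally show ?thesis by (simp add: y_def)
qed

lemma rate_le_border_rate:
  assumes i: "i < pair_count pri" "0 < h" "h < phops i"
    and right: "fst (proute i ! target i h) = Suc (fst (proute i ! h))"
  shows "rate s u (sender qp pri s (i, h)) (receiver qp pri s (i, h)) \<le> border_rate (sender qp pri s (i, h))"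
proof -
  define v where "v = sender qp pri s (i, h)"
  define w where "w = receiver qp pri s (i, h)"
  have v: "v < node_count pri" "pcell v = proute i ! h"
    using sender_in_cell[OF i(1,3)] by (auto simp: v_def)
  have w: "w < node_count pri" "pcell w = proute i ! target i h"
    using receiver_in_cell[OF i(1,3)] by (auto simp: w_def)
  have "Suc (fst (pcell v)) < qp" using pcell_less(1)[of w] w v right by simp
  then have "0 < border_gap v" using border_gap_pos v(1) by blast
  moreover have "border_gap v \<le> real qp * dist (node_pos pri v) (node_pos pri w)"
  proof -
    have "real (fst (pcell v)) + 1 \<le> real qp * fst (node_pos pri w)"
      using in_cell_pri[OF w(1)] w(2) v(2) right by (simp add: in_cell_def)
    then have "border_gap v \<le> \<bar>real qp * fst (node_pos pri v) - real qp * fst (node_pos pri w)\<bar>"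
      by (simp add: border_gap_def)
    then show ?thesis
      using scaled_dist_coord(1)[OF cells_pos(1), of "node_pos pri v" "node_pos pri w"] by linarith
  qed
  ultimately have "rate s u v w \<le> border_rate v" unfolding border_rate_def by (rule rate_le)
  then show ?thesis by (simp add: v_def w_def)
qed

text \<open>The throughput is an infimum, so one pair suffices. With \<open>0 < h\<close> the sender
  is the relay, whose turn cycles through all nodes of \<open>c\<close>; hence the long-run rate is
  at most the mean of \<open>border_rate\<close> over the cell, although individual values are
  unbounded.\<close>

lemma throughput_le:
  assumes i: "i < pair_count pri" and h: "0 < h" "h < phops i" "proute i ! h = c"
    and right: "fst (proute i ! target i h) = Suc (fst c)"
  shows "throughput \<le> ereal (tp / (25 * real (length (tasks qp pri c)) * real (length (cell_nodes qp pri c))) *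
    (\<Sum>v\<in>set (cell_nodes qp pri c). border_rate v))"
proof -
  define vs where "vs = cell_nodes qp pri c"
  define L where "L = length vs"
  define N where "N = length (tasks qp pri c)"
  define S where "S = (\<Sum>v\<in>set vs. border_rate v)"
  define f where "f j = 25 * j + phase c" for j
  have "c \<in> set (proute i)" using h hop_less_length[OF h(2)] nth_mem by blast
  then have "vs \<noteq> []" unfolding vs_def by (rule route_cell_occupied)
  then have L: "0 < L" by (simp add: L_def)
  have "distinct vs" by (simp add: vs_def cell_nodes_def)
  then have S: "(\<Sum>l<L. border_rate (vs ! l)) = S"
    unfolding S_def L_def
    by (simp add: sum_list_distinct_conv_sum_set[symmetric] sum_list_sum_nth lessThan_atLeast0)
  have S0: "0 \<le> S" unfolding S_def by (intro sum_nonneg border_rate_nonneg)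
  have cap: "capacity (f j) (i, h) \<le> border_rate (vs ! (j mod L)) * tp / real N" for j
  proof -
    have "active (f j) (proute i ! h)" using h(3) phase_less by (simp add: active_def f_def)
    moreover have "sender qp pri (f j) (i, h) = vs ! (j mod L)"
      using h relay_turn[of qp pri j c] by (simp add: sender_def f_def vs_def L_def)
    ultimately show ?thesis
      using capacity_le[OF i h(2), of "f j" "border_rate (vs ! (j mod L))"]
        rate_le_border_rate[OF i h(1,2), of "f j"] right h(3) by (simp add: N_def)
  qed
  have bound: "delivered i t \<le> tp / real N * S * ((real t / 25 + 1) / real L + 1)" for t
  proof -
    \<comment> \<open>Frame number \<open>t div 25\<close> may be incomplete but can contain an
      active slot before \<open>t\<close>.\<close>
    define J where "J = Suc (t div 25)"
    have "delivered i t \<le> (\<Sum>s<t. capacity s (i, h))" by (rule delivered_le_sum_capacity[OF i h(2)])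
    also have "\<dots> = (\<Sum>s\<in>{s. s < t \<and> active s c}. capacity s (i, h))"
      using capacity_inactive[of _ i h] h(3) by (intro sum.mono_neutral_right) auto
    also have "\<dots> \<le> (\<Sum>s\<in>f ` {..<J}. capacity s (i, h))"
    proof (rule sum_mono2)
      show "{s. s < t \<and> active s c} \<subseteq> f ` {..<J}"
      proof
        fix s assume "s \<in> {s. s < t \<and> active s c}"
        then have s: "s < t" "s mod 25 = phase c" by (auto simp: active_def)
        have "s = f (s div 25)" unfolding f_def s(2)[symmetric] by simp
        moreover have "s div 25 < J" using s(1) by (simp add: J_def div_le_mono less_Suc_eq_le)
        ultimately show "s \<in> f ` {..<J}" by blast
      qed
    qed (auto intro: capacity_nonneg[OF i h(2)])
    also have "\<dots> = (\<Sum>j<J. capacity (f j) (i, h))"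
      by (subst sum.reindex) (auto simp: inj_on_def f_def)
    also have "\<dots> \<le> (\<Sum>j<J. border_rate (vs ! (j mod L)) * tp / real N)"
      by (intro sum_mono cap)
    also have "\<dots> = tp / real N * (\<Sum>j<J. border_rate (vs ! (j mod L)))"
      by (simp add: sum_distrib_left mult_ac)
    also have "\<dots> \<le> tp / real N * ((real (J div L) + 1) * S)"
      using sum_mod_le[OF L, of "\<lambda>l. border_rate (vs ! l)" J] slot_pos border_rate_nonneg
      unfolding S by (intro mult_left_mono) auto
    also have "\<dots> \<le> tp / real N * (((real t / 25 + 1) / real L + 1) * S)"
    proof (intro mult_left_mono mult_right_mono add_right_mono)
      have "real (J div L) \<le> real J / real L" by (rule of_nat_div_le_of_nat)
      also have "\<dots> \<le> (real t / 25 + 1) / real L"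
        using of_nat_div_le_of_nat[of t 25, where 'a = real] by (intro divide_right_mono) (auto simp: J_def)
      finally show "real (J div L) \<le> (real t / 25 + 1) / real L" .
    qed (use slot_pos S0 in auto)
    finally show ?thesis by (simp add: mult_ac)
  qed
  define b where "b t = tp / real N * S * (1 / (25 * real L) + (1 / real L + 1) / real t)" for t :: nat
  have lim: "b \<longlonglongrightarrow> tp / real N * S * (1 / (25 * real L) + 0)"
    unfolding b_def by (intro tendsto_intros lim_const_over_n)
  have "throughput \<le> liminf (\<lambda>t. ereal (delivered i t / real t))"
    unfolding throughput_def using i by (intro INF_lower) auto
  also have "\<dots> \<le> liminf (\<lambda>t. ereal (b t))"
  proof (rule Liminf_mono, rule eventually_sequentiallyI[of 1])
    fix t :: nat assume t: "1 \<le> t"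
    have "delivered i t / real t \<le> tp / real N * S * ((real t / 25 + 1) / real L + 1) / real t"
      using bound by (intro divide_right_mono) auto
    also have "\<dots> = b t"
    proof -
      have "((real t / 25 + 1) / real L + 1) / real t = 1 / (25 * real L) + (1 / real L + 1) / real t"
        using t L by (simp add: field_simps)
      then show ?thesis unfolding b_def by (metis times_divide_eq_right)
    qed
    finally show "ereal (delivered i t / real t) \<le> ereal (b t)" by simp
  qed
  also have "\<dots> = ereal (tp / real N * S * (1 / (25 * real L) + 0))"
    using lim by (intro lim_imp_Liminf) auto
  also have "tp / real N * S * (1 / (25 * real L) + 0) = tp / (25 * real N * real L) * S"
    by simp
  finally show ?thesis by (simp add: N_def L_def S_def vs_def)
qed

end

section \<open>Random networks are typical\<close>

lemma cell_index_ge_iff: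
  assumes "0 < q" "0 \<le> x" "i < q"
  shows "i \<le> cell_index q x \<longleftrightarrow> real i / real q \<le> x"
proof -
  have "0 \<le> real q * x" using assms by simp
  then have "i \<le> nat \<lfloor>real q * x\<rfloor> \<longleftrightarrow> real i \<le> real q * x" by linarith
  also have "\<dots> \<longleftrightarrow> real i / real q \<le> x" using assms by (simp add: field_simps)
  finally show ?thesis using assms by (auto simp: cell_index_def)
qed

definition band :: "nat \<Rightarrow> nat \<Rightarrow> real set" where
  "band q i = {x \<in> {0..1}. cell_index q x = i}"

lemma band_eq:
  assumes "i < q"
  shows "band q i = (if Suc i < q then {real i / real q..<real (Suc i) / real q} else {real i / real q..1})"
proof -
  have q: "0 < q" using assms by simp
  have up: "real (Suc i) / real q \<le> 1" using assms by (simp del: of_nat_Suc)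
  have lo: "0 \<le> real i / real q" by simp
  have iff: "x \<in> band q i \<longleftrightarrow> 0 \<le> x \<and> x \<le> 1 \<and> real i / real q \<le> x \<and> (Suc i < q \<longrightarrow> x < real (Suc i) / real q)"
    for x
  proof (cases "0 \<le> x")
    case True
    have "cell_index q x = i \<longleftrightarrow> i \<le> cell_index q x \<and> (Suc i < q \<longrightarrow> \<not> Suc i \<le> cell_index q x)"
      using cell_index_less[OF q, of x] by linarith
    then show ?thesis using True assms cell_index_ge_iff[OF q True, of i] cell_index_ge_iff[OF q True, of "Suc i"]
      by (auto simp: band_def)
  qed (simp add: band_def)
  have in_if: "(0 \<le> x \<and> x \<le> 1 \<and> l \<le> x \<and> (P \<longrightarrow> x < u)) \<longleftrightarrow> x \<in> (if P then {l..<u} else {l..1})"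
    if "0 \<le> l" "u \<le> 1" for l u x :: real and P
    using that by auto
  show ?thesis
  proof (rule set_eqI)
    fix x
    show "x \<in> band q i \<longleftrightarrow> x \<in> (if Suc i < q then {real i / real q..<real (Suc i) / real q} else {real i / real q..1})"
      unfolding iff by (rule in_if[OF lo up])
  qed
qed

lemma band_borel: "i < q \<Longrightarrow> band q i \<in> sets borel"
  by (simp add: band_eq)

lemma measure_band:
  assumes "i < q"
  shows "measure lborel (band q i) = 1 / real q"
proof (cases "Suc i < q")
  case True
  have "real i / real q \<le> real (Suc i) / real q" by (intro divide_right_mono) auto
  then show ?thesis using True by (simp add: band_eq assms diff_divide_distrib[symmetric])
next
  case False
  then have "real q = real i + 1" using assms by simp
  then show ?thesis using False assms by (simp add: band_eq field_simps)
qed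

lemma measure_lborel_Times:
  fixes A B :: "real set"
  assumes "A \<in> sets borel" "B \<in> sets borel"
  shows "A \<times> B \<in> sets borel" "measure lborel (A \<times> B) = measure lborel A * measure lborel B"
proof -
  have "A \<times> B \<in> sets (borel \<Otimes>\<^sub>M borel)" using assms by (rule pair_measureI)
  then show "A \<times> B \<in> sets borel" unfolding borel_prod .
  have "emeasure (lborel \<Otimes>\<^sub>M lborel) (A \<times> B) = emeasure lborel A * emeasure lborel B"
    using assms by (intro lborel.emeasure_pair_measure_Times) auto
  then show "measure lborel (A \<times> B) = measure lborel A * measure lborel B"
    by (simp add: lborel_prod measure_def enn2real_mult)
qed

text \<open>The sets of labels located in \<open>A\<close> and \<open>B\<close> are random, but once
  they and the node count are fixed the permutation is still uniform, and
  \<open>linked_pairs_chebyshev\<close> applies with a bound uniform over all cases. The cap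
  \<open>k1\<close> leaves finitely many cases; the exceptional set is constructed as a measurable
  event, as \<open>whp\<close> requires.\<close>

lemma random_network_linked_pairs:
  fixes A B :: "point set" and m0 :: real
  assumes net: "random_network M d \<N>"
    and A: "A \<in> sets borel" and B: "B \<in> sets borel" and "A \<inter> B = {}"
    and k0: "6 \<le> k0" and m0: "0 < m0"
  defines "S \<equiv> \<lambda>C \<omega>. {v. v < node_count (\<N> \<omega>) \<and> node_pos (\<N> \<omega>) v \<in> C}"
  defines "m \<equiv> \<lambda>k a b. real (k div 2) * real (card a) * real (card b) / (real k * (real k - 1))"
  obtains D where "D \<in> sets M" "measure M D \<le> 4 / m0 + 64 / real k0"
    "\<And>\<omega>. \<omega> \<in> space M - D \<Longrightarrow> k0 \<le> node_count (\<N> \<omega>) \<Longrightarrow> node_count (\<N> \<omega>) \<le> k1 \<Longrightarrow>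
      m0 \<le> m (node_count (\<N> \<omega>)) (S A \<omega>) (S B \<omega>) \<Longrightarrow>
      m0 / 2 \<le> real (card (linked_pairs (node_count (\<N> \<omega>)) (shuffle (\<N> \<omega>)) (S A \<omega>) (S B \<omega>)))"
proof -
  interpret prob_space M using net by (simp add: random_network_def poisson_process_def)
  have cnt [measurable]: "(\<lambda>\<omega>. node_count (\<N> \<omega>)) \<in> measurable M (count_space UNIV)"
    and pos [measurable]: "(\<lambda>\<omega>. node_pos (\<N> \<omega>)) \<in> measurable M (PiM UNIV (\<lambda>_. borel))"
    using net by (auto simp: random_network_def)
  define \<delta> where "\<delta> = 4 / m0 + 64 / real k0"
  \<comment> \<open>Of the positions only the sets \<open>a\<close> and \<open>b\<close> of labels
    falling into \<open>A\<close> and \<open>B\<close> matter; \<open>Q\<close> groups the positions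
    accordingly.\<close>
  define Q where "Q = (\<lambda>(k, a, b). {p :: nat \<Rightarrow> point. \<forall>v\<in>{..<k}. (p v \<in> A \<longleftrightarrow> v \<in> a) \<and> (p v \<in> B \<longleftrightarrow> v \<in> b)})"
  have Q: "Q z \<in> sets (PiM UNIV (\<lambda>_. borel))" for z
  proof -
    obtain k a b where [simp]: "z = (k, a, b)" by (metis prod_cases3)
    note A [measurable] B [measurable]
    have "{p \<in> space (PiM UNIV (\<lambda>_. borel)). \<forall>v\<in>{..<k}. (p v \<in> A \<longleftrightarrow> v \<in> a) \<and> (p v \<in> B \<longleftrightarrow> v \<in> b)}
        \<in> sets (PiM UNIV (\<lambda>_::nat. borel :: point measure))"
      by measurable
    then show ?thesis by (simp add: Q_def space_PiM)
  qed
  define I where "I = {(k, a, b). k0 \<le> k \<and> k \<le> k1 \<and> a \<subseteq> {..<k} \<and> b \<subseteq> {..<k} \<and> a \<inter> b = {} \<and> m0 \<le> m k a b}"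
  have finI: "finite I"
    by (rule finite_subset[of _ "{..k1} \<times> Pow {..<k1} \<times> Pow {..<k1}"])
      (auto simp: I_def dest: less_le_trans)
  define R where "R = (\<lambda>(k, a, b). {\<pi>. \<pi> permutes {..<k} \<and> real (card (linked_pairs k \<pi> a b)) \<le> m k a b / 2})"
  define E where "E z = {\<omega>\<in>space M. node_count (\<N> \<omega>) = fst z \<and> node_pos (\<N> \<omega>) \<in> Q z}" for z
  define F where "F z \<pi> = {\<omega>\<in>space M. node_count (\<N> \<omega>) = fst z \<and> node_pos (\<N> \<omega>) \<in> Q z \<and> shuffle (\<N> \<omega>) = \<pi>}" for z \<pi>
  have E: "E z \<in> events" for z
  proof -
    note Q[of z, measurable]
    show ?thesis unfolding E_def by measurable
  qed
  have F: "F z \<pi> \<in> events" "prob (F z \<pi>) = prob (E z) / fact (fst z)" if "\<pi> \<in> R z" for z \<pi>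
  proof -
    have "\<pi> permutes {..<fst z}" using that by (auto simp: R_def split: prod.splits)
    then show "F z \<pi> \<in> events" "prob (F z \<pi>) = prob (E z) / fact (fst z)"
      using net Q[of z] unfolding random_network_def F_def E_def by blast+
  qed
  have finR: "finite (R z)" for z
    by (rule finite_subset[OF _ finite_permutations[of "{..<fst z}"]]) (auto simp: R_def split: prod.splits)
  have cardR: "real (card (R z)) \<le> fact (fst z) * \<delta>" if "z \<in> I" for z
  proof -
    obtain k a b where z: "z = (k, a, b)" by (metis prod_cases3)
    with that have I: "k0 \<le> k" "a \<subseteq> {..<k}" "b \<subseteq> {..<k}" "a \<inter> b = {}" "m0 \<le> m k a b"
      by (auto simp: I_def)
    have "real (card (R z)) \<le> fact k * (4 / m k a b + 64 / real k)"
      unfolding R_def z prod.case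
      using I k0 m0 by (intro linked_pairs_chebyshev) (auto simp: m_def)
    also have "\<dots> \<le> fact k * \<delta>"
      unfolding \<delta>_def using I k0 m0 by (intro mult_left_mono add_mono divide_left_mono) auto
    finally show ?thesis by (simp add: z)
  qed
  define D where "D = (\<Union>z\<in>I. \<Union>\<pi>\<in>R z. F z \<pi>)"
  have D1: "(\<Union>\<pi>\<in>R z. F z \<pi>) \<in> events" for z
    using finR F by (intro sets.finite_UN) auto
  have "D \<in> events" unfolding D_def by (rule sets.finite_UN[OF finI D1])
  moreover have "prob D \<le> \<delta>"
  proof -
    have "prob D \<le> (\<Sum>z\<in>I. prob (\<Union>\<pi>\<in>R z. F z \<pi>))"
      unfolding D_def by (rule measure_UNION_le[OF finI D1])
    also have "\<dots> \<le> (\<Sum>z\<in>I. prob (E z) * \<delta>)"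
    proof (rule sum_mono)
      fix z assume z: "z \<in> I"
      have "prob (\<Union>\<pi>\<in>R z. F z \<pi>) \<le> (\<Sum>\<pi>\<in>R z. prob (F z \<pi>))"
        using finR F by (intro measure_UNION_le) auto
      also have "\<dots> = prob (E z) * (real (card (R z)) / fact (fst z))" by (simp add: F)
      also have "\<dots> \<le> prob (E z) * \<delta>"
        using cardR[OF z] by (intro mult_left_mono) (auto simp: field_simps)
      finally show "prob (\<Union>\<pi>\<in>R z. F z \<pi>) \<le> prob (E z) * \<delta>" .
    qed
    \<comment> \<open>A realisation determines its node count and both label sets, so the cases are
      disjoint and the conditional bounds average to \<delta>.\<close>
    also have "\<dots> = prob (\<Union>z\<in>I. E z) * \<delta>"
    proof -
      have "disjoint_family_on E I"
        unfolding disjoint_family_on_def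
      proof (intro ballI impI)
        fix z z' assume zz: "z \<in> I" "z' \<in> I" "z \<noteq> z'"
        show "E z \<inter> E z' = {}"
        proof (rule ccontr)
          assume "E z \<inter> E z' \<noteq> {}"
          then obtain \<omega> where w: "\<omega> \<in> E z" "\<omega> \<in> E z'" by blast
          obtain k a b k' a' b' where [simp]: "z = (k, a, b)" "z' = (k', a', b')" by (metis prod_cases3)
          have "k = k'" using w by (simp add: E_def)
          moreover have "a = {v. v < k \<and> node_pos (\<N> \<omega>) v \<in> A}" "b = {v. v < k \<and> node_pos (\<N> \<omega>) v \<in> B}"
            using w(1) zz(1) by (auto simp: E_def Q_def I_def)
          moreover have "a' = {v. v < k' \<and> node_pos (\<N> \<omega>) v \<in> A}" "b' = {v. v < k' \<and> node_pos (\<N> \<omega>) v \<in> B}"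
            using w(2) zz(2) by (auto simp: E_def Q_def I_def)
          ultimately show False using zz(3) by simp
        qed
      qed
      then have "prob (\<Union>z\<in>I. E z) = (\<Sum>z\<in>I. prob (E z))"
        using finI E by (intro finite_measure_finite_Union) auto
      then show ?thesis by (simp add: sum_distrib_right)
    qed
    also have "\<dots> \<le> \<delta>"
      using m0 prob_le_1[of "\<Union>z\<in>I. E z"] by (intro mult_left_le_one_le) (auto simp: \<delta>_def)
    finally show ?thesis .
  qed
  moreover have "m0 / 2 \<le> real (card (linked_pairs (node_count (\<N> \<omega>)) (shuffle (\<N> \<omega>)) (S A \<omega>) (S B \<omega>)))"
    if w: "\<omega> \<in> space M - D" and k: "k0 \<le> node_count (\<N> \<omega>)" "node_count (\<N> \<omega>) \<le> k1"
      and m: "m0 \<le> m (node_count (\<N> \<omega>)) (S A \<omega>) (S B \<omega>)" for \<omega>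
  proof (rule ccontr)
    define z where "z = (node_count (\<N> \<omega>), S A \<omega>, S B \<omega>)"
    assume "\<not> ?thesis"
    then have "real (card (linked_pairs (node_count (\<N> \<omega>)) (shuffle (\<N> \<omega>)) (S A \<omega>) (S B \<omega>)))
        \<le> m (node_count (\<N> \<omega>)) (S A \<omega>) (S B \<omega>) / 2" using m by linarith
    moreover have "shuffle (\<N> \<omega>) permutes {..<node_count (\<N> \<omega>)}"
      using net w by (auto simp: random_network_def)
    ultimately have "shuffle (\<N> \<omega>) \<in> R z" by (simp add: R_def z_def)
    moreover have "z \<in> I" using k m \<open>A \<inter> B = {}\<close> by (auto simp: I_def z_def S_def)
    moreover have "\<omega> \<in> F z (shuffle (\<N> \<omega>))" using w by (auto simp: F_def z_def Q_def S_def)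
    ultimately show False using w by (auto simp: D_def)
  qed
  ultimately show ?thesis using that by (simp add: \<delta>_def)
qed


text \<open>
  The strips at the right border of the middle cell shrink by the factor 16 while the admitted
  counts only shrink by 2, which makes the probabilities from Chebyshev's inequality summable.
\<close>

definition typical :: "nat \<Rightarrow> real \<Rightarrow> network \<Rightarrow> bool" where
  "typical q d \<nu> \<longleftrightarrow>
     (\<forall>c. fst c < q \<longrightarrow> snd c < q \<longrightarrow> cell_nodes q \<nu> c \<noteq> []) \<and>
     (\<forall>b<q. real (card {v. v < node_count \<nu> \<and> snd (cell_of q \<nu> v) = b}) \<le> 2 * d / real q) \<and>
     (\<forall>b<q. real (card {v. v < node_count \<nu> \<and> fst (cell_of q \<nu> v) = b}) \<le> 2 * d / real q) \<and>
     d / 2 \<le> real (node_count \<nu>) \<and> real (node_count \<nu>) \<le> 2 * d \<and>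
     d / (2 * (real q)\<^sup>2) \<le> real (length (cell_nodes q \<nu> (q div 2, 0))) \<and>
     (\<forall>j. real (card {v. v < node_count \<nu> \<and> cell_of q \<nu> v = (q div 2, 0) \<and>
         real (q div 2) + 1 - real q * fst (node_pos \<nu> v) \<le> (1 / 16) ^ j})
       \<le> 2 * (d / (real q)\<^sup>2) * (1 / 2) ^ j) \<and>
     d / (288 * real q) \<le> real (card (linked_pairs (node_count \<nu>) (shuffle \<nu>)
       {v. v < node_count \<nu> \<and> snd (cell_of q \<nu> v) = 0 \<and> fst (cell_of q \<nu> v) < q div 2}
       {v. v < node_count \<nu> \<and> q div 2 < fst (cell_of q \<nu> v)}))"

text \<open>The Poisson process counts points whereas the schedule counts labels; injectivity of the
  positions identifies the two.\<close>

lemma card_nodes_in: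
  assumes "inj_on (node_pos \<nu>) {..<node_count \<nu>}"
    and "\<And>v. v < node_count \<nu> \<Longrightarrow> P v \<longleftrightarrow> node_pos \<nu> v \<in> A"
  shows "card {v. v < node_count \<nu> \<and> P v} = card (node_set \<nu> \<inter> A)"
proof -
  have "card {v. v < node_count \<nu> \<and> P v} = card (node_pos \<nu> ` {v. v < node_count \<nu> \<and> P v})"
    by (rule card_image[symmetric]) (use assms(1) in \<open>auto simp: inj_on_def\<close>)
  also have "node_pos \<nu> ` {v. v < node_count \<nu> \<and> P v} = node_set \<nu> \<inter> A"
    using assms(2) by (auto simp: node_set_def)
  finally show ?thesis .
qed

lemma length_cell_nodes: "length (cell_nodes q \<nu> c) = card {v. v < node_count \<nu> \<and> cell_of q \<nu> v = c}"
proof -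
  have "set (cell_nodes q \<nu> c) = {v. v < node_count \<nu> \<and> cell_of q \<nu> v = c}"
    by (auto simp: cell_nodes_def)
  moreover have "distinct (cell_nodes q \<nu> c)" by (simp add: cell_nodes_def)
  ultimately show ?thesis by (metis distinct_card)
qed

text \<open>Each failure costs at most a constant times \<open>\<epsilon> = q ^ 2 / d\<close>. The
  hypothesis linking \<open>q\<close> and \<open>ln d\<close> is what keeps all cells
  occupied.\<close>

lemma random_network_typical:
  assumes net: "random_network M d \<N>" and q: "6 \<le> q" and d: "12 \<le> d" "(real q)\<^sup>2 * ln d \<le> d"
  obtains G where "G \<in> sets M" "1 - 725 * (real q)\<^sup>2 / d \<le> measure M G"
    "\<And>\<omega>. \<omega> \<in> G \<Longrightarrow> typical q d (\<N> \<omega>)"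
proof -
  have pp: "poisson_process M d (\<lambda>\<omega>. node_set (\<N> \<omega>))" using net by (simp add: random_network_def)
  interpret prob_space M using pp by (simp add: poisson_process_def)
  define X where "X A \<omega> = card (node_set (\<N> \<omega>) \<inter> A)" for A \<omega>
  define dev where "dev A t = {\<omega>\<in>space M. t \<le> \<bar>real (X A \<omega>) - d * measure lborel A\<bar>}" for A t
  have X_meas: "X A \<in> measurable M (count_space UNIV)" if "A \<in> sets borel" "A \<subseteq> unit_square" for A
    unfolding X_def using poisson_process_measurable[OF pp that] .
  have dev_events: "dev A t \<in> events" if "A \<in> sets borel" "A \<subseteq> unit_square" for A t
  proof -
    note X_meas[OF that, measurable]
    show ?thesis unfolding dev_def by measurable
  qed
  have dev_prob: "prob (dev A t) \<le> \<mu> / t\<^sup>2"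
    if "A \<in> sets borel" "A \<subseteq> unit_square" "0 < t" "d * measure lborel A = \<mu>" for A t \<mu>
    using poisson_process_chebyshev[OF pp that(1-3)] that(4) by (simp add: dev_def X_def)
  have X_close: "\<bar>real (X A \<omega>) - \<mu>\<bar> < t"
    if "\<omega> \<in> space M" "\<omega> \<notin> dev A t" "d * measure lborel A = \<mu>" for A \<omega> t \<mu>
    using that by (auto simp: dev_def)

  define Q where "Q = real q"
  define \<epsilon> where "\<epsilon> = Q\<^sup>2 / d"
  have Q: "6 \<le> Q" using q by (simp add: Q_def)
  have dpos: "0 < d" using d by simp
  have Q2: "1 \<le> Q\<^sup>2" "Q \<le> Q\<^sup>2" using Q by (auto simp: power2_eq_square intro: order_trans[of 1 "Q"])
  define cx where "cx = q div 2"
  have cx: "1 \<le> cx" "cx < q" "Suc cx < q" using q by (auto simp: cx_def)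
  \<comment> \<open>Having \<open>6 \<le> q\<close> leaves at least a third of the columns on either
    side of the middle one.\<close>
  have cxQ: "Q / 3 \<le> real cx" "Q / 3 \<le> Q - 1 - real cx"
    using q unfolding cx_def Q_def by linarith+
  define I01 where "I01 = {0..1 :: real}"
  have I01: "I01 \<in> sets borel" "measure lborel I01 = 1" by (auto simp: I01_def)
  have band_sub: "band q i \<subseteq> I01" for i by (auto simp: band_def I01_def)
  have sub: "S \<times> T \<subseteq> unit_square" if "S \<subseteq> I01" "T \<subseteq> I01" for S T
    using that by (auto simp: unit_square_def I01_def)
  note rect = measure_lborel_Times
  define L where "L = {0..<real cx / Q} \<times> band q 0"
  define R where "R = {real (Suc cx) / Q..1} \<times> I01"
  define strip where "strip j = {(real cx + 1 - (1 / 16) ^ j) / Q..<(real cx + 1) / Q} \<times> band q 0" for j :: nat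
  have q0: "0 < q" using q by simp
  have cell: "band q i \<times> band q j \<in> sets borel" "band q i \<times> band q j \<subseteq> unit_square"
    "d * measure lborel (band q i \<times> band q j) = d / Q\<^sup>2" if "i < q" "j < q" for i j
    using rect[OF band_borel[OF that(1)] band_borel[OF that(2)]] sub[OF band_sub band_sub] measure_band that
    by (auto simp: Q_def power2_eq_square)
  have row: "I01 \<times> band q b \<in> sets borel" "I01 \<times> band q b \<subseteq> unit_square"
    "d * measure lborel (I01 \<times> band q b) = d / Q" if "b < q" for b
    using rect[OF I01(1) band_borel[OF that]] sub[OF order_refl band_sub] measure_band[OF that] I01 
    by (auto simp: Q_def)
  have col: "band q b \<times> I01 \<in> sets borel" "band q b \<times> I01 \<subseteq> unit_square"
    "d * measure lborel (band q b \<times> I01) = d / Q" if "b < q" for b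
    using rect[OF band_borel[OF that] I01(1)] sub[OF band_sub order_refl] measure_band[OF that] I01 
    by (auto simp: Q_def)
  have tot: "unit_square \<in> sets borel" "d * measure lborel unit_square = d"
    using rect[OF I01(1) I01(1)] I01 by (auto simp: unit_square_def I01_def)
  have cxle: "real cx / Q \<le> 1" "real (Suc cx) / Q \<le> 1" "0 \<le> real cx / Q"
    using cx Q by (auto simp: Q_def)
  have L: "L \<in> sets borel" "L \<subseteq> unit_square" "d * measure lborel L = d * real cx / Q\<^sup>2"
  proof -
    have "{0..<real cx / Q} \<subseteq> I01" using cxle by (auto simp: I01_def)
    then show "L \<in> sets borel" "L \<subseteq> unit_square" "d * measure lborel L = d * real cx / Q\<^sup>2"
      unfolding L_def using rect[OF _ band_borel[OF q0], of "{0..<real cx / Q}"] measure_band[OF q0]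
        cxle sub[OF _ band_sub]
      by (auto simp: Q_def power2_eq_square)
  qed
  have R: "R \<in> sets borel" "R \<subseteq> unit_square" "d * measure lborel R = d * (Q - 1 - real cx) / Q"
  proof -
    have "measure lborel {real (Suc cx) / Q..1} = 1 - real (Suc cx) / Q" using cxle by simp
    moreover have "1 - real (Suc cx) / Q = (Q - 1 - real cx) / Q" using Q by (simp add: field_simps)
    moreover have "{real (Suc cx) / Q..1} \<subseteq> I01" using Q by (auto simp: I01_def intro: order_trans[rotated])
    ultimately show "R \<in> sets borel" "R \<subseteq> unit_square" "d * measure lborel R = d * (Q - 1 - real cx) / Q"
      unfolding R_def using rect[OF _ I01(1), of "{real (Suc cx) / Q..1}"] I01 sub[OF _ order_refl]
      by auto
  qed
  have strip: "strip j \<in> sets borel" "strip j \<subseteq> unit_square"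
    "d * measure lborel (strip j) = d / Q\<^sup>2 * (1 / 16) ^ j" for j
  proof -
    define e :: real where "e = (1 / 16) ^ j"
    have e: "0 < e" "e \<le> 1" by (auto simp: e_def power_le_one)
    have lo: "0 \<le> (real cx + 1 - e) / Q" "(real cx + 1 - e) / Q \<le> (real cx + 1) / Q"
      using e Q by (auto intro: divide_right_mono)
    then have "measure lborel {(real cx + 1 - e) / Q..<(real cx + 1) / Q} = e / Q"
      by (simp add: diff_divide_distrib)
    moreover have "{(real cx + 1 - e) / Q..<(real cx + 1) / Q} \<subseteq> I01"
    proof -
      have "(real cx + 1) / Q \<le> 1" using cxle(2) by (simp add: add.commute)
      then show ?thesis using lo(1) by (auto simp: I01_def)
    qed
    ultimately show "strip j \<in> sets borel" "strip j \<subseteq> unit_square"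
      "d * measure lborel (strip j) = d / Q\<^sup>2 * (1 / 16) ^ j"
      unfolding strip_def e_def[symmetric] using sub[OF _ band_sub] measure_band[OF q0]
        rect[OF _ band_borel[OF q0], of "{(real cx + 1 - e) / Q..<(real cx + 1) / Q}"]
      by (auto simp: Q_def power2_eq_square)
  qed
  have disj: "L \<inter> R = {}"
    using cx Q by (auto simp: L_def R_def field_simps)

  define k0 where "k0 = nat \<lceil>d / 2\<rceil>"
  define k1 where "k1 = nat \<lfloor>2 * d\<rfloor>"
  \<comment> \<open>A lower bound for the mean number of linked pairs: with
    \<open>d / (6 * Q)\<close> nodes in \<open>L\<close>, \<open>d / 6\<close> in \<open>R\<close>
    and at most \<open>2 * d\<close> nodes in all, the mean is at least
    \<open>(d / (6 * Q)) * (d / 6) / (4 * d)\<close>.\<close>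
  define m0 where "m0 = d / (144 * Q)"
  have k0: "6 \<le> k0" "d / 2 \<le> real k0" using d unfolding k0_def by linarith+
  have m0: "0 < m0" using dpos Q by (simp add: m0_def)
  define S where "S C \<omega> = {v. v < node_count (\<N> \<omega>) \<and> node_pos (\<N> \<omega>) v \<in> C}" for C \<omega>
  obtain D where D: "D \<in> events" "prob D \<le> 4 / m0 + 64 / real k0"
    and D_good: "\<And>\<omega>. \<omega> \<in> space M - D \<Longrightarrow> k0 \<le> node_count (\<N> \<omega>) \<Longrightarrow> node_count (\<N> \<omega>) \<le> k1 \<Longrightarrow>
      m0 \<le> real (node_count (\<N> \<omega>) div 2) * real (card (S L \<omega>)) * real (card (S R \<omega>)) /
        (real (node_count (\<N> \<omega>)) * (real (node_count (\<N> \<omega>)) - 1)) \<Longrightarrow>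
      m0 / 2 \<le> real (card (linked_pairs (node_count (\<N> \<omega>)) (shuffle (\<N> \<omega>)) (S L \<omega>) (S R \<omega>)))"
    unfolding S_def by (rule random_network_linked_pairs[OF net L(1) R(1) disj k0(1) m0, of k1]) blast

  define B1 where "B1 = (\<Union>c\<in>{..<q} \<times> {..<q}. {\<omega>\<in>space M. X (band q (fst c) \<times> band q (snd c)) \<omega> = 0})"
  define B2 where "B2 = (\<Union>b\<in>{..<q}. dev (I01 \<times> band q b) (d / Q))"
  define B3 where "B3 = (\<Union>b\<in>{..<q}. dev (band q b \<times> I01) (d / Q))"
  define B4 where "B4 = dev unit_square (d / 2)"
  define B5 where "B5 = dev (band q cx \<times> band q 0) (d / Q\<^sup>2 / 2)"
  \<comment> \<open>\<open>B6\<close> and \<open>B7\<close> guard the hypothesis of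
    \<open>D_good\<close>: enough nodes in \<open>L\<close> and \<open>R\<close> keep the mean above
    \<open>m0\<close>.\<close>
  define B6 where "B6 = dev L (d * real cx / Q\<^sup>2 / 2)"
  define B7 where "B7 = dev R (d * (Q - 1 - real cx) / Q / 2)"
  define B8 where "B8 = (\<Union>j. dev (strip j) (d / Q\<^sup>2 * (1 / 2) ^ j))"
  have E1: "{\<omega>\<in>space M. X (band q (fst c) \<times> band q (snd c)) \<omega> = 0} \<in> events"
    if "c \<in> {..<q} \<times> {..<q}" for c
  proof -
    have "fst c < q" "snd c < q" using that by auto
    note X_meas[OF cell(1,2)[OF this], measurable]
    show ?thesis by measurable
  qed
  have ev: "B1 \<in> events" "B2 \<in> events" "B3 \<in> events" "B4 \<in> events" "B5 \<in> events" "B6 \<in> events"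
    "B7 \<in> events" "B8 \<in> events"
  proof -
    show "B1 \<in> events" unfolding B1_def by (rule sets.finite_UN[OF _ E1]) auto
    show "B2 \<in> events" unfolding B2_def using dev_events[OF row(1,2)] by (intro sets.finite_UN) auto
    show "B3 \<in> events" unfolding B3_def using dev_events[OF col(1,2)] by (intro sets.finite_UN) auto
    show "B4 \<in> events" unfolding B4_def by (rule dev_events[OF tot(1) order_refl])
    show "B5 \<in> events" unfolding B5_def by (rule dev_events[OF cell(1,2)[OF cx(2) q0]])
    show "B6 \<in> events" unfolding B6_def by (rule dev_events[OF L(1,2)])
    show "B7 \<in> events" unfolding B7_def by (rule dev_events[OF R(1,2)])
    show "B8 \<in> events" unfolding B8_def using dev_events[OF strip(1,2)] by (intro sets.countable_UN) auto
  qed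
  have \<epsilon>: "1 / d \<le> \<epsilon>" "Q / d \<le> \<epsilon>" "0 < \<epsilon>"
    using Q2 dpos Q by (auto simp: \<epsilon>_def intro: divide_right_mono)
  have P1: "prob B1 \<le> \<epsilon>"
  proof -
    have "prob B1 \<le> (\<Sum>c\<in>{..<q} \<times> {..<q}. prob {\<omega>\<in>space M. X (band q (fst c) \<times> band q (snd c)) \<omega> = 0})"
      unfolding B1_def by (rule measure_UNION_le[OF _ E1]) auto
    also have "\<dots> \<le> (\<Sum>c\<in>{..<q} \<times> {..<q}. 1 / d)"
    proof (rule sum_mono)
      fix c assume "c \<in> {..<q} \<times> {..<q}"
      then have c: "fst c < q" "snd c < q" by auto
      \<comment> \<open>The void probability is at most \<open>1 / d\<close>; summed over the
        \<open>q ^ 2\<close> cells it gives \<epsilon>.\<close>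
      have "prob {\<omega>\<in>space M. X (band q (fst c) \<times> band q (snd c)) \<omega> = 0} = exp (- (d / Q\<^sup>2))"
        using pp cell[OF c] unfolding poisson_process_def X_def by fastforce
      also have "\<dots> \<le> exp (- ln d)"
      proof -
        have "0 < Q\<^sup>2" using Q by simp
        then have "ln d \<le> d / Q\<^sup>2" using d(2) by (simp add: Q_def pos_le_divide_eq mult.commute)
        then show ?thesis by simp
      qed
      also have "\<dots> = 1 / d" using dpos by (simp add: exp_minus divide_inverse)
      finally show "prob {\<omega>\<in>space M. X (band q (fst c) \<times> band q (snd c)) \<omega> = 0} \<le> 1 / d" .
    qed
    also have "\<dots> = \<epsilon>" by (simp add: \<epsilon>_def Q_def power2_eq_square)
    finally show ?thesis .
  qed
  have line: "d / Q / (d / Q)\<^sup>2 = Q / d" using dpos Q by (simp add: field_simps power2_eq_square)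
  have lines: "(\<Sum>b\<in>{..<q}. Q / d) = \<epsilon>" by (simp add: \<epsilon>_def Q_def power2_eq_square)
  have tQ: "0 < d / Q" using dpos Q by simp
  have P2: "prob B2 \<le> \<epsilon>"
  proof -
    have "prob B2 \<le> (\<Sum>b\<in>{..<q}. prob (dev (I01 \<times> band q b) (d / Q)))"
      unfolding B2_def using dev_events[OF row(1,2)] by (intro measure_UNION_le) auto
    also have "\<dots> \<le> (\<Sum>b\<in>{..<q}. Q / d)"
      using dev_prob[OF row(1,2) tQ row(3)] unfolding line by (intro sum_mono) auto
    finally show ?thesis unfolding lines .
  qed
  have P3: "prob B3 \<le> \<epsilon>"
  proof -
    have "prob B3 \<le> (\<Sum>b\<in>{..<q}. prob (dev (band q b \<times> I01) (d / Q)))"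
      unfolding B3_def using dev_events[OF col(1,2)] by (intro measure_UNION_le) auto
    also have "\<dots> \<le> (\<Sum>b\<in>{..<q}. Q / d)"
      using dev_prob[OF col(1,2) tQ col(3)] unfolding line by (intro sum_mono) auto
    finally show ?thesis unfolding lines .
  qed
  have half: "prob (dev A (\<mu> / 2)) \<le> 4 * (1 / \<mu>)"
    if "A \<in> sets borel" "A \<subseteq> unit_square" "d * measure lborel A = \<mu>" "0 < \<mu>" for A \<mu>
    using dev_prob[OF that(1,2) _ that(3), of "\<mu> / 2"] that(4) by (simp add: power2_eq_square)
  have P4: "prob B4 \<le> 4 * \<epsilon>"
    unfolding B4_def by (rule order_trans[OF half[OF tot(1) order_refl tot(2) dpos]]) (use \<epsilon> in simp)
  have P5: "prob B5 \<le> 4 * \<epsilon>"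
    unfolding B5_def by (rule order_trans[OF half[OF cell[OF cx(2) q0]]]) (use dpos Q in \<open>auto simp: \<epsilon>_def\<close>)
  have P6: "prob B6 \<le> 4 * \<epsilon>"
  proof -
    have "1 / (d * real cx / Q\<^sup>2) = \<epsilon> / real cx" by (simp add: \<epsilon>_def)
    also have "\<dots> \<le> \<epsilon> / 1" using cx \<epsilon>(3) by (intro divide_left_mono) auto
    finally have "1 / (d * real cx / Q\<^sup>2) \<le> \<epsilon>" by simp
    moreover have "0 < d * real cx / Q\<^sup>2" using dpos Q cx by simp
    ultimately show ?thesis unfolding B6_def using half[OF L] by fastforce
  qed
  have P7: "prob B7 \<le> 4 * \<epsilon>"
  proof -
    have y: "1 \<le> Q - 1 - real cx" using cxQ Q by linarith
    then have "Q / (d * (Q - 1 - real cx)) \<le> Q / d"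
      using dpos Q by (intro divide_left_mono) auto
    then have "1 / (d * (Q - 1 - real cx) / Q) \<le> \<epsilon>" using \<epsilon> by simp
    moreover have "0 < d * (Q - 1 - real cx) / Q" using dpos Q y by simp
    ultimately show ?thesis unfolding B7_def using half[OF R] by fastforce
  qed
  have P8: "prob B8 \<le> 2 * \<epsilon>"
  proof -
    \<comment> \<open>The mean shrinks by 16 and the squared deviation by 4, so their quotient still
      shrinks by 4.\<close>
    have each: "prob (dev (strip j) (d / Q\<^sup>2 * (1 / 2) ^ j)) \<le> \<epsilon> * (1 / 4) ^ j" for j
    proof -
      have "prob (dev (strip j) (d / Q\<^sup>2 * (1 / 2) ^ j))
          \<le> d / Q\<^sup>2 * (1 / 16) ^ j / (d / Q\<^sup>2 * (1 / 2) ^ j)\<^sup>2"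
        by (rule dev_prob[OF strip(1,2) _ strip(3)]) (use dpos Q in simp)
      also have "\<dots> = \<epsilon> * (1 / 4) ^ j"
      proof -
        have "(1 / 16 :: real) ^ j = (1 / 4) ^ j * (1 / 4) ^ j" "((1 / 2 :: real) ^ j)\<^sup>2 = (1 / 4) ^ j"
          by (simp_all add: power_mult_distrib[symmetric] power2_eq_square)
        then show ?thesis using dpos Q
          by (simp only: power_mult_distrib) (simp add: \<epsilon>_def power2_eq_square)
      qed
      finally show ?thesis .
    qed
    have summ: "(\<lambda>j. \<epsilon> * (1 / 4) ^ j) sums (\<epsilon> * (4 / 3))"
      using geometric_sums[of "1 / 4 :: real"] by (intro sums_mult) simp
    have summable: "summable (\<lambda>j. prob (dev (strip j) (d / Q\<^sup>2 * (1 / 2) ^ j)))"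
      by (rule summable_comparison_test'[OF sums_summable[OF summ], of 0]) (use each in auto)
    have "prob B8 \<le> (\<Sum>j. prob (dev (strip j) (d / Q\<^sup>2 * (1 / 2) ^ j)))"
      unfolding B8_def
      by (rule finite_measure_subadditive_countably[OF _ summable]) (use dev_events[OF strip(1,2)] in blast)
    also have "\<dots> \<le> \<epsilon> * (4 / 3)"
      using suminf_le[OF each summable sums_summable[OF summ]] sums_unique[OF summ] by simp
    also have "\<dots> \<le> 2 * \<epsilon>" using \<epsilon> by simp
    finally show ?thesis .
  qed
  \<comment> \<open>704 is 576 from \<open>4 / m0\<close> plus 128 from
    \<open>64 / k0\<close>.\<close>
  have P9: "prob D \<le> 704 * \<epsilon>"
  proof -
    have "64 / real k0 \<le> 64 / (d / 2)" using k0 dpos by (intro divide_left_mono) auto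
    moreover have "4 / m0 = 576 * (Q / d)" using Q dpos by (simp add: m0_def)
    ultimately show ?thesis using D(2) \<epsilon> by simp
  qed
  define Bad where "Bad = B1 \<union> B2 \<union> B3 \<union> B4 \<union> B5 \<union> B6 \<union> B7 \<union> B8 \<union> D"
  have Bad: "Bad \<in> events" unfolding Bad_def using ev D by auto
  have "prob Bad \<le> prob B1 + prob B2 + prob B3 + prob B4 + prob B5 + prob B6 + prob B7 + prob B8 + prob D"
    unfolding Bad_def using ev D(1)
    by (intro order_trans[OF measure_Un_le] add_right_mono order_refl sets.Un)
  \<comment> \<open>725 = 3 + 4 * 4 + 2 + 704.\<close>
  then have PBad: "prob Bad \<le> 725 * \<epsilon>" using P1 P2 P3 P4 P5 P6 P7 P8 P9 by linarith
  have PG: "1 - 725 * (real q)\<^sup>2 / d \<le> prob (space M - Bad)"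
    using prob_compl[OF Bad] PBad by (simp add: \<epsilon>_def Q_def)
  have "typical q d (\<N> \<omega>)" if w: "\<omega> \<in> space M - Bad" for \<omega>
  proof -
    define \<nu> where "\<nu> = \<N> \<omega>"
    define x where "x v = fst (node_pos \<nu> v)" for v
    define y where "y v = snd (node_pos \<nu> v)" for v
    have sp: "\<omega> \<in> space M" using w by simp
    have inj: "inj_on (node_pos \<nu>) {..<node_count \<nu>}"
      using net sp by (auto simp: random_network_def \<nu>_def)
    have "node_set \<nu> \<subseteq> unit_square" using pp sp by (auto simp: poisson_process_def \<nu>_def)
    then have pos: "node_pos \<nu> v \<in> unit_square" if "v < node_count \<nu>" for v
      using that by (auto simp: node_set_def)
    have xy: "x v \<in> I01" "y v \<in> I01" "0 \<le> x v" if "v < node_count \<nu>" for v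
      using pos[OF that] by (auto simp: unit_square_def I01_def x_def y_def)
    have cellv: "cell_of q \<nu> v = (cell_index q (x v), cell_index q (y v))" for v
      by (simp add: cell_of_def x_def y_def)
    have mem: "node_pos \<nu> v \<in> A \<times> B \<longleftrightarrow> x v \<in> A \<and> y v \<in> B" for A B v
      by (cases "node_pos \<nu> v") (simp add: x_def y_def)
    have band: "x v \<in> band q i \<longleftrightarrow> cell_index q (x v) = i" "y v \<in> band q i \<longleftrightarrow> cell_index q (y v) = i"
      if "v < node_count \<nu>" for v i
      using xy[OF that] by (auto simp: band_def I01_def)
    have count: "card {v. v < node_count \<nu> \<and> P v} = X A \<omega>"
      if "\<And>v. v < node_count \<nu> \<Longrightarrow> P v \<longleftrightarrow> node_pos \<nu> v \<in> A" for P A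
      unfolding X_def \<nu>_def[symmetric] using inj that by (rule card_nodes_in)
    have c_cell: "card {v. v < node_count \<nu> \<and> cell_of q \<nu> v = (i, j)} = X (band q i \<times> band q j) \<omega>" for i j
      by (rule count) (simp only: mem band, simp add: cellv)
    have c_row: "card {v. v < node_count \<nu> \<and> snd (cell_of q \<nu> v) = b} = X (I01 \<times> band q b) \<omega>" for b
      by (rule count) (simp only: mem band, simp add: cellv xy)
    have c_col: "card {v. v < node_count \<nu> \<and> fst (cell_of q \<nu> v) = b} = X (band q b \<times> I01) \<omega>" for b
      by (rule count) (simp only: mem band, simp add: cellv xy)
    have "card {v. v < node_count \<nu> \<and> True} = X unit_square \<omega>"
      by (rule count) (simp add: pos)
    then have c_tot: "node_count \<nu> = X unit_square \<omega>" by simp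
    have ge: "i \<le> cell_index q (x v) \<longleftrightarrow> real i / Q \<le> x v" if "v < node_count \<nu>" "i < q" for i v
      unfolding Q_def by (rule cell_index_ge_iff[OF q0 xy(3)[OF that(1)] that(2)])
    have L_iff: "snd (cell_of q \<nu> v) = 0 \<and> fst (cell_of q \<nu> v) < cx \<longleftrightarrow> node_pos \<nu> v \<in> L"
      if "v < node_count \<nu>" for v
      unfolding L_def mem band(2)[OF that] using ge[OF that cx(2)] xy(3)[OF that]
      by (auto simp: cellv not_le[symmetric])
    have R_iff: "cx < fst (cell_of q \<nu> v) \<longleftrightarrow> node_pos \<nu> v \<in> R" if "v < node_count \<nu>" for v
      unfolding R_def mem using ge[OF that cx(3)] xy(1,2)[OF that]
      by (auto simp: cellv Suc_le_eq I01_def simp del: of_nat_Suc)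
    have strip_iff: "cell_of q \<nu> v = (cx, 0) \<and> real cx + 1 - Q * x v \<le> (1 / 16) ^ j \<longleftrightarrow> node_pos \<nu> v \<in> strip j"
      if v: "v < node_count \<nu>" for v j
    proof -
      define e :: real where "e = (1 / 16) ^ j"
      have e: "e \<le> 1" by (simp add: e_def power_le_one)
      have "cell_index q (x v) = cx \<longleftrightarrow> real cx / Q \<le> x v \<and> x v < real (Suc cx) / Q"
        using ge[OF v cx(2)] ge[OF v cx(3)] by linarith
      moreover have "real cx / Q \<le> x v \<longleftrightarrow> real cx \<le> Q * x v" "x v < real (Suc cx) / Q \<longleftrightarrow> Q * x v < real cx + 1"
        "(real cx + 1 - e) / Q \<le> x v \<longleftrightarrow> real cx + 1 - e \<le> Q * x v" "x v < (real cx + 1) / Q \<longleftrightarrow> Q * x v < real cx + 1"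
        using Q by (auto simp: field_simps)
      ultimately show ?thesis
        unfolding strip_def mem band(2)[OF v] e_def[symmetric] cellv using e by auto
    qed
    have notin: "\<omega> \<notin> B1" "\<omega> \<notin> B2" "\<omega> \<notin> B3" "\<omega> \<notin> B4" "\<omega> \<notin> B5" "\<omega> \<notin> B6" "\<omega> \<notin> B7" "\<omega> \<notin> B8" "\<omega> \<notin> D"
      using w by (auto simp: Bad_def)
    have n1: "cell_nodes q \<nu> c \<noteq> []" if "fst c < q" "snd c < q" for c
    proof -
      have "X (band q (fst c) \<times> band q (snd c)) \<omega> \<noteq> 0"
        using notin(1) that sp by (auto simp: B1_def)
      then have "length (cell_nodes q \<nu> c) \<noteq> 0"
        unfolding length_cell_nodes using c_cell[of "fst c" "snd c"] by simp
      then show ?thesis by simp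
    qed
    have n2: "real (card {v. v < node_count \<nu> \<and> snd (cell_of q \<nu> v) = b}) \<le> 2 * d / real q" if "b < q" for b
      using X_close[OF sp _ row(3)[OF that], of "d / Q"] notin(2) that
      unfolding c_row by (auto simp: B2_def Q_def)
    have n3: "real (card {v. v < node_count \<nu> \<and> fst (cell_of q \<nu> v) = b}) \<le> 2 * d / real q" if "b < q" for b
      using X_close[OF sp _ col(3)[OF that], of "d / Q"] notin(3) that
      unfolding c_col by (auto simp: B3_def Q_def)
    have n4: "d / 2 \<le> real (node_count \<nu>)" "real (node_count \<nu>) \<le> 2 * d"
      using X_close[OF sp _ tot(2), of "d / 2"] notin(4) dpos unfolding c_tot B4_def by linarith+
    have lower: "\<mu> / 2 \<le> z" if "\<bar>z - \<mu>\<bar> < \<mu> / 2" for z \<mu> :: real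
      using that by linarith
    have n5: "d / (2 * (real q)\<^sup>2) \<le> real (length (cell_nodes q \<nu> (q div 2, 0)))"
    proof -
      have "\<bar>real (X (band q cx \<times> band q 0) \<omega>) - d / Q\<^sup>2\<bar> < d / Q\<^sup>2 / 2"
        using notin(5) unfolding B5_def by (intro X_close[OF sp _ cell(3)[OF cx(2) q0]])
      then have "d / Q\<^sup>2 / 2 \<le> real (X (band q cx \<times> band q 0) \<omega>)" by (rule lower)
      then show ?thesis unfolding length_cell_nodes cx_def[symmetric] c_cell by (simp add: Q_def)
    qed
    have n6: "d * real cx / Q\<^sup>2 / 2 \<le> real (card (S L \<omega>))"
    proof -
      have "\<bar>real (X L \<omega>) - d * real cx / Q\<^sup>2\<bar> < d * real cx / Q\<^sup>2 / 2"
        using notin(6) unfolding B6_def by (intro X_close[OF sp _ L(3)])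
      then have "d * real cx / Q\<^sup>2 / 2 \<le> real (X L \<omega>)" by (rule lower)
      moreover have "card (S L \<omega>) = X L \<omega>" unfolding S_def \<nu>_def[symmetric] by (rule count) simp
      ultimately show ?thesis by (simp only:)
    qed
    have n7: "d * (Q - 1 - real cx) / Q / 2 \<le> real (card (S R \<omega>))"
    proof -
      have "\<bar>real (X R \<omega>) - d * (Q - 1 - real cx) / Q\<bar> < d * (Q - 1 - real cx) / Q / 2"
        using notin(7) unfolding B7_def by (intro X_close[OF sp _ R(3)])
      then have "d * (Q - 1 - real cx) / Q / 2 \<le> real (X R \<omega>)" by (rule lower)
      moreover have "card (S R \<omega>) = X R \<omega>" unfolding S_def \<nu>_def[symmetric] by (rule count) simp
      ultimately show ?thesis by (simp only:)
    qed
    have n8: "real (card {v. v < node_count \<nu> \<and> cell_of q \<nu> v = (q div 2, 0) \<and>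
         real (q div 2) + 1 - real q * fst (node_pos \<nu> v) \<le> (1 / 16) ^ j})
       \<le> 2 * (d / (real q)\<^sup>2) * (1 / 2) ^ j" for j
    proof -
      have c: "card {v. v < node_count \<nu> \<and> cell_of q \<nu> v = (q div 2, 0) \<and>
          real (q div 2) + 1 - real q * fst (node_pos \<nu> v) \<le> (1 / 16) ^ j} = X (strip j) \<omega>"
        by (rule count) (use strip_iff in \<open>simp add: x_def cx_def Q_def\<close>)
      have "\<bar>real (X (strip j) \<omega>) - d / Q\<^sup>2 * (1 / 16) ^ j\<bar> < d / Q\<^sup>2 * (1 / 2) ^ j"
        using notin(8) unfolding B8_def by (intro X_close[OF sp _ strip(3)]) auto
      moreover have "d / Q\<^sup>2 * (1 / 16) ^ j \<le> d / Q\<^sup>2 * (1 / 2) ^ j"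
        using dpos by (intro mult_left_mono power_mono) auto
      ultimately have "real (X (strip j) \<omega>) \<le> 2 * (d / Q\<^sup>2 * (1 / 2) ^ j)" by linarith
      then show ?thesis unfolding c by (simp add: Q_def)
    qed
    have n9: "d / (288 * real q) \<le> real (card (linked_pairs (node_count \<nu>) (shuffle \<nu>) (S L \<omega>) (S R \<omega>)))"
    proof -
      define N where "N = real (node_count \<nu>)"
      have N: "6 \<le> N" "d / 2 \<le> N" "N \<le> 2 * d" using n4 d unfolding N_def by linarith+
      have a: "d / (6 * Q) \<le> real (card (S L \<omega>))"
      proof -
        have "d / (6 * Q) = d * (Q / 3) / Q\<^sup>2 / 2" using Q by (simp add: power2_eq_square)
        also have "\<dots> \<le> d * real cx / Q\<^sup>2 / 2"
          using cxQ dpos by (intro divide_right_mono mult_left_mono) auto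
        finally show ?thesis using n6 by linarith
      qed
      have b: "d / 6 \<le> real (card (S R \<omega>))"
      proof -
        have "d / 6 = d * (Q / 3) / Q / 2" using Q by simp
        also have "\<dots> \<le> d * (Q - 1 - real cx) / Q / 2"
          using cxQ dpos Q by (intro divide_right_mono mult_left_mono) auto
        finally show ?thesis using n7 by linarith
      qed
      \<comment> \<open>With an odd node count one node is unpaired. The resulting
        \<open>N - 1\<close> cancels against the denominator \<open>N * (N - 1)\<close> of the
        mean.\<close>
      define p where "p = node_count \<nu> div 2"
      have "node_count \<nu> \<le> 2 * p + 1" unfolding p_def by presburger
      then have "real (node_count \<nu>) \<le> real (2 * p + 1)" by (rule of_nat_mono)
      then have "(N - 1) / 2 \<le> real p" unfolding N_def by simp
      then have p: "(N - 1) / 2 \<le> real (node_count \<nu> div 2)" by (simp only: p_def)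
      have "m0 = (d / (6 * Q)) * (d / 6) / (2 * (2 * d))"
        using dpos Q by (simp add: m0_def)
      also have "\<dots> \<le> (d / (6 * Q)) * (d / 6) / (2 * N)"
        using N dpos Q by (intro divide_left_mono) auto
      also have "\<dots> = (N - 1) / 2 * (d / (6 * Q)) * (d / 6) / (N * (N - 1))"
        using N by simp
      also have "\<dots> \<le> real (node_count \<nu> div 2) * real (card (S L \<omega>)) * real (card (S R \<omega>)) / (N * (N - 1))"
        using p a b N dpos Q by (intro divide_right_mono mult_mono) auto
      finally have "m0 \<le> real (node_count \<nu> div 2) * real (card (S L \<omega>)) * real (card (S R \<omega>)) / (N * (N - 1))" .
      moreover have "k0 \<le> node_count \<nu>" "node_count \<nu> \<le> k1"
        using n4 unfolding k0_def k1_def by linarith+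
      ultimately have "m0 / 2 \<le> real (card (linked_pairs (node_count \<nu>) (shuffle \<nu>) (S L \<omega>) (S R \<omega>)))"
        using D_good[of \<omega>] notin(9) sp unfolding \<nu>_def N_def by blast
      then show ?thesis by (simp add: m0_def Q_def)
    qed
    have SL: "S L \<omega> = {v. v < node_count \<nu> \<and> snd (cell_of q \<nu> v) = 0 \<and> fst (cell_of q \<nu> v) < q div 2}"
      unfolding S_def \<nu>_def[symmetric] using L_iff by (auto simp: cx_def)
    have SR: "S R \<omega> = {v. v < node_count \<nu> \<and> q div 2 < fst (cell_of q \<nu> v)}"
      unfolding S_def \<nu>_def[symmetric] using R_iff by (auto simp: cx_def)
    have "typical q d \<nu>"
      unfolding typical_def using n1 n2 n3 n4 n5 n8 n9[unfolded SL SR] by blast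
    then show ?thesis by (simp add: \<nu>_def)
  qed
  then show ?thesis using that[of "space M - Bad"] Bad PG by auto
qed

section \<open>Throughput of a typical network\<close>

context regular_overlay
begin

text \<open>A row and a column with at most \<open>2 * d / q\<close> nodes each yield at most
  \<open>4 * d / q\<close> tasks; 100 is this 4 times the 25 slots of a frame.\<close>

lemma typical_throughput_ge:
  assumes "typical qp d pri"
  shows "ereal (rate_floor * tp / 100 * (real qp / d)) \<le> throughput"
proof -
  have "real (length (tasks qp pri c)) \<le> 4 * d / real qp" if "fst c < qp" "snd c < qp" for c
  proof -
    have "real (length (tasks qp pri c)) \<le>
        real (card {v. v < node_count pri \<and> snd (pcell v) = snd c} + card {v. v < node_count pri \<and> fst (pcell v) = fst c})"
      by (intro of_nat_mono length_tasks_le pri_shuffle)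
    also have "\<dots> \<le> 2 * d / real qp + 2 * d / real qp"
      unfolding of_nat_add using assms that by (intro add_mono) (auto simp: typical_def)
    finally show ?thesis by simp
  qed
  from throughput_ge[OF this] show ?thesis by simp
qed

text \<open>The number of linked pairs enters through the number of tasks sharing the slot of the
  middle cell; a single linked pair then serves as the witness whose delivery is bounded.\<close>

lemma typical_throughput_le:
  assumes typical: "typical qp d pri" and d: "0 < d" and q: "6 \<le> qp"
  shows "throughput \<le> ereal (12 * tp * (ln (1 + P0 / N0) + 8 * \<alpha> * ln 16) * (real qp / d))"
proof -
  define cx where "cx = qp div 2"
  define c :: cell where "c = (cx, 0)"
  define LP where "LP = linked_pairs (node_count pri) (shuffle pri)
       {v. v < node_count pri \<and> snd (pcell v) = 0 \<and> fst (pcell v) < cx}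
       {v. v < node_count pri \<and> cx < fst (pcell v)}"
  define V where "V = {v. v < node_count pri \<and> pcell v = c}"
  define L where "L = real (length (cell_nodes qp pri c))"
  define N where "N = real (length (tasks qp pri c))"
  have LP_ge: "d / (288 * real qp) \<le> real (card LP)"
    and L_ge: "d / (2 * (real qp)\<^sup>2) \<le> L"
    and strips: "\<And>j. real (card {v. v < node_count pri \<and> pcell v = c \<and>
         real cx + 1 - real qp * fst (node_pos pri v) \<le> (1 / 16) ^ j}) \<le> 2 * (d / (real qp)\<^sup>2) * (1 / 2) ^ j"
    using typical unfolding typical_def LP_def L_def c_def cx_def by blast+
  have pos: "0 < d / (288 * real qp)" "0 < d / (2 * (real qp)\<^sup>2)" using d cells_pos by auto
  have cx: "Suc cx < qp" using q by (simp add: cx_def)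
  have hop: "\<exists>h. 0 < h \<and> h < phops i \<and> proute i ! h = c \<and> proute i ! target i h = (Suc cx, 0)"
    and LP_less: "i < pair_count pri" if "i \<in> LP" for i
  proof -
    have i: "i < pair_count pri" "snd (pcell (src pri i)) = 0" "fst (pcell (src pri i)) < cx"
      "cx < fst (pcell (dst pri i))"
      using that by (auto simp: LP_def linked_pairs_def pair_count_def src_def dst_def)
    define a where "a = fst (pcell (src pri i))"
    define a' where "a' = fst (pcell (dst pri i))"
    have a: "a < cx" "cx < a'" using i by (auto simp: a_def a'_def)
    have nth: "proute i ! h = (a + h, 0)" if "h \<le> a' - a" for h
      using nth_corner_path_horizontal[of h "pcell (src pri i)" "pcell (dst pri i)"] that a i(2)
      unfolding route_eq_corner_path a_def[symmetric] a'_def[symmetric] by (simp add: nat_diff_def)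
    have len: "a' - a < length (proute i)"
      unfolding route_eq_corner_path length_corner_path a_def[symmetric] a'_def[symmetric]
      using a by (simp add: nat_diff_def)
    \<comment> \<open>The source lies strictly left of the middle column, so \<open>h\<close> is
      positive and this hop is sent by a relay.\<close>
    define h where "h = cx - a"
    have h: "0 < h" "h < a' - a" "a + h = cx" using a by (auto simp: h_def)
    moreover have "h < phops i" using len h hop_count_cases[of i] by auto
    moreover have "target i h = Suc h" using len h by (simp add: target_def)
    ultimately show "\<exists>h. 0 < h \<and> h < phops i \<and> proute i ! h = c \<and> proute i ! target i h = (Suc cx, 0)"
      using nth[of h] nth[of "Suc h"] by (intro exI[of _ h]) (auto simp: c_def)
    show "i < pair_count pri" by (rule i(1))
  qed
  have "LP \<noteq> {}" using LP_ge pos by auto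
  then obtain i where i: "i \<in> LP" by blast
  from hop[OF i] obtain h where h: "0 < h" "h < phops i" "proute i ! h = c" "proute i ! target i h = (Suc cx, 0)"
    by blast
  have "throughput \<le> ereal (tp / (25 * N * L) * (\<Sum>v\<in>set (cell_nodes qp pri c). border_rate v))"
    unfolding N_def L_def using h by (intro throughput_le[OF LP_less[OF i] h(1,2)]) (auto simp: c_def)
  also have "\<dots> \<le> ereal (tp / (25 * N * L) * (L * (ln (1 + P0 / N0) + 8 * \<alpha> * ln 16)))"
  proof -
    have setV: "set (cell_nodes qp pri c) = V" by (auto simp: cell_nodes_def V_def)
    have cardV: "real (card V) = L" by (simp add: L_def length_cell_nodes V_def)
    have gap: "0 < border_gap v" "border_gap v \<le> 1" if "v \<in> V" for v
      using that cx border_gap_pos[of v] by (auto simp: V_def c_def)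
    have "(\<Sum>v\<in>V. - ln (border_gap v)) \<le> 2 * (2 * (d / (real qp)\<^sup>2)) * ln 16"
    proof (rule sum_neg_ln_le)
      fix j
      have "{v \<in> V. border_gap v \<le> (1 / 16) ^ j} = {v. v < node_count pri \<and> pcell v = c \<and>
         real cx + 1 - real qp * fst (node_pos pri v) \<le> (1 / 16) ^ j}"
        by (auto simp: V_def border_gap_def c_def)
      then show "real (card {v \<in> V. border_gap v \<le> (1 / 16) ^ j}) \<le> 2 * (d / (real qp)\<^sup>2) * (1 / 2) ^ j"
        using strips[of j] by simp
    qed (use gap in \<open>auto simp: V_def\<close>)
    \<comment> \<open>The lower bound on the occupancy \<open>L\<close> turns
      \<open>d / q ^ 2\<close> into at most \<open>2 * L\<close>: the sum becomes a bounded average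
      per node.\<close>
    also have "\<dots> \<le> 8 * L * ln 16" using L_ge by (intro mult_right_mono) auto
    finally have logs: "(\<Sum>v\<in>V. - ln (border_gap v)) \<le> 8 * L * ln 16" .
    have "(\<Sum>v\<in>V. border_rate v) \<le> (\<Sum>v\<in>V. ln (1 + P0 / N0) + \<alpha> * (- ln (border_gap v)))"
      using border_rate_le[OF gap] by (intro sum_mono) simp
    also have "\<dots> = L * ln (1 + P0 / N0) + \<alpha> * (\<Sum>v\<in>V. - ln (border_gap v))"
      by (simp only: sum.distrib sum_distrib_left) (simp add: cardV)
    also have "\<dots> \<le> L * ln (1 + P0 / N0) + \<alpha> * (8 * L * ln 16)"
      using logs exponent by (intro add_left_mono mult_left_mono) auto
    also have "\<dots> = L * (ln (1 + P0 / N0) + 8 * \<alpha> * ln 16)" by (simp add: algebra_simps)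
    finally have rates: "(\<Sum>v\<in>V. border_rate v) \<le> L * (ln (1 + P0 / N0) + 8 * \<alpha> * ln 16)" .
    show ?thesis
      unfolding setV ereal_less_eq
      by (rule mult_left_mono[OF rates]) (use slot_pos in \<open>simp add: N_def L_def\<close>)
  qed
  also have "tp / (25 * N * L) * (L * (ln (1 + P0 / N0) + 8 * \<alpha> * ln 16)) =
      tp * (ln (1 + P0 / N0) + 8 * \<alpha> * ln 16) / 25 * (1 / N)"
    using L_ge pos by simp
  also have "ereal \<dots> \<le> ereal (tp * (ln (1 + P0 / N0) + 8 * \<alpha> * ln 16) / 25 * (288 * real qp / d))"
  proof -
    have "card LP \<le> card (fst ` set (tasks qp pri c))"
    proof (rule card_mono)
      show "LP \<subseteq> fst ` set (tasks qp pri c)"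
        using hop LP_less by (force simp: set_tasks)
    qed simp
    also have "\<dots> \<le> length (tasks qp pri c)"
      by (meson card_image_le card_length finite_set order_trans)
    finally have "d / (288 * real qp) \<le> N" using LP_ge by (simp add: N_def)
    then have "1 / N \<le> 1 / (d / (288 * real qp))"
      using pos less_le_trans[OF pos(1)] by (intro divide_left_mono mult_pos_pos) auto
    moreover have "0 \<le> tp * (ln (1 + P0 / N0) + 8 * \<alpha> * ln 16) / 25"
      using slot_pos noise_pos power_pos exponent by (auto intro!: divide_nonneg_pos mult_nonneg_nonneg add_nonneg_nonneg)
    ultimately show ?thesis by (simp only: ereal_less_eq) (intro mult_left_mono, simp_all)
  qed
  also have "\<dots> \<le> ereal (12 * tp * (ln (1 + P0 / N0) + 8 * \<alpha> * ln 16) * (real qp / d))"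
  proof -
    \<comment> \<open>12 rounds up \<open>288 / 25\<close>, the loss in the number of linked pairs
      over the frame length.\<close>
    have "0 \<le> tp * (ln (1 + P0 / N0) + 8 * \<alpha> * ln 16) * (real qp / d)"
      using slot_pos noise_pos power_pos exponent d
      by (auto intro!: divide_nonneg_pos mult_nonneg_nonneg add_nonneg_nonneg)
    then have "288 / 25 * (tp * (ln (1 + P0 / N0) + 8 * \<alpha> * ln 16) * (real qp / d))
        \<le> 12 * (tp * (ln (1 + P0 / N0) + 8 * \<alpha> * ln 16) * (real qp / d))"
      by (intro mult_right_mono) auto
    then show ?thesis by (simp add: mult_ac)
  qed
  finally show ?thesis .
qed

end

section \<open>Asymptotics in the density\<close>

text \<open>With nominal cell side \<open>s = sqrt (k * ln d / d)\<close>, \<open>q\<close> is about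
  \<open>1 / s\<close>, and \<open>s * d = sqrt k * sqrt (d * ln d)\<close> gives the order of
  \<open>q / d\<close>. The bound \<open>1 / 144\<close> means \<open>1 / s \<ge> 12\<close>, so
  rounding down loses less than half. Rounding down together with \<open>k \<ge> 1\<close> yields
  the condition for occupied cells.\<close>

lemma cells_per_side_bounds:
  assumes "1 < d" "1 \<le> k" "k * ln d / d \<le> 1 / 144"
  shows "6 \<le> cells_per_side k d" "(real (cells_per_side k d))\<^sup>2 * ln d \<le> d"
    "real (cells_per_side k d) / d \<le> sqrt (1 / (d * ln d))"
    "sqrt (1 / (d * ln d)) / (2 * sqrt k) \<le> real (cells_per_side k d) / d"
proof -
  define s where "s = sqrt (k * ln d / d)"
  define q where "q = cells_per_side k d"
  define l where "l = sqrt (d * ln d)"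
  have l: "0 < ln d" "0 < d" "0 < l" using assms by (auto simp: l_def)
  have s: "0 < s" using l assms by (simp add: s_def)
  have "s \<le> sqrt (1 / 144)" unfolding s_def using assms(3) by (rule real_sqrt_le_mono)
  also have "sqrt (1 / 144) = (1 / 12 :: real)" by (rule real_sqrt_unique) (auto simp: power2_eq_square)
  finally have "12 \<le> 1 / s" using s by (simp add: field_simps)
  then have q: "real q \<le> 1 / s" "1 / s - 1 \<le> real q" "6 \<le> q"
    unfolding q_def cells_per_side_def s_def[symmetric] by linarith+
  have s_eq: "s * d = sqrt k * l"
  proof -
    have "d * sqrt (ln d / d) = sqrt (d\<^sup>2) * sqrt (ln d / d)" using l by simp
    also have "\<dots> = l" unfolding l_def real_sqrt_mult[symmetric] using l by (simp add: power2_eq_square)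
    finally have "d * sqrt (ln d / d) = l" .
    moreover have "s = sqrt k * sqrt (ln d / d)"
      unfolding s_def by (simp add: real_sqrt_mult[symmetric])
    ultimately show ?thesis by (simp add: mult_ac)
  qed
  have k: "1 \<le> sqrt k" using assms(2) by simp
  have f: "sqrt (1 / (d * ln d)) = 1 / l" by (simp add: l_def real_sqrt_divide)
  show "6 \<le> cells_per_side k d" using q(3) by (simp add: q_def)
  have sq: "1 / s / d = 1 / (sqrt k * l)" unfolding s_eq[symmetric] by simp
  have "real q / d \<le> 1 / s / d" using q(1) l by (intro divide_right_mono) auto
  also have "\<dots> \<le> 1 / l" unfolding sq using k l by (intro divide_left_mono) auto
  finally show "real (cells_per_side k d) / d \<le> sqrt (1 / (d * ln d))" by (simp add: q_def f)
  have "(1 / s) / 2 / d \<le> real q / d"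
    using q(2) \<open>12 \<le> 1 / s\<close> l by (intro divide_right_mono) auto
  moreover have "(1 / s) / 2 / d = (1 / s / d) / 2" by simp
  then have "(1 / s) / 2 / d = 1 / l / (2 * sqrt k)" unfolding sq by (simp add: mult_ac)
  ultimately have "1 / l / (2 * sqrt k) \<le> real q / d" by (simp only:)
  then show "sqrt (1 / (d * ln d)) / (2 * sqrt k) \<le> real (cells_per_side k d) / d"
    by (simp only: q_def f)
  have "(real q)\<^sup>2 * ln d \<le> (1 / s)\<^sup>2 * ln d"
    using q(1) l by (intro mult_right_mono power_mono) auto
  also have "\<dots> = d / k" using l assms by (simp add: s_def power_divide)
  also have "\<dots> \<le> d" using l assms by (simp add: field_simps)
  finally show "(real (cells_per_side k d))\<^sup>2 * ln d \<le> d" by (simp add: q_def)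
qed

theorem theorem2:
  fixes \<alpha> \<beta> N0 P0 P1 tp k1 k2 :: real
    and M :: "real \<Rightarrow> 'w measure"
    and pri sec :: "real \<Rightarrow> 'w \<Rightarrow> network"
  assumes "\<alpha> > 2" and "\<beta> > 1" and "N0 > 0" and "P0 > 0" and "P1 > 0" and "tp > 0"
    and "k1 \<ge> 1" and "k2 = k1"
    and "\<And>n. n > 1 \<Longrightarrow> random_network (M n) n (pri n)"
    and "\<And>n. n > 1 \<Longrightarrow> random_network (M n) (n powr \<beta>) (sec n)"
  shows "whp_Theta M
           (\<lambda>n \<omega>. overlay.throughput \<alpha> N0 P0 P1 tp
              (cells_per_side k1 n) (cells_per_side k2 (n powr \<beta>)) (pri n \<omega>) (sec n \<omega>))
           (\<lambda>n. sqrt (1 / (n * ln n)))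
       \<and> whp_Theta M
           (\<lambda>n \<omega>. overlay.sum_throughput \<alpha> N0 P0 P1 tp
              (cells_per_side k1 n) (cells_per_side k2 (n powr \<beta>)) (pri n \<omega>) (sec n \<omega>))
           (\<lambda>n. sqrt (n / ln n))"
proof -
  define T where "T n \<omega> = overlay.throughput \<alpha> N0 P0 P1 tp
    (cells_per_side k1 n) (cells_per_side k2 (n powr \<beta>)) (pri n \<omega>) (sec n \<omega>)" for n \<omega>
  define T' where "T' n \<omega> = overlay.sum_throughput \<alpha> N0 P0 P1 tp
    (cells_per_side k1 n) (cells_per_side k2 (n powr \<beta>)) (pri n \<omega>) (sec n \<omega>)" for n \<omega>
  \<comment> \<open>The value of \<open>rate_floor\<close>, written outside the locale to show that
    it depends neither on \<open>n\<close> nor on the realisation.\<close>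
  define R0 where "R0 = ln (1 + P0 * 4 powr (- \<alpha>) / (N0 + (P0 + P1) * (2 powr \<alpha> * (lattice_total (\<alpha> / 2))\<^sup>2)))"
  define c2 where "c2 = R0 * tp / 100 / (2 * sqrt k1)"
  define c1 where "c1 = 12 * tp * (ln (1 + P0 / N0) + 8 * \<alpha> * ln 16)"
  have "((\<lambda>x :: real. k1 * (ln x / x)) \<longlongrightarrow> k1 * 0) at_top"
    by (intro tendsto_intros ln_x_over_x_tendsto_0)
  then have "\<forall>\<^sub>F x in at_top. k1 * (ln x / x) < 1 / 144"
    by (rule order_tendstoD) simp
  then obtain x0 where x0: "\<And>x. x0 \<le> x \<Longrightarrow> k1 * (ln x / x) < 1 / 144"
    by (auto simp: eventually_at_top_linorder)
  define n0 where "n0 = max x0 12"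
  have R0: "0 < R0"
    unfolding R0_def using assms(3-5)
    by (intro ln_gt_zero) (auto intro!: divide_pos_pos add_pos_nonneg mult_nonneg_nonneg)
  have c2: "0 < c2" using R0 assms by (simp add: c2_def)
  have c1: "0 \<le> c1" using assms by (auto simp: c1_def intro!: mult_nonneg_nonneg add_nonneg_nonneg)
  have main: "\<exists>G\<in>sets (M n). 1 - 725 / ln n \<le> measure (M n) G \<and>
      (\<forall>\<omega>\<in>G. ereal (c2 * sqrt (1 / (n * ln n))) \<le> T n \<omega> \<and> T n \<omega> \<le> ereal (c1 * sqrt (1 / (n * ln n))) \<and>
        ereal (c2 / 4 * sqrt (n / ln n)) \<le> T' n \<omega> \<and> T' n \<omega> \<le> ereal (c1 * sqrt (n / ln n)))"
    if n: "n0 \<le> n" for n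
  proof -
    define q where "q = cells_per_side k1 n"
    define q' where "q' = cells_per_side k2 (n powr \<beta>)"
    define f where "f = sqrt (1 / (n * ln n))"
    have n12: "12 \<le> n" and n1: "1 < n" using n by (auto simp: n0_def)
    have ln: "0 < ln n" using n1 by simp
    have q: "6 \<le> q" "(real q)\<^sup>2 * ln n \<le> n" "real q / n \<le> f" "f / (2 * sqrt k1) \<le> real q / n"
      unfolding q_def f_def using x0[of n] n n1 assms(7)
      by (intro cells_per_side_bounds; simp add: n0_def)+
    \<comment> \<open>The secondary density is at least \<open>n\<close>, so the same threshold
      \<open>x0\<close> also controls the secondary grid.\<close>
    have "n powr 1 \<le> n powr \<beta>" using n1 assms(2) by (intro powr_mono) auto
    then have n\<beta>: "n \<le> n powr \<beta>" using n1 by simp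
    then have q': "6 \<le> q'"
      unfolding q'_def using x0[of "n powr \<beta>"] n n1 assms(7,8)
      by (intro cells_per_side_bounds(1)) (simp_all add: n0_def)
    note net = assms(9)[OF n1] and net' = assms(10)[OF n1]
    obtain G where G: "G \<in> sets (M n)" "1 - 725 * (real q)\<^sup>2 / n \<le> measure (M n) G"
      "\<And>\<omega>. \<omega> \<in> G \<Longrightarrow> typical q n (pri n \<omega>)"
      using random_network_typical[OF net q(1) n12 q(2)] by blast
    have "(real q)\<^sup>2 / n \<le> 1 / ln n" using q(2) ln n1 by (simp add: field_simps)
    then have "1 - 725 / ln n \<le> measure (M n) G" using G(2) by simp
    moreover have "ereal (c2 * f) \<le> T n \<omega> \<and> T n \<omega> \<le> ereal (c1 * f) \<and>
        ereal (c2 / 4 * sqrt (n / ln n)) \<le> T' n \<omega> \<and> T' n \<omega> \<le> ereal (c1 * sqrt (n / ln n))"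
      if \<omega>: "\<omega> \<in> G" for \<omega>
    proof -
      have sp: "\<omega> \<in> space (M n)" using \<omega> G(1) sets.sets_into_space by blast
      have typical: "typical q n (pri n \<omega>)" using G(3)[OF \<omega>] .
      have sq: "node_set (pri n \<omega>) \<subseteq> unit_square" "node_set (sec n \<omega>) \<subseteq> unit_square"
        using net net' sp by (auto simp: random_network_def poisson_process_def)
      interpret regular_overlay \<alpha> N0 P0 P1 tp q q' "pri n \<omega>" "sec n \<omega>"
      proof
        show "inj_on (node_pos (pri n \<omega>)) {..<node_count (pri n \<omega>)}"
          "shuffle (pri n \<omega>) permutes {..<node_count (pri n \<omega>)}"
          using net sp by (auto simp: random_network_def)
        show "cell_nodes q (pri n \<omega>) c \<noteq> []" if "fst c < q" "snd c < q" for c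
          using typical that unfolding typical_def by blast
      qed (use assms q(1) q' sq in \<open>auto simp: node_set_def\<close>)
      have T: "T n \<omega> = throughput" "T' n \<omega> = sum_throughput"
        by (simp_all add: T_def T'_def q_def q'_def)
      have R0_eq: "rate_floor = R0" by (simp add: rate_floor_def R0_def interference_bound_def)
      have "c2 * f = R0 * tp / 100 * (f / (2 * sqrt k1))" by (simp add: c2_def)
      also have "\<dots> \<le> rate_floor * tp / 100 * (real q / n)"
        unfolding R0_eq using q(4) R0 assms(6) by (intro mult_left_mono) auto
      finally have "ereal (c2 * f) \<le> ereal (rate_floor * tp / 100 * (real q / n))" by simp
      then have lo: "ereal (c2 * f) \<le> throughput"
        using typical_throughput_ge[OF typical] by (rule order_trans)
      have "12 * tp * (ln (1 + P0 / N0) + 8 * \<alpha> * ln 16) * (real q / n) \<le> c1 * f"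
        unfolding c1_def[symmetric] using q(3) c1 by (intro mult_left_mono) auto
      then have "ereal (12 * tp * (ln (1 + P0 / N0) + 8 * \<alpha> * ln 16) * (real q / n)) \<le> ereal (c1 * f)" by simp
      with typical_throughput_le[OF typical _ q(1)] n1 have up: "throughput \<le> ereal (c1 * f)"
        by (intro order_trans[OF typical_throughput_le[OF typical _ q(1)]]) auto
      have N: "n / 2 \<le> real (node_count (pri n \<omega>))" "real (node_count (pri n \<omega>)) \<le> 2 * n"
        using typical by (auto simp: typical_def)
      have nf: "n * f = sqrt (n / ln n)"
      proof -
        have "n * f = sqrt (n\<^sup>2) * f" using n1 by simp
        also have "\<dots> = sqrt (n\<^sup>2 * (1 / (n * ln n)))" unfolding f_def by (rule real_sqrt_mult[symmetric])
        also have "n\<^sup>2 * (1 / (n * ln n)) = n / ln n" using n1 by (simp add: power2_eq_square)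
        finally show ?thesis .
      qed
      have f0: "0 \<le> f" using ln n1 by (simp add: f_def)
      \<comment> \<open>Both bounds are finite, so the infimum is a real number and the sum
        throughput can be estimated in the reals.\<close>
      obtain \<tau> where \<tau>: "throughput = ereal \<tau>" using lo up by (cases throughput) auto
      have \<tau>': "c2 * f \<le> \<tau>" "\<tau> \<le> c1 * f" "0 \<le> \<tau>"
        using lo up c2 f0 by (auto simp: \<tau> intro: order_trans[of _ "c2 * f"])
      have sum: "sum_throughput = ereal (real (node_count (pri n \<omega>)) / 2 * \<tau>)"
        by (simp add: sum_throughput_def \<tau>)
      \<comment> \<open>One factor 2 comes from the definition of the sum throughput, the other from
        the node count being at least \<open>n / 2\<close>. Above, \<open>2 * n\<close> nodes make
        \<open>n\<close> pairs, which leaves \<open>c1\<close> unchanged.\<close>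
      have "c2 / 4 * (n * f) = n / 2 / 2 * (c2 * f)" by simp
      also have "\<dots> \<le> real (node_count (pri n \<omega>)) / 2 * \<tau>"
        using N \<tau>' c2 f0 n1 by (intro mult_mono) auto
      finally have "ereal (c2 / 4 * sqrt (n / ln n)) \<le> sum_throughput" by (simp add: sum nf)
      moreover have "real (node_count (pri n \<omega>)) / 2 * \<tau> \<le> n * (c1 * f)"
        using N \<tau>' n1 by (intro mult_mono) auto
      then have "sum_throughput \<le> ereal (c1 * sqrt (n / ln n))" by (simp add: sum nf[symmetric] mult_ac)
      ultimately show ?thesis using lo up unfolding T by blast
    qed
    ultimately show ?thesis using G(1) unfolding f_def by blast
  qed
  then obtain G where G: "\<And>n. n0 \<le> n \<Longrightarrow> G n \<in> sets (M n)"
    "\<And>n. n0 \<le> n \<Longrightarrow> 1 - 725 / ln n \<le> measure (M n) (G n)"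
    "\<And>n \<omega>. n0 \<le> n \<Longrightarrow> \<omega> \<in> G n \<Longrightarrow> ereal (c2 * sqrt (1 / (n * ln n))) \<le> T n \<omega>
      \<and> T n \<omega> \<le> ereal (c1 * sqrt (1 / (n * ln n))) \<and>
        ereal (c2 / 4 * sqrt (n / ln n)) \<le> T' n \<omega> \<and> T' n \<omega> \<le> ereal (c1 * sqrt (n / ln n))"
    by metis
  \<comment> \<open>\<open>whp\<close> asks for a measurable subevent at every real
    \<open>n\<close>; the empty set serves below \<open>n0\<close>.\<close>
  define A where "A n = (if n0 \<le> n then G n else {})" for n
  have "((\<lambda>n. measure (M n) (A n)) \<longlongrightarrow> 1) at_top"
  proof (rule tendsto_sandwich)
    show "\<forall>\<^sub>F n in at_top. 1 - 725 / ln n \<le> measure (M n) (A n)"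
      using eventually_ge_at_top[of n0] by eventually_elim (simp add: A_def G)
    show "\<forall>\<^sub>F n in at_top. measure (M n) (A n) \<le> 1"
      using eventually_gt_at_top[of 1]
    proof eventually_elim
      case (elim n)
      then interpret prob_space "M n" using assms(9) by (simp add: random_network_def poisson_process_def)
      show ?case by (rule prob_le_1)
    qed
    have "((\<lambda>n :: real. 725 / ln n) \<longlongrightarrow> 0) at_top"
      by (rule tendsto_divide_0[OF tendsto_const filterlim_at_top_imp_at_infinity[OF ln_at_top]])
    from tendsto_diff[OF tendsto_const[of 1] this]
    show "((\<lambda>n :: real. 1 - 725 / ln n) \<longlongrightarrow> 1) at_top" by simp
  qed simp
  moreover have "A n \<in> sets (M n)" for n by (simp add: A_def G)
  ultimately have whp: "whp M P" if "\<And>n \<omega>. n0 \<le> n \<Longrightarrow> \<omega> \<in> G n \<Longrightarrow> P n \<omega>" for P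
    unfolding whp_def using that by (intro exI[of _ A]) (auto simp: A_def split: if_splits)
  have "whp M (\<lambda>n \<omega>. ereal (c2 * sqrt (1 / (n * ln n))) \<le> T n \<omega> \<and> T n \<omega> \<le> ereal (c1 * sqrt (1 / (n * ln n))))"
    using G(3) by (intro whp) blast
  moreover have "whp M (\<lambda>n \<omega>. ereal (c2 / 4 * sqrt (n / ln n)) \<le> T' n \<omega> \<and> T' n \<omega> \<le> ereal (c1 * sqrt (n / ln n)))"
    using G(3) by (intro whp) blast
  moreover have "0 < c2 / 4" using c2 by simp
  ultimately show ?thesis
    unfolding whp_Theta_def T_def[symmetric] T'_def[symmetric] using c2 by blast
qed

end
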